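(* Let $(D,\mu)$ be a measure space and let $H$ be a reproducing kernel Hilbert space of functions on $D$ with kernel $K$, contained in $L_2=L_2(D,\mu)$, such that $$\sup_{f\in H\setminus\{0\}}\frac{\|f\|_2^2}{\|f\|_H^2}<\infty,\qquad \|f\|_2\neq 0\ \text{ for all } f\in H\setminus\{0\},\qquad \int_D K(x,x)\,d\mu(x)<\infty .$$ Let $B_H$ be the unit ball of $H$, and let $\sigma_0\ge\sigma_1\ge\dots$ be the singular values of the embedding $H\hookrightarrow L_2$. Then, for all integers $m\ge 1$ and $n\ge m$, $$g_n^{\rm lin}(B_H,L_2)\ \le\ \Big(1+\frac{1}{1-r}\Big)\Big(\sigma_m+\sqrt{\frac1n\sum_{k>m}\sigma_k^2}\Big),\qquad r=\sqrt{\frac{m-1}{n}} .$$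
   Context: Functions are complex-valued, and $L_2(D,\mu)$ consists of functions, not equivalence classes; $\|\cdot\|_2$ is its norm. A reproducing kernel Hilbert space on $D$ is a Hilbert space of functions on $D$ with continuous point evaluations; its kernel satisfies $\langle f,K(x,\cdot)\rangle_H=f(x)$. Under the stated conditions the embedding $H\hookrightarrow L_2$ is Hilbert–Schmidt; singular values are counted with multiplicity, indexed from $0$, with $\sigma_k=0$ for $k\ge\dim H$. For a class $F\subset Y$ in a (semi-)normed space $Y\subset\mathbb C^D$ of functions on $D$, the linear sampling numbers are $$g_n^{\rm lin}(F,Y):=\inf_{\substack{x_1,\dots,x_n\in D\\ \varphi_1,\dots,\varphi_n\in Y}}\ \sup_{f\in F}\Big\|f-\sum_{i=1}^n f(x_i)\,\varphi_i\Big\|_Y .$$ *)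

theory Defs
  imports "HOL-Analysis.Analysis" "HOL-Library.Function_Algebras"
begin

text \<open>
  A subset D of a type plays the role of the domain. The space of all complex-valued functions
  on D is represented by the functions on the whole type that vanish outside D, so that
  equality of functions is equality on D and the pointwise vector space structure is inherited.
\<close>

definition functions_on :: "'a set \<Rightarrow> ('a \<Rightarrow> complex) set"
  where "functions_on D = {f. \<forall>x. x \<notin> D \<longrightarrow> f x = 0}"

definition cscale :: "complex \<Rightarrow> ('a \<Rightarrow> complex) \<Rightarrow> 'a \<Rightarrow> complex"
  where "cscale c f = (\<lambda>x. c * f x)"

interpretation cfun: vector_space cscale
  by unfold_locales (auto simp: cscale_def fun_eq_iff algebra_simps)

definition ip_norm :: "(('a \<Rightarrow> complex) \<Rightarrow> ('a \<Rightarrow> complex) \<Rightarrow> complex) \<Rightarrow> ('a \<Rightarrow> complex) \<Rightarrow> real"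
  where "ip_norm ip f = sqrt (Re (ip f f))"

text \<open>
  Inner products are linear in the first argument; this is forced by the reproducing property
  in the form used below.
\<close>

locale hilbert_function_space =
  fixes D :: "'a set"
    and H :: "('a \<Rightarrow> complex) set"
    and ip :: "('a \<Rightarrow> complex) \<Rightarrow> ('a \<Rightarrow> complex) \<Rightarrow> complex"
  assumes on_domain: "H \<subseteq> functions_on D"
    and subspace: "cfun.subspace H"
    and ip_add: "\<lbrakk>f \<in> H; g \<in> H; h \<in> H\<rbrakk> \<Longrightarrow> ip (f + g) h = ip f h + ip g h"
    and ip_scale: "\<lbrakk>f \<in> H; g \<in> H\<rbrakk> \<Longrightarrow> ip (cscale c f) g = c * ip f g"
    and ip_commute: "\<lbrakk>f \<in> H; g \<in> H\<rbrakk> \<Longrightarrow> ip g f = cnj (ip f g)"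
    and ip_pos: "\<lbrakk>f \<in> H; f \<noteq> 0\<rbrakk> \<Longrightarrow> 0 < Re (ip f f)"
    and complete:
      "\<lbrakk>\<And>k::nat. s k \<in> H;
        \<And>e. e > 0 \<Longrightarrow> \<exists>N. \<forall>i\<ge>N. \<forall>j\<ge>N. ip_norm ip (s i - s j) < e\<rbrakk>
       \<Longrightarrow> \<exists>f\<in>H. (\<lambda>k. ip_norm ip (s k - f)) \<longlonglongrightarrow> 0"

locale rkhs = hilbert_function_space +
  fixes K :: "'a \<Rightarrow> 'a \<Rightarrow> complex"
  assumes continuous_evaluation: "x \<in> D \<Longrightarrow> \<exists>C. \<forall>f\<in>H. cmod (f x) \<le> C * ip_norm ip f"
    and kernel_mem: "x \<in> D \<Longrightarrow> K x \<in> H"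
    and reproducing: "\<lbrakk>x \<in> D; f \<in> H\<rbrakk> \<Longrightarrow> ip f (K x) = f x"

text \<open>Square integrable functions (not equivalence classes); the norm below is a seminorm there.\<close>

definition L2_funs :: "'a measure \<Rightarrow> ('a \<Rightarrow> complex) set"
  where "L2_funs M = {f \<in> functions_on (space M).
           f \<in> borel_measurable M \<and> integrable M (\<lambda>x. (cmod (f x))\<^sup>2)}"

definition L2_inner :: "'a measure \<Rightarrow> ('a \<Rightarrow> complex) \<Rightarrow> ('a \<Rightarrow> complex) \<Rightarrow> complex"
  where "L2_inner M f g = (\<integral>x. f x * cnj (g x) \<partial>M)"

definition L2_norm :: "'a measure \<Rightarrow> ('a \<Rightarrow> complex) \<Rightarrow> real"
  where "L2_norm M f = sqrt (\<integral>x. (cmod (f x))\<^sup>2 \<partial>M)"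

text \<open>
  Let T be the embedding of H into the square integrable functions. Its adjoint is determined
  by: the inner product in H of T* T f with g equals the inner product of f with g over M, for
  all g in H. Hence the set below is the kernel of T* T - a, that is, the eigenspace of T* T
  for a, together with 0.
\<close>

definition embedding_eigenspace ::
    "'a measure \<Rightarrow> ('a \<Rightarrow> complex) set \<Rightarrow> (('a \<Rightarrow> complex) \<Rightarrow> ('a \<Rightarrow> complex) \<Rightarrow> complex)
      \<Rightarrow> real \<Rightarrow> ('a \<Rightarrow> complex) set"
  where "embedding_eigenspace M H ip a =
           {f \<in> H. \<forall>g\<in>H. L2_inner M f g = complex_of_real a * ip f g}"

text \<open>
  The sequence s is the non-increasing enumeration of the square roots of the positive
  eigenvalues of T* T, in which each t > 0 is listed as many times as the dimension of the
  eigenspace for the square of t (not at all if that space is trivial), continued by zeros if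
  there are only finitely many. For a compact embedding exactly one sequence has these
  properties.
\<close>

definition embedding_singular_values ::
    "'a measure \<Rightarrow> ('a \<Rightarrow> complex) set \<Rightarrow> (('a \<Rightarrow> complex) \<Rightarrow> ('a \<Rightarrow> complex) \<Rightarrow> complex)
      \<Rightarrow> (nat \<Rightarrow> real) \<Rightarrow> bool"
  where "embedding_singular_values M H ip s \<longleftrightarrow>
           (\<forall>k. 0 \<le> s k) \<and> decseq s \<and>
           (\<forall>t>0. \<exists>B b. cfun.independent B \<and>
              cfun.span B = embedding_eigenspace M H ip (t\<^sup>2) \<and>
              bij_betw b {k. s k = t} B)"

text \<open>
  Linear sampling numbers of a class F in a space Y of functions on D with seminorm p, with
  infimum and supremum taken in the extended nonnegative reals.
\<close>

definition lin_sampling_number ::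
    "'a set \<Rightarrow> ('a \<Rightarrow> complex) set \<Rightarrow> (('a \<Rightarrow> complex) \<Rightarrow> real) \<Rightarrow> ('a \<Rightarrow> complex) set
      \<Rightarrow> nat \<Rightarrow> ennreal"
  where "lin_sampling_number D Y p F n =
           (INF (x, \<phi>) \<in> ({1..n} \<rightarrow> D) \<times> ({1..n} \<rightarrow> Y).
              SUP f\<in>F. ennreal (p (\<lambda>t. f t - (\<Sum>i=1..n. f (x i) * \<phi> i t))))"

end

theory Submission
  imports Defs "Jordan_Normal_Form.Determinant"
begin

text \<open>
  Let \<open>e\<^sub>k\<close> be the singular functions of the embedding, orthonormal in \<open>H\<close>, so that the functions
  \<open>b\<^sub>k = e\<^sub>k / \<sigma>\<^sub>k\<close> are orthonormal in \<open>L\<^sub>2\<close>. Given points \<open>x\<^sub>i\<close> and weights \<open>w\<^sub>i\<close>, let \<open>A f\<close> be the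
  weighted least squares fit of \<open>f\<close> by \<open>b\<^sub>0, \<dots>, b\<^sub>m\<^sub>-\<^sub>1\<close>. It is linear in the samples of \<open>f\<close> and
  reproduces the span of these functions. If \<open>g\<close> denotes the part of \<open>f\<close> orthogonal to that span, then
  \<open>f - A f = g - A g\<close>, and the two terms are orthogonal in \<open>L\<^sub>2\<close>. The first has norm at most
  \<open>\<sigma>\<^sub>m\<close>. The square of the second is at most \<open>\<alpha>\<^sup>-\<^sup>1 \<Sum>\<^sub>i w\<^sub>i |g(x\<^sub>i)|\<^sup>2\<close>, where \<open>\<alpha>\<close> is the smallest
  eigenvalue of the Gram matrix of \<open>b\<^sub>0, \<dots>, b\<^sub>m\<^sub>-\<^sub>1\<close> for the weighted points
  (lemma \<open>weighted_least_squares\<close>). So points and weights are needed for which \<open>\<alpha>\<close> is large while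
  \<open>\<Sum>\<^sub>i w\<^sub>i |g(x\<^sub>i)|\<^sup>2\<close> is small for all \<open>g\<close> in the unit ball at once.

  They are found one at a time by the barrier method of Batson, Spielman and Srivastava
  (lemma \<open>two_sided_sparsification\<close>). Two positive definite matrices record the distance of the current
  Gram matrices to a lower and an upper barrier, and both barriers move upwards in every step. Averaging
  over the measure shows that some point can be added, with a suitable weight, such that neither of the
  two traces of inverse matrices grows. Two refinements give the constants of the theorem.
  First, a positive definite matrix whose inverse has trace at most \<open>c\<close> is at least \<open>1/c\<close>. So the final
  Gram matrices keep a distance \<open>1/c\<close> from the barriers, which turns \<open>m\<close> into \<open>m - 1\<close> and removes
  \<open>\<sigma>\<^sub>m\<^sup>2\<close> from the sum of the squares. Second, the upper barrier is run for the orthonormal functions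
  \<open>b\<^sub>k\<close>, \<open>k \<ge> m\<close>, and the singular values enter only through the initial matrix, which is diagonal
  with entries \<open>u / \<sigma>\<^sub>k\<^sup>2\<close>. Then the motion of the barrier costs a multiple of \<open>\<sigma>\<^sub>m\<^sup>2\<close>, and the
  sum of all squares enters only once.

  Matrices are finite, so the singular functions are cut off at a large index \<open>N\<close>. The rest of \<open>g\<close> is
  controlled by the diagonal of the remaining kernel, whose integral tends to zero (lemma \<open>truncation\<close>),
  and a bound for one nonnegative integrable function can be included in the averaging at arbitrarily small cost. That
  integral tends to zero because \<open>\<parallel>f\<parallel>\<^sub>2 \<le> \<sigma>\<^sub>N \<parallel>f\<parallel>\<^sub>H\<close> for \<open>f\<close> orthogonal to
  \<open>e\<^sub>0, \<dots>, e\<^sub>N\<^sub>-\<^sub>1\<close> (lemma \<open>W_bound\<close>). This is what is needed of the spectral theorem for the embedding, and it rests on the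
  fact that the Rayleigh quotient attains its supremum on every nonzero orthogonal complement in \<open>H\<close>
  (lemma \<open>rayleigh_attained\<close>).

  Write \<open>X = \<sigma>\<^sub>m + (n\<^sup>-\<^sup>1 \<Sum>\<^sub>k\<^sub>>\<^sub>m \<sigma>\<^sub>k\<^sup>2)\<^sup>1\<^sup>/\<^sup>2\<close>. The optimal parameters of the upper barrier would bound
  the sums \<open>\<Sum>\<^sub>i w\<^sub>i |g(x\<^sub>i)|\<^sup>2\<close> by \<open>n X\<^sup>2\<close>, but they are admissible only if the sum in \<open>X\<close> is not too
  small. Slightly different parameters are always admissible and give \<open>(n + 1) X\<^sup>2\<close>
  (lemma \<open>upper_parameters\<close>). The loss, together with the truncation error, is paid by the orthogonality
  of the two error terms. For \<open>m \<ge> 2\<close> the square of the error is at most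
  \<open>(1 + (1 + 1/(2n))\<^sup>2 / (1-r)\<^sup>2) X\<^sup>2\<close>, and \<open>1 - r\<close> exceeds \<open>1/(2n)\<close> by enough to make this at most
  \<open>(1 + 1/(1-r))\<^sup>2 X\<^sup>2\<close>. The case \<open>m = 1\<close>, where \<open>r = 0\<close>, leaves more room
  (lemma \<open>lower_parameters\<close>).
\<close>

section \<open>Quadratic forms of complex matrices\<close>

no_notation Finite_Cartesian_Product.vec.vec_nth (infixl "$" 90)

abbreviation norm2 :: "nat \<Rightarrow> (nat \<Rightarrow> complex) \<Rightarrow> real"
  where "norm2 d z \<equiv> \<Sum>k<d. (cmod (z k))\<^sup>2"

abbreviation vnorm2 :: "nat \<Rightarrow> complex Matrix.vec \<Rightarrow> real"
  where "vnorm2 d v \<equiv> \<Sum>k<d. (cmod (v $ k))\<^sup>2"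

definition madj :: "complex mat \<Rightarrow> complex mat"
  where "madj A = mat (dim_col A) (dim_row A) (\<lambda>(i,j). cnj (A $$ (j,i)))"

definition mtrace :: "complex mat \<Rightarrow> complex"
  where "mtrace A = (\<Sum>i<dim_row A. A $$ (i,i))"

definition quad :: "complex mat \<Rightarrow> complex Matrix.vec \<Rightarrow> real"
  where "quad A v = Re ((A *\<^sub>v v) \<bullet>c v)"

definition outer :: "complex Matrix.vec \<Rightarrow> complex mat"
  where "outer v = mat (dim_vec v) (dim_vec v) (\<lambda>(i,j). v $ i * cnj (v $ j))"

definition pos_def :: "nat \<Rightarrow> complex mat \<Rightarrow> bool"
  where "pos_def d A \<longleftrightarrow> A \<in> carrier_mat d d \<and> madj A = A \<and>
    (\<forall>v \<in> carrier_vec d. v \<noteq> 0\<^sub>v d \<longrightarrow> 0 < quad A v)"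

lemma madj_carrier[simp]: "A \<in> carrier_mat d e \<Longrightarrow> madj A \<in> carrier_mat e d"
  by (auto simp: madj_def)

lemma outer_carrier[simp]: "v \<in> carrier_vec d \<Longrightarrow> outer v \<in> carrier_mat d d"
  by (auto simp: outer_def)

lemma cip_sum: "(v :: complex Matrix.vec) \<in> carrier_vec d \<Longrightarrow> u \<bullet>c v = (\<Sum>i<d. u $ i * cnj (v $ i))"
  by (auto simp: scalar_prod_def atLeast0LessThan)

lemma mult_index: "A \<in> carrier_mat d e \<Longrightarrow> B \<in> carrier_mat e f \<Longrightarrow> i < d \<Longrightarrow> j < f \<Longrightarrow>
   (A * B) $$ (i,j) = (\<Sum>k<e. A $$ (i,k) * B $$ (k,j))"
  by (auto simp: scalar_prod_def atLeast0LessThan)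

lemma mult_vec_index: "A \<in> carrier_mat d e \<Longrightarrow> v \<in> carrier_vec e \<Longrightarrow> i < d \<Longrightarrow>
   (A *\<^sub>v v) $ i = (\<Sum>k<e. A $$ (i,k) * v $ k)"
  by (auto simp: scalar_prod_def atLeast0LessThan)

lemma madj_mult:
  assumes "A \<in> carrier_mat d e" "B \<in> carrier_mat e f"
  shows "madj (A * B) = madj B * madj A"
proof (rule eq_matI)
  fix i j assume "i < dim_row (madj B * madj A)" "j < dim_col (madj B * madj A)"
  then have ij: "i < f" "j < d" using assms by (auto simp: madj_def)
  have "madj (A * B) $$ (i,j) = cnj ((A * B) $$ (j,i))"
    using assms ij by (auto simp: madj_def)
  also have "\<dots> = (\<Sum>k<e. cnj (A $$ (j,k)) * cnj (B $$ (k,i)))"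
    by (subst mult_index[OF assms ij(2,1)]) simp
  also have "\<dots> = (\<Sum>k<e. madj B $$ (i,k) * madj A $$ (k,j))"
    using assms ij by (intro sum.cong) (auto simp: madj_def)
  also have "\<dots> = (madj B * madj A) $$ (i,j)"
    by (rule mult_index[symmetric, where d=f and e=e and f=d]) (use assms ij in auto)
  finally show "madj (A * B) $$ (i,j) = (madj B * madj A) $$ (i,j)" .
qed (use assms in \<open>auto simp: madj_def\<close>)

lemma madj_add: "A \<in> carrier_mat d e \<Longrightarrow> B \<in> carrier_mat d e \<Longrightarrow> madj (A + B) = madj A + madj B"
  by (rule eq_matI) (auto simp: madj_def)
lemma madj_minus: "A \<in> carrier_mat d e \<Longrightarrow> B \<in> carrier_mat d e \<Longrightarrow> madj (A - B) = madj A - madj B"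
  by (rule eq_matI) (auto simp: madj_def)
lemma madj_smult: "madj (c \<cdot>\<^sub>m A) = cnj c \<cdot>\<^sub>m madj A"
  by (rule eq_matI) (auto simp: madj_def)
lemma madj_one[simp]: "madj (1\<^sub>m d) = 1\<^sub>m d"
  by (rule eq_matI) (auto simp: madj_def)
lemma madj_outer[simp]: "madj (outer v) = outer v"
  by (rule eq_matI) (auto simp: madj_def outer_def)

lemma mtrace_mult_commute:
  assumes "A \<in> carrier_mat d e" "B \<in> carrier_mat e d"
  shows "mtrace (A * B) = mtrace (B * A)"
proof -
  have "mtrace (A * B) = (\<Sum>i<d. \<Sum>k<e. A $$ (i,k) * B $$ (k,i))"
    unfolding mtrace_def using assms by (intro sum.cong) (auto simp del: index_mult_mat(1) simp: mult_index)
  also have "\<dots> = (\<Sum>k<e. \<Sum>i<d. B $$ (k,i) * A $$ (i,k))"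
    by (subst sum.swap) (simp add: mult.commute)
  also have "\<dots> = mtrace (B * A)"
    unfolding mtrace_def using assms by (intro sum.cong) (auto simp del: index_mult_mat(1) simp: mult_index)
  finally show ?thesis .
qed

lemma mtrace_add: "A \<in> carrier_mat d d \<Longrightarrow> B \<in> carrier_mat d d \<Longrightarrow> mtrace (A + B) = mtrace A + mtrace B"
  by (auto simp: mtrace_def sum.distrib)
lemma mtrace_minus: "A \<in> carrier_mat d d \<Longrightarrow> B \<in> carrier_mat d d \<Longrightarrow> mtrace (A - B) = mtrace A - mtrace B"
  by (auto simp: mtrace_def sum_subtractf)
lemma mtrace_smult: "A \<in> carrier_mat d d \<Longrightarrow> mtrace (c \<cdot>\<^sub>m A) = c * mtrace A"
  by (auto simp: mtrace_def sum_distrib_left)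

lemma madj_cip:
  assumes A: "A \<in> carrier_mat d e" and u: "u \<in> carrier_vec e" and v: "v \<in> carrier_vec d"
  shows "(A *\<^sub>v u) \<bullet>c v = u \<bullet>c (madj A *\<^sub>v v)"
proof -
  have "(A *\<^sub>v u) \<bullet>c v = (\<Sum>i<d. \<Sum>k<e. A $$ (i,k) * u $ k * cnj (v $ i))"
    using mult_vec_index[OF A u] by (subst cip_sum[OF v]) (simp add: sum_distrib_right del: index_mult_mat_vec)
  also have "\<dots> = (\<Sum>k<e. \<Sum>i<d. u $ k * (A $$ (i,k) * cnj (v $ i)))"
    by (subst sum.swap) (simp add: mult_ac)
  also have "\<dots> = (\<Sum>k<e. u $ k * cnj ((madj A *\<^sub>v v) $ k))"
  proof (intro sum.cong refl)
    fix k assume "k \<in> {..<e}"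
    then have k: "k < e" by simp
    have "cnj ((madj A *\<^sub>v v) $ k) = (\<Sum>i<d. A $$ (i,k) * cnj (v $ i))"
      by (subst mult_vec_index[OF madj_carrier[OF A] v k]) (use A k in \<open>auto simp: madj_def\<close>)
    then show "(\<Sum>i<d. u $ k * (A $$ (i,k) * cnj (v $ i))) = u $ k * cnj ((madj A *\<^sub>v v) $ k)"
      by (simp add: sum_distrib_left)
  qed
  also have "\<dots> = u \<bullet>c (madj A *\<^sub>v v)"
    by (rule cip_sum[symmetric], rule mult_mat_vec_carrier[OF madj_carrier[OF A] v])
  finally show ?thesis .
qed

lemma cip_cnj:
  assumes "u \<in> carrier_vec d" "v \<in> carrier_vec d"
  shows "v \<bullet>c u = cnj ((u :: complex Matrix.vec) \<bullet>c v)"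
  using assms by (simp add: cip_sum mult.commute)

lemma cip_self:
  assumes "v \<in> carrier_vec d"
  shows "v \<bullet>c v = complex_of_real (vnorm2 d v)"
  using assms by (simp add: cip_sum complex_norm_square[symmetric] del: of_real_power)

lemma outer_mult_vec:
  assumes "u \<in> carrier_vec d" "v \<in> carrier_vec d"
  shows "outer v *\<^sub>v u = (u \<bullet>c v) \<cdot>\<^sub>v v"
proof (rule eq_vecI)
  fix i assume "i < dim_vec ((u \<bullet>c v) \<cdot>\<^sub>v v)"
  then have i: "i < d" using assms by auto
  have "(outer v *\<^sub>v u) $ i = (\<Sum>k<d. v $ i * (u $ k * cnj (v $ k)))"
    by (subst mult_vec_index[OF outer_carrier assms(1) i]) (use assms i in \<open>auto simp: outer_def mult_ac\<close>)
  then show "(outer v *\<^sub>v u) $ i = ((u \<bullet>c v) \<cdot>\<^sub>v v) $ i"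
    using assms i by (simp add: cip_sum[OF assms(2)] sum_distrib_left[symmetric] del: index_mult_mat_vec)
qed (use assms in \<open>auto simp: outer_def\<close>)

lemma mtrace_mult_outer:
  assumes A: "A \<in> carrier_mat d d" and v: "v \<in> carrier_vec d"
  shows "mtrace (A * outer v) = (A *\<^sub>v v) \<bullet>c v"
proof -
  have "mtrace (A * outer v) = (\<Sum>i<d. (A * outer v) $$ (i,i))" using A by (simp add: mtrace_def)
  also have "\<dots> = (\<Sum>i<d. \<Sum>k<d. A $$ (i,k) * (v $ k * cnj (v $ i)))"
  proof (intro sum.cong refl)
    fix i assume "i \<in> {..<d}"
    then have i: "i < d" by simp
    show "(A * outer v) $$ (i,i) = (\<Sum>k<d. A $$ (i,k) * (v $ k * cnj (v $ i)))"
      by (subst mult_index[OF A outer_carrier[OF v] i i]) (use v i in \<open>auto simp: outer_def\<close>)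
  qed
  also have "\<dots> = (A *\<^sub>v v) \<bullet>c v"
    using mult_vec_index[OF A v]
    by (subst cip_sum[OF v]) (simp add: sum_distrib_right sum_distrib_left mult_ac del: index_mult_mat_vec)
  finally show ?thesis .
qed

lemma quad_outer:
  assumes "u \<in> carrier_vec d" "v \<in> carrier_vec d"
  shows "quad (outer v) u = (cmod (u \<bullet>c v))\<^sup>2"
proof -
  have "(outer v *\<^sub>v u) \<bullet>c u = (u \<bullet>c v) * (v \<bullet>c u)"
    using assms by (simp add: outer_mult_vec[OF assms])
  also have "\<dots> = (u \<bullet>c v) * cnj (u \<bullet>c v)" by (simp only: cip_cnj[OF assms])
  also have "\<dots> = complex_of_real ((cmod (u \<bullet>c v))\<^sup>2)" by (rule complex_norm_square[symmetric])
  finally show ?thesis by (simp only: quad_def Re_complex_of_real)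
qed

lemma quad_add:
  assumes "A \<in> carrier_mat d d" "B \<in> carrier_mat d d" "v \<in> carrier_vec d"
  shows "quad (A + B) v = quad A v + quad B v"
  using assms by (simp add: quad_def add_mult_distrib_mat_vec[OF assms] add_scalar_prod_distrib[of _ d])
lemma quad_smult:
  assumes "A \<in> carrier_mat d d" "v \<in> carrier_vec d"
  shows "quad (complex_of_real c \<cdot>\<^sub>m A) v = c * quad A v"
proof -
  have "(complex_of_real c \<cdot>\<^sub>m A) *\<^sub>v v = complex_of_real c \<cdot>\<^sub>v (A *\<^sub>v v)"
    using assms by (intro eq_vecI) auto
  then show ?thesis using assms by (simp add: quad_def)
qed
lemma quad_minus:
  assumes "A \<in> carrier_mat d d" "B \<in> carrier_mat d d" "v \<in> carrier_vec d"
  shows "quad (A - B) v = quad A v - quad B v"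
  using assms by (simp add: quad_def minus_mult_distrib_mat_vec[OF assms] minus_scalar_prod_distrib[of _ d])
lemma quad_one: "v \<in> carrier_vec d \<Longrightarrow> quad (1\<^sub>m d) v = (vnorm2 d v)"
  by (simp add: quad_def cip_self)

lemma quad_congr:
  assumes "A \<in> carrier_mat d d" "C \<in> carrier_mat d d" "v \<in> carrier_vec d"
  shows "quad (madj C * A * C) v = quad A (C *\<^sub>v v)"
proof -
  have "(madj C * A * C) *\<^sub>v v = madj C *\<^sub>v (A *\<^sub>v (C *\<^sub>v v))"
    using assoc_mult_mat_vec[OF mult_carrier_mat[OF madj_carrier[OF assms(2)] assms(1)] assms(2,3)]
      assoc_mult_mat_vec[OF madj_carrier[OF assms(2)] assms(1) mult_mat_vec_carrier[OF assms(2,3)]]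
    by simp
  moreover have "\<dots> \<bullet>c v = (A *\<^sub>v (C *\<^sub>v v)) \<bullet>c (madj (madj C) *\<^sub>v v)"
    using assms by (intro madj_cip[where d=d and e=d]) auto
  moreover have "madj (madj C) = C" by (rule eq_matI) (auto simp: madj_def)
  ultimately show ?thesis by (simp add: quad_def)
qed

lemma mtrace_quad:
  assumes "A \<in> carrier_mat d d"
  shows "Re (mtrace A) = (\<Sum>i<d. quad A (unit_vec d i))"
proof -
  have "quad A (unit_vec d i) = Re (A $$ (i,i))" if "i < d" for i
  proof -
    have "(A *\<^sub>v unit_vec d i) \<bullet>c unit_vec d i = (\<Sum>k<d. (A *\<^sub>v unit_vec d i) $ k * (if k = i then 1 else 0))"
      using assms that by (subst cip_sum[where d=d]) (auto intro!: sum.cong)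
    also have "\<dots> = (\<Sum>k<d. if k = i then (A *\<^sub>v unit_vec d i) $ i else 0)"
      by (intro sum.cong) auto
    also have "\<dots> = A $$ (i,i)" using assms that by simp
    finally show ?thesis by (simp add: quad_def)
  qed
  then show ?thesis using assms by (simp add: mtrace_def)
qed

section \<open>Positive definite matrices\<close>

lemma pos_def_carrier: "pos_def d A \<Longrightarrow> A \<in> carrier_mat d d" by (simp add: pos_def_def)
lemma pos_def_madj: "pos_def d A \<Longrightarrow> madj A = A" by (simp add: pos_def_def)
lemma pos_def_pos: "pos_def d A \<Longrightarrow> v \<in> carrier_vec d \<Longrightarrow> v \<noteq> 0\<^sub>v d \<Longrightarrow> 0 < quad A v" by (simp add: pos_def_def)
lemma quad_zero[simp]: "A \<in> carrier_mat d d \<Longrightarrow> quad A (0\<^sub>v d) = 0" by (simp add: quad_def)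
lemma pos_def_nonneg: "pos_def d A \<Longrightarrow> v \<in> carrier_vec d \<Longrightarrow> 0 \<le> quad A v"
  by (cases "v = 0\<^sub>v d") (auto simp: pos_def_carrier dest: pos_def_pos)

lemma hermitian_quad:
  assumes "A \<in> carrier_mat d d" "madj A = A" "v \<in> carrier_vec d"
  shows "(A *\<^sub>v v) \<bullet>c v = complex_of_real (quad A v)"
proof -
  have "(A *\<^sub>v v) \<bullet>c v = v \<bullet>c (A *\<^sub>v v)" using madj_cip[OF assms(1,3,3)] assms(2) by simp
  also have "\<dots> = cnj ((A *\<^sub>v v) \<bullet>c v)" by (rule cip_cnj[where d=d]) (use assms in auto)
  finally have "Im ((A *\<^sub>v v) \<bullet>c v) = 0" by (simp add: complex_eq_iff)
  then show ?thesis by (simp add: quad_def complex_eq_iff)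
qed

lemma pos_def_inverse:
  assumes "pos_def d A"
  obtains R where "pos_def d R" "A * R = 1\<^sub>m d" "R * A = 1\<^sub>m d"
proof -
  note A = pos_def_carrier[OF assms]
  have "Determinant.det A \<noteq> 0"
  proof
    assume "Determinant.det A = 0"
    then obtain v where v: "v \<in> carrier_vec d" "v \<noteq> 0\<^sub>v d" "A *\<^sub>v v = 0\<^sub>v d"
      using det_0_iff_vec_prod_zero_field[OF A] by auto
    then have "quad A v = 0" by (simp add: quad_def)
    then show False using pos_def_pos[OF assms v(1,2)] by simp
  qed
  from det_non_zero_imp_unit[OF A this, of "()"] obtain R where
    R: "R \<in> carrier_mat d d" "R * A = 1\<^sub>m d" "A * R = 1\<^sub>m d"
    by (auto simp: Units_def ring_mat_def)
  have "madj R = madj R * (A * R)" using R right_mult_one_mat[OF madj_carrier[OF R(1)]] by simp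
  also have "\<dots> = madj R * A * R" using A R by (simp add: assoc_mult_mat[of _ d d _ d _ d])
  also have "madj R * A = madj (A * R)" using madj_mult[OF A R(1)] pos_def_madj[OF assms] by simp
  finally have hR: "madj R = R" using R by simp
  have "0 < quad R v" if v: "v \<in> carrier_vec d" "v \<noteq> 0\<^sub>v d" for v
  proof -
    have Rv: "R *\<^sub>v v \<in> carrier_vec d" using R(1) v(1) by simp
    have AR: "A *\<^sub>v (R *\<^sub>v v) = v" using assoc_mult_mat_vec[OF A R(1) v(1)] R v by simp
    have "R *\<^sub>v v \<noteq> 0\<^sub>v d"
    proof
      assume "R *\<^sub>v v = 0\<^sub>v d"
      then have "A *\<^sub>v (R *\<^sub>v v) = 0\<^sub>v d" using A by auto
      with AR v(2) show False by simp
    qed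
    then have "0 < quad A (R *\<^sub>v v)" by (rule pos_def_pos[OF assms Rv])
    also have "quad A (R *\<^sub>v v) = Re (v \<bullet>c (R *\<^sub>v v))" by (simp only: quad_def AR)
    also have "\<dots> = quad R v" using madj_cip[OF R(1) v(1) v(1)] hR by (simp add: quad_def)
    finally show ?thesis .
  qed
  then have "pos_def d R" using R hR by (simp add: pos_def_def)
  then show ?thesis using that R by blast
qed

text \<open>
  This is the Cauchy-Schwarz inequality for the inner product given by \<open>A\<close>, applied to \<open>u\<close> and
  \<open>R v = A\<^sup>-\<^sup>1 v\<close>. It makes \<open>A\<close> plus a negative rank-one matrix positive definite as long as the
  coefficient is small enough, and it bounds a positive definite matrix by its trace.
\<close>

lemma cauchy_schwarz_inverse:
  assumes A: "pos_def d A" and R: "R \<in> carrier_mat d d" "A * R = 1\<^sub>m d" "pos_def d R"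
    and u: "u \<in> carrier_vec d" and v: "v \<in> carrier_vec d"
  shows "(cmod (u \<bullet>c v))\<^sup>2 \<le> quad A u * quad R v"
proof (cases "v = 0\<^sub>v d")
  case True
  then show ?thesis using u R(1) by (simp add: cip_sum[where d=d])
next
  case False
  note Ac = pos_def_carrier[OF A]
  define a where "a = quad R v"
  have a: "a > 0" unfolding a_def by (rule pos_def_pos[OF R(3) v False])
  define w where "w = R *\<^sub>v v"
  have w: "w \<in> carrier_vec d" using R(1) v by (simp add: w_def)
  have Aw: "A *\<^sub>v w = v" using assoc_mult_mat_vec[OF Ac R(1) v] R(2) v by (simp add: w_def)
  \<comment> \<open>The form of \<open>A\<close> at \<open>u - t w\<close> is minimal for this \<open>t\<close>.\<close>
  define t where "t = (u \<bullet>c v) / complex_of_real a"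
  have tw: "t \<cdot>\<^sub>v w \<in> carrier_vec d" using w by simp
  have vw: "v \<bullet>c w = complex_of_real a"
  proof -
    have "v \<bullet>c w = (R *\<^sub>v v) \<bullet>c v"
      using madj_cip[OF R(1) v v] pos_def_madj[OF R(3)] by (simp add: w_def)
    then show ?thesis unfolding a_def using hermitian_quad[OF R(1) pos_def_madj[OF R(3)] v] by simp
  qed
  have uA: "(A *\<^sub>v u) \<bullet>c w = u \<bullet>c v"
    using madj_cip[OF Ac u w] pos_def_madj[OF A] Aw by simp
  have cw: "(v \<bullet>c u) = cnj (u \<bullet>c v)" by (rule cip_cnj[OF u v])
  have Aux: "A *\<^sub>v (u - t \<cdot>\<^sub>v w) = A *\<^sub>v u - t \<cdot>\<^sub>v v"
    using Ac u w Aw by (simp add: mult_minus_distrib_mat_vec[OF Ac u tw] mult_mat_vec[OF Ac w])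
  have car: "A *\<^sub>v u \<in> carrier_vec d" "conjugate w \<in> carrier_vec d" using Ac u w by auto
  have "(A *\<^sub>v (u - t \<cdot>\<^sub>v w)) \<bullet>c (u - t \<cdot>\<^sub>v w) =
     (A *\<^sub>v u) \<bullet>c u - cnj t * ((A *\<^sub>v u) \<bullet>c w) - t * (v \<bullet>c u) + t * cnj t * (v \<bullet>c w)"
    unfolding Aux using car u v w
    by (simp add: cip_sum[where d=d] sum_subtractf algebra_simps sum_distrib_left sum.distrib del: index_mult_mat_vec)
  also have "\<dots> = (A *\<^sub>v u) \<bullet>c u - complex_of_real ((cmod (u \<bullet>c v))\<^sup>2 / a)"
    unfolding uA vw cw t_def using a
    by (simp add: field_simps complex_norm_square[symmetric] power2_eq_square[of "complex_of_real a"])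
  finally have "quad A (u - t \<cdot>\<^sub>v w) = quad A u - (cmod (u \<bullet>c v))\<^sup>2 / a"
    by (simp add: quad_def)
  moreover have "0 \<le> quad A (u - t \<cdot>\<^sub>v w)" by (rule pos_def_nonneg[OF A]) (use u w in auto)
  ultimately have "(cmod (u \<bullet>c v))\<^sup>2 / a \<le> quad A u" by linarith
  then show ?thesis using a by (simp add: a_def pos_divide_le_eq)
qed

text \<open>
  Each entry of \<open>w = R v\<close> satisfies \<open>|w\<^sub>i|\<^sup>2 \<le> (v, R v) R\<^sub>i\<^sub>i\<close>. Summing up bounds the norm of \<open>w\<close>, and
  \<open>(v, R v)\<close> is the inner product of \<open>w\<close> and \<open>v\<close>.
\<close>

lemma quad_le_trace:
  assumes R: "pos_def d R" and v: "v \<in> carrier_vec d"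
  shows "quad R v \<le> Re (mtrace R) * (vnorm2 d v)"
proof -
  note Rc = pos_def_carrier[OF R]
  obtain A where A: "pos_def d A" "R * A = 1\<^sub>m d" "A * R = 1\<^sub>m d" by (rule pos_def_inverse[OF R])
  define w where "w = R *\<^sub>v v"
  define q where "q = quad R v"
  have w: "w \<in> carrier_vec d" using Rc v by (simp add: w_def)
  have Aw: "A *\<^sub>v w = v" using assoc_mult_mat_vec[OF pos_def_carrier[OF A(1)] Rc v] A(3) v by (simp add: w_def)
  have qw: "quad A w = q"
  proof -
    have "quad A w = Re (v \<bullet>c w)" by (simp only: quad_def Aw)
    also have "\<dots> = q" using madj_cip[OF Rc v v] pos_def_madj[OF R] by (simp add: q_def quad_def w_def)
    finally show ?thesis .
  qed
  have q: "0 \<le> q" unfolding q_def by (rule pos_def_nonneg[OF R v])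
  have wi: "(cmod (w $ i))\<^sup>2 \<le> q * quad R (unit_vec d i)" if i: "i < d" for i
  proof -
    have "w \<bullet>c unit_vec d i = (\<Sum>k<d. w $ k * cnj (unit_vec d i $ k))" by (rule cip_sum) simp
    also have "\<dots> = (\<Sum>k<d. if k = i then w $ i else 0)" by (intro sum.cong) (use i in auto)
    finally have "w \<bullet>c unit_vec d i = w $ i" using i by simp
    then show ?thesis
      using cauchy_schwarz_inverse[OF A(1) Rc A(3) R w, of "unit_vec d i"] qw by simp
  qed
  have "q = Re (\<Sum>i<d. w $ i * cnj (v $ i))" by (simp only: q_def quad_def w_def cip_sum[OF v])
  also have "\<dots> \<le> (\<Sum>i<d. cmod (w $ i) * cmod (v $ i))"
    by (rule order_trans[OF complex_Re_le_cmod order_trans[OF norm_sum]]) (simp add: norm_mult)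
  finally have "q \<le> (\<Sum>i<d. cmod (w $ i) * cmod (v $ i))" .
  then have "q\<^sup>2 \<le> (\<Sum>i<d. cmod (w $ i) * cmod (v $ i))\<^sup>2" using q by (intro power_mono)
  also have "\<dots> \<le> (\<Sum>i<d. (cmod (w $ i))\<^sup>2) * (vnorm2 d v)"
    by (rule Cauchy_Schwarz_ineq_sum)
  also have "\<dots> \<le> (\<Sum>i<d. q * quad R (unit_vec d i)) * (vnorm2 d v)"
    using wi by (intro mult_right_mono sum_mono sum_nonneg) auto
  also have "\<dots> = q * (Re (mtrace R) * (vnorm2 d v))"
    by (simp add: mtrace_quad[OF Rc] mult.assoc flip: sum_distrib_left)
  finally have *: "q * q \<le> q * (Re (mtrace R) * (vnorm2 d v))" by (simp add: power2_eq_square)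
  have "0 \<le> Re (mtrace R)" unfolding mtrace_quad[OF Rc] by (intro sum_nonneg pos_def_nonneg[OF R]) auto
  then have "0 \<le> Re (mtrace R) * (vnorm2 d v)" by (intro mult_nonneg_nonneg sum_nonneg) auto
  then show ?thesis using * q unfolding q_def[symmetric] by (cases "q = 0") auto
qed

text \<open>
  The inverse is at most its trace, so the matrix is at least the reciprocal of it. This is what
  remains of a trace bound on the inverse at the end of the construction, and the reason why the
  barriers are not only respected but missed by \<open>1/c\<close>.
\<close>

lemma trace_inverse_lower_bound:
  assumes A: "pos_def d A" and R: "pos_def d R" "A * R = 1\<^sub>m d"
    and c: "Re (mtrace R) \<le> c" and v: "v \<in> carrier_vec d"
  shows "(vnorm2 d v) \<le> c * quad A v"
proof -
  define s where "s = (vnorm2 d v)"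
  have s: "0 \<le> s" by (simp add: s_def sum_nonneg)
  have q: "0 \<le> quad A v" by (rule pos_def_nonneg[OF A v])
  have "s * s = (cmod (v \<bullet>c v))\<^sup>2"
    unfolding cip_self[OF v] s_def[symmetric] by (simp add: power2_eq_square)
  also have "\<dots> \<le> quad A v * quad R v"
    by (rule cauchy_schwarz_inverse[OF A pos_def_carrier[OF R(1)] R(2) R(1) v v])
  also have "\<dots> \<le> quad A v * (c * s)"
  proof (intro mult_left_mono q)
    have "quad R v \<le> Re (mtrace R) * s" unfolding s_def by (rule quad_le_trace[OF R(1) v])
    also have "\<dots> \<le> c * s" by (intro mult_right_mono c s)
    finally show "quad R v \<le> c * s" .
  qed
  finally have "s * s \<le> s * (c * quad A v)" by (simp add: mult_ac)
  moreover have "0 \<le> c * quad A v" if "s = 0"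
  proof -
    have "0 \<le> Re (mtrace R)" unfolding mtrace_quad[OF pos_def_carrier[OF R(1)]]
      by (intro sum_nonneg pos_def_nonneg[OF R(1)]) auto
    then show ?thesis using c q by simp
  qed
  ultimately show ?thesis using s unfolding s_def[symmetric] by (cases "s = 0") auto
qed

lemma quad_shift:
  assumes "A \<in> carrier_mat d d" "v \<in> carrier_vec d"
  shows "quad (A + complex_of_real t \<cdot>\<^sub>m 1\<^sub>m d) v = quad A v + t * (vnorm2 d v)"
  using assms by (subst quad_add[where d=d]) (auto simp: quad_smult[where d=d] quad_one)

lemma sumsq_pos:
  assumes "v \<in> carrier_vec d" "v \<noteq> 0\<^sub>v d"
  shows "0 < (\<Sum>i<d. (cmod ((v :: complex Matrix.vec) $ i))\<^sup>2)"
proof -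
  from assms obtain i where "i < d" "v $ i \<noteq> 0" by (metis eq_vecI carrier_vecD index_zero_vec)
  then show ?thesis by (intro sum_pos2[of _ i]) auto
qed

lemma pos_def_congr_trace:
  assumes A: "pos_def d A" and C: "C \<in> carrier_mat d d" "madj C = C"
  shows "0 \<le> Re (mtrace (C * A * C))"
proof -
  note Ac = pos_def_carrier[OF A]
  have "C * A * C \<in> carrier_mat d d" using Ac C by auto
  from mtrace_quad[OF this] have "Re (mtrace (C * A * C)) = (\<Sum>i<d. quad (C * A * C) (unit_vec d i))" .
  also have "\<dots> = (\<Sum>i<d. quad A (C *\<^sub>v unit_vec d i))"
    using quad_congr[OF Ac C(1)] C(2) by (intro sum.cong) auto
  also have "0 \<le> \<dots>" using C by (intro sum_nonneg pos_def_nonneg[OF A]) auto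
  finally show ?thesis .
qed

lemma pos_def_square_trace:
  assumes A: "pos_def d A" and d: "0 < d"
  shows "0 < Re (mtrace (A * A))"
proof -
  note Ac = pos_def_carrier[OF A]
  have "A * A = madj A * 1\<^sub>m d * A" using Ac pos_def_madj[OF A] by simp
  then have "Re (mtrace (A * A)) = (\<Sum>i<d. quad (madj A * 1\<^sub>m d * A) (unit_vec d i))"
    using mtrace_quad[OF mult_carrier_mat[OF Ac Ac]] by simp
  also have "\<dots> = (\<Sum>i<d. (\<Sum>j<d. (cmod ((A *\<^sub>v unit_vec d i) $ j))\<^sup>2))"
  proof (intro sum.cong refl)
    fix i
    have "quad (madj A * 1\<^sub>m d * A) (unit_vec d i) = quad (1\<^sub>m d) (A *\<^sub>v unit_vec d i)"
      by (rule quad_congr) (use Ac in auto)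
    also have "\<dots> = (\<Sum>j<d. (cmod ((A *\<^sub>v unit_vec d i) $ j))\<^sup>2)"
      by (rule quad_one) (rule mult_mat_vec_carrier[OF Ac], simp)
    finally show "quad (madj A * 1\<^sub>m d * A) (unit_vec d i) = (\<Sum>j<d. (cmod ((A *\<^sub>v unit_vec d i) $ j))\<^sup>2)" .
  qed
  also have "0 < \<dots>"
  proof (rule sum_pos)
    fix i assume "i \<in> {..<d}"
    then have i: "i < d" by simp
    have "A *\<^sub>v unit_vec d i \<noteq> 0\<^sub>v d"
    proof
      assume "A *\<^sub>v unit_vec d i = 0\<^sub>v d"
      then have "quad A (unit_vec d i) = 0" by (simp add: quad_def)
      moreover have "unit_vec d i \<noteq> (0\<^sub>v d :: complex Matrix.vec)"
        using i by (metis index_unit_vec(1) index_zero_vec(1) one_neq_zero)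
      ultimately show False using pos_def_pos[OF A, of "unit_vec d i"] by simp
    qed
    then show "0 < (\<Sum>j<d. (cmod ((A *\<^sub>v unit_vec d i) $ j))\<^sup>2)"
      by (intro sumsq_pos mult_mat_vec_carrier[OF Ac]) auto
  qed (use d in auto)
  finally show ?thesis .
qed

section \<open>Resolvents and rank-one updates\<close>

text \<open>
  Everything follows from the resolvent identity \<open>S - S' = t S S'\<close>, where \<open>S\<close> and \<open>S'\<close> commute: the
  first three claims by taking traces after multiplication with \<open>1\<close>, \<open>S'\<close> and \<open>S\<close>. The last one is
  the Cauchy-Schwarz inequality for the semi-inner product \<open>tr (X S' Y\<^sup>*)\<close>, applied to \<open>S\<close> and \<open>1\<close>.
\<close>

lemma resolvent_shift:
  fixes t :: real
  assumes P: "P \<in> carrier_mat d d" and t: "0 < t"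
    and S: "pos_def d S" "P * S = 1\<^sub>m d" "S * P = 1\<^sub>m d"
    and S': "pos_def d S'" "(P + complex_of_real t \<cdot>\<^sub>m 1\<^sub>m d) * S' = 1\<^sub>m d"
      "S' * (P + complex_of_real t \<cdot>\<^sub>m 1\<^sub>m d) = 1\<^sub>m d"
  defines "b \<equiv> Re (mtrace (S * S'))"
  shows "Re (mtrace S) = Re (mtrace S') + t * b"
    and "b = Re (mtrace (S' * S')) + t * Re (mtrace (S' * S * S'))"
    and "Re (mtrace (S * S)) = b + t * Re (mtrace (S * S' * S))"
    and "b\<^sup>2 \<le> Re (mtrace (S * S' * S)) * Re (mtrace S')"
proof -
  let ?t = "complex_of_real t"
  let ?I = "1\<^sub>m d :: complex mat"
  note Sc = pos_def_carrier[OF S(1)] and S'c = pos_def_carrier[OF S'(1)]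
  have SS': "S * S' \<in> carrier_mat d d" and S'S: "S' * S \<in> carrier_mat d d" using Sc S'c by auto
  have tI: "?t \<cdot>\<^sub>m ?I \<in> carrier_mat d d" by simp
  have r1: "S = S' + ?t \<cdot>\<^sub>m (S * S')"
  proof -
    have "S = S * ((P + ?t \<cdot>\<^sub>m ?I) * S')" using Sc S'(2) by simp
    also have "\<dots> = S * (P + ?t \<cdot>\<^sub>m ?I) * S'"
      using P Sc S'c by (intro assoc_mult_mat[symmetric]) auto
    also have "S * (P + ?t \<cdot>\<^sub>m ?I) = ?I + ?t \<cdot>\<^sub>m S"
      using P Sc S(3) by (simp add: mult_add_distrib_mat[OF Sc P tI] mult_smult_distrib[OF Sc, of _ d])
    also have "\<dots> * S' = S' + ?t \<cdot>\<^sub>m (S * S')"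
      using Sc S'c by (simp add: add_mult_distrib_mat[where nr=d and n=d and nc=d] mult_smult_assoc_mat[OF Sc S'c])
    finally show ?thesis .
  qed
  have r2: "S = S' + ?t \<cdot>\<^sub>m (S' * S)"
  proof -
    have "S = S' * (P + ?t \<cdot>\<^sub>m ?I) * S" using Sc S'(3) by simp
    also have "\<dots> = S' * ((P + ?t \<cdot>\<^sub>m ?I) * S)"
      using P Sc S'c by (intro assoc_mult_mat) auto
    also have "(P + ?t \<cdot>\<^sub>m ?I) * S = ?I + ?t \<cdot>\<^sub>m S"
      using P Sc S(2) by (simp add: add_mult_distrib_mat[OF P tI Sc] mult_smult_assoc_mat[of _ d d, OF _ Sc])
    also have "S' * \<dots> = S' + ?t \<cdot>\<^sub>m (S' * S)"
      using Sc S'c by (simp add: mult_add_distrib_mat[where nr=d and n=d and nc=d] mult_smult_distrib[OF S'c Sc])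
    finally show ?thesis .
  qed
  have comm: "S' * S = S * S'"
  proof (rule eq_matI)
    fix i j assume "i < dim_row (S * S')" "j < dim_col (S * S')"
    then have ij: "i < d" "j < d" using Sc S'c by auto
    have "S' $$ (i,j) + ?t * (S' * S) $$ (i,j) = S' $$ (i,j) + ?t * (S * S') $$ (i,j)"
      using arg_cong[OF r1, of "\<lambda>A. A $$ (i,j)"] arg_cong[OF r2, of "\<lambda>A. A $$ (i,j)"] ij Sc S'c
      by (simp del: index_mult_mat(1))
    then show "(S' * S) $$ (i,j) = (S * S') $$ (i,j)" using t by simp
  qed (use Sc S'c in auto)
  have "mtrace S = mtrace S' + ?t * mtrace (S * S')"
    using arg_cong[OF r1, of mtrace] SS' S'c by (simp add: mtrace_add[of _ d] mtrace_smult[of _ d])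
  then show "Re (mtrace S) = Re (mtrace S') + t * b" by (simp add: b_def)
  have "S * S' = (S' + ?t \<cdot>\<^sub>m (S * S')) * S'" using r1 by simp
  also have "\<dots> = S' * S' + ?t \<cdot>\<^sub>m (S' * S * S')"
    using SS' S'c by (simp add: add_mult_distrib_mat[where nr=d and n=d and nc=d] mult_smult_assoc_mat[OF SS' S'c] comm)
  finally have "mtrace (S * S') = mtrace (S' * S') + ?t * mtrace (S' * S * S')"
    using S'S S'c by (simp add: mtrace_add[of _ d] mtrace_smult[of _ d])
  then show "b = Re (mtrace (S' * S')) + t * Re (mtrace (S' * S * S'))" by (simp add: b_def)
  have "S * S = (S' + ?t \<cdot>\<^sub>m (S * S')) * S" using r1 by simp
  also have "\<dots> = S * S' + ?t \<cdot>\<^sub>m (S * S' * S)"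
    using SS' S'c Sc by (simp add: add_mult_distrib_mat[where nr=d and n=d and nc=d] mult_smult_assoc_mat[OF SS' Sc] comm)
  finally have "mtrace (S * S) = mtrace (S * S') + ?t * mtrace (S * S' * S)"
    using SS' Sc by (simp add: mtrace_add[of _ d] mtrace_smult[of _ d])
  then show "Re (mtrace (S * S)) = b + t * Re (mtrace (S * S' * S))" by (simp add: b_def)
  define r where "r = Re (mtrace S')"
  \<comment> \<open>The quadratic polynomial \<open>tr ((S - s) S' (S - s))\<close> in \<open>s\<close> is nonnegative.\<close>
  have discr: "0 \<le> Re (mtrace (S * S' * S)) - 2 * s * b + s\<^sup>2 * r" for s :: real
  proof -
    let ?s = "complex_of_real s"
    define C where "C = S - ?s \<cdot>\<^sub>m ?I"
    have C: "C \<in> carrier_mat d d" "madj C = C"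
      using Sc pos_def_madj[OF S(1)] by (auto simp: C_def madj_minus[of _ d d] madj_smult)
    have sS': "?s \<cdot>\<^sub>m S' \<in> carrier_mat d d" using S'c by simp
    have "C * S' = S * S' - ?s \<cdot>\<^sub>m S'"
      using Sc S'c by (simp add: C_def minus_mult_distrib_mat[OF Sc, of _ S' d] mult_smult_assoc_mat[of _ d d, OF _ S'c])
    moreover define X where "X = S * S' - ?s \<cdot>\<^sub>m S'"
    ultimately have CSC: "C * S' * C = X * (S - ?s \<cdot>\<^sub>m ?I)" by (simp add: C_def)
    have Xc: "X \<in> carrier_mat d d" unfolding X_def by (rule minus_carrier_mat[OF sS'])
    have "X * (S - ?s \<cdot>\<^sub>m ?I) = X * S - X * (?s \<cdot>\<^sub>m ?I)"
      by (rule mult_minus_distrib_mat[OF Xc Sc]) simp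
    also have "X * (?s \<cdot>\<^sub>m ?I) = ?s \<cdot>\<^sub>m X"
      using Xc mult_smult_distrib[OF Xc one_carrier_mat] by simp
    finally have 1: "mtrace (C * S' * C) = mtrace (X * S) - ?s * mtrace X"
      unfolding CSC using mtrace_minus[of "X * S" d "?s \<cdot>\<^sub>m X"] Xc Sc by (simp add: mtrace_smult[OF Xc])
    have "X * S = S * S' * S - ?s \<cdot>\<^sub>m (S' * S)"
      unfolding X_def minus_mult_distrib_mat[OF SS' sS' Sc] mult_smult_assoc_mat[OF S'c Sc] ..
    then have 2: "mtrace (X * S) = mtrace (S * S' * S) - ?s * mtrace (S' * S)"
      using mtrace_minus[OF mult_carrier_mat[OF SS' Sc] smult_carrier_mat[OF S'S]] mtrace_smult[OF S'S] by simp
    have 3: "mtrace X = mtrace (S * S') - ?s * mtrace S'"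
      unfolding X_def using mtrace_minus[OF SS' sS'] mtrace_smult[OF S'c] by simp
    have "mtrace (C * S' * C) = mtrace (S * S' * S) - ?s * mtrace (S' * S) - (?s * mtrace (S * S') - ?s * (?s * mtrace S'))"
      unfolding 1 2 3 by (simp add: algebra_simps)
    from arg_cong[OF this, of Re] have "Re (mtrace (C * S' * C)) = Re (mtrace (S * S' * S)) - 2 * s * b + s\<^sup>2 * r"
      unfolding comm by (simp add: b_def r_def power2_eq_square algebra_simps)
    with pos_def_congr_trace[OF S'(1) C] show ?thesis by simp
  qed
  have r0: "0 \<le> r" unfolding r_def mtrace_quad[OF S'c] by (intro sum_nonneg pos_def_nonneg[OF S'(1)]) auto
  show "b\<^sup>2 \<le> Re (mtrace (S * S' * S)) * Re (mtrace S')"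
  proof (cases "r = 0")
    case True
    have "d = 0"
    proof (rule ccontr)
      assume "d \<noteq> 0"
      then have "0 < (\<Sum>i<d. quad S' (unit_vec d i))"
      proof (intro sum_pos pos_def_pos[OF S'(1)])
        fix i assume "i \<in> {..<d}"
        then show "unit_vec d i \<noteq> (0\<^sub>v d :: complex Matrix.vec)"
          by (metis index_unit_vec(1) index_zero_vec(1) lessThan_iff one_neq_zero)
      qed auto
      with True show False by (simp add: r_def mtrace_quad[OF S'c])
    qed
    then show ?thesis using Sc by (simp add: b_def mtrace_def)
  next
    case False
    with r0 have "0 < r" by simp
    then show ?thesis using discr[of "b / r"]
      by (simp add: r_def[symmetric] field_simps power2_eq_square)
  qed
qed

lemma outer_sandwich:
  assumes X: "X \<in> carrier_mat d d" and v: "v \<in> carrier_vec d"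
  shows "outer v * X * outer v = ((X *\<^sub>v v) \<bullet>c v) \<cdot>\<^sub>m outer v"
proof -
  have O: "outer v \<in> carrier_mat d d" using v by simp
  have "outer v * X * outer v = outer v * (X * outer v)" using O X by simp
  also have "\<dots> = ((X *\<^sub>v v) \<bullet>c v) \<cdot>\<^sub>m outer v"
  proof (rule eq_matI)
    fix i j assume "i < dim_row (((X *\<^sub>v v) \<bullet>c v) \<cdot>\<^sub>m outer v)" "j < dim_col (((X *\<^sub>v v) \<bullet>c v) \<cdot>\<^sub>m outer v)"
    then have ij: "i < d" "j < d" using O by auto
    have 1: "(X * outer v) $$ (k,j) = (X *\<^sub>v v) $ k * cnj (v $ j)" if "k < d" for k
      using that ij v unfolding mult_index[OF X O that ij(2)] mult_vec_index[OF X v that]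
      by (simp add: sum_distrib_right sum_distrib_left outer_def mult_ac)
    have "(outer v * (X * outer v)) $$ (i,j) = (\<Sum>k<d. outer v $$ (i,k) * (X * outer v) $$ (k,j))"
      by (rule mult_index) (use O X ij in auto)
    also have "\<dots> = (\<Sum>k<d. v $ i * cnj (v $ k) * ((X *\<^sub>v v) $ k * cnj (v $ j)))"
    proof (intro sum.cong refl)
      fix k assume "k \<in> {..<d}"
      then have k: "k < d" by simp
      show "outer v $$ (i,k) * (X * outer v) $$ (k,j) = v $ i * cnj (v $ k) * ((X *\<^sub>v v) $ k * cnj (v $ j))"
        unfolding 1[OF k] using v ij k by (simp add: outer_def del: index_mult_mat_vec)
    qed
    also have "\<dots> = (\<Sum>k<d. (X *\<^sub>v v) $ k * cnj (v $ k)) * (v $ i * cnj (v $ j))"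
      by (simp add: sum_distrib_right sum_distrib_left mult_ac)
    finally show "(outer v * (X * outer v)) $$ (i,j) = (((X *\<^sub>v v) \<bullet>c v) \<cdot>\<^sub>m outer v) $$ (i,j)"
      using v ij by (simp add: cip_sum[OF v] outer_def del: index_mult_mat_vec index_mult_mat(1))
  qed (use O X in auto)
  finally show ?thesis .
qed

text \<open>
  The Sherman-Morrison formula. Its trace is all that the barrier steps need: adding a rank-one matrix
  changes the trace of the inverse by an expression in the two quadratic forms of \<open>T\<close> and \<open>T\<^sup>2\<close>.
\<close>

lemma rank_one_update:
  fixes \<gamma> :: real
  assumes Q: "pos_def d Q" and T: "pos_def d T" "Q * T = 1\<^sub>m d" "T * Q = 1\<^sub>m d"
    and v: "v \<in> carrier_vec d" and pos: "0 < 1 + \<gamma> * quad T v"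
  obtains R where "pos_def d (Q + complex_of_real \<gamma> \<cdot>\<^sub>m outer v)" "pos_def d R"
    "(Q + complex_of_real \<gamma> \<cdot>\<^sub>m outer v) * R = 1\<^sub>m d"
    "R * (Q + complex_of_real \<gamma> \<cdot>\<^sub>m outer v) = 1\<^sub>m d"
    "Re (mtrace R) = Re (mtrace T) - \<gamma> / (1 + \<gamma> * quad T v) * quad (T * T) v"
proof -
  define g where "g = quad T v"
  define \<kappa> where "\<kappa> = \<gamma> / (1 + \<gamma> * g)"
  note Qc = pos_def_carrier[OF Q] and Tc = pos_def_carrier[OF T(1)]
  let ?O = "outer v" and ?I = "1\<^sub>m d :: complex mat"
  let ?g = "complex_of_real \<gamma>" and ?k = "complex_of_real \<kappa>"
  have O: "?O \<in> carrier_mat d d" using v by simp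
  define P where "P = Q + ?g \<cdot>\<^sub>m ?O"
  define R where "R = T - ?k \<cdot>\<^sub>m (T * ?O * T)"
  have Pc: "P \<in> carrier_mat d d" using Qc O by (simp add: P_def)
  have TO: "T * ?O \<in> carrier_mat d d" "T * ?O * T \<in> carrier_mat d d" "?O * T \<in> carrier_mat d d" using Tc O by auto
  have Rc: "R \<in> carrier_mat d d"
    unfolding R_def by (rule minus_carrier_mat, rule smult_carrier_mat, rule TO(2))
  have pP: "pos_def d P"
    unfolding pos_def_def
  proof (intro conjI ballI impI)
    show "madj P = P" using Qc O pos_def_madj[OF Q] by (simp add: P_def madj_add[of _ d d] madj_smult)
    fix u :: "complex Matrix.vec" assume u: "u \<in> carrier_vec d" "u \<noteq> 0\<^sub>v d"
    have q: "0 < quad Q u" by (rule pos_def_pos[OF Q u])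
    have eq: "quad P u = quad Q u + \<gamma> * (cmod (u \<bullet>c v))\<^sup>2"
      using Qc O u v by (simp add: P_def quad_add[of _ d] quad_smult[of _ d] quad_outer[of _ d])
    show "0 < quad P u"
    proof (cases "0 \<le> \<gamma>")
      case True then show ?thesis using q eq by (simp add: add_pos_nonneg)
    next
      case False
      then have "\<gamma> * (quad Q u * g) \<le> \<gamma> * (cmod (u \<bullet>c v))\<^sup>2"
        using cauchy_schwarz_inverse[OF Q Tc T(2) T(1) u(1) v] by (simp add: g_def)
      then have "quad Q u * (1 + \<gamma> * g) \<le> quad P u" unfolding eq by (simp add: algebra_simps)
      moreover have "0 < quad Q u * (1 + \<gamma> * g)" using q pos by (simp add: g_def)
      ultimately show ?thesis by simp
    qed
  qed (rule Pc)
  have OTO: "?O * T * ?O = complex_of_real g \<cdot>\<^sub>m ?O"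
    using outer_sandwich[OF Tc v] hermitian_quad[OF Tc pos_def_madj[OF T(1)] v] by (simp add: g_def)
  have "P * R = P * T - ?k \<cdot>\<^sub>m (P * (T * ?O * T))"
    unfolding R_def mult_minus_distrib_mat[OF Pc Tc smult_carrier_mat[OF TO(2)]]
      mult_smult_distrib[OF Pc TO(2)] ..
  also have PT: "P * T = ?I + ?g \<cdot>\<^sub>m (?O * T)"
    using Qc O Tc T(2) by (simp add: P_def add_mult_distrib_mat[of _ d d] mult_smult_assoc_mat[of _ d d])
  also have "P * (T * ?O * T) = (P * T) * (?O * T)"
    using assoc_mult_mat[OF Pc Tc TO(3)] Tc O by simp
  also have "\<dots> = ?O * T + ?g \<cdot>\<^sub>m (?O * T * (?O * T))"
    unfolding PT using TO left_mult_one_mat[OF TO(3)]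
    by (simp add: add_mult_distrib_mat[of _ d d] mult_smult_assoc_mat[of _ d d])
  also have "?O * T * (?O * T) = complex_of_real g \<cdot>\<^sub>m (?O * T)"
    using Tc O TO OTO assoc_mult_mat[of "?O * T" d d ?O d T d] by (simp add: mult_smult_assoc_mat[of _ d d] del: assoc_mult_mat)
  also have "?I + ?g \<cdot>\<^sub>m (?O * T) - ?k \<cdot>\<^sub>m (?O * T + ?g \<cdot>\<^sub>m (complex_of_real g \<cdot>\<^sub>m (?O * T))) =
     ?I + complex_of_real (\<gamma> - \<kappa> * (1 + \<gamma> * g)) \<cdot>\<^sub>m (?O * T)"
    using TO by (intro eq_matI) (auto simp: algebra_simps simp del: index_mult_mat(1))
  also have "\<gamma> - \<kappa> * (1 + \<gamma> * g) = 0" using pos by (simp add: \<kappa>_def g_def)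
  also have "?I + complex_of_real 0 \<cdot>\<^sub>m (?O * T) = ?I"
  proof (rule eq_matI)
    fix i j assume "i < dim_row ?I" "j < dim_col ?I"
    then have ij: "i < d" "j < d" by auto
    then show "(?I + complex_of_real 0 \<cdot>\<^sub>m (?O * T)) $$ (i,j) = ?I $$ (i,j)"
      using carrier_matD[OF O] carrier_matD[OF Tc] by (simp del: index_mult_mat(1))
  qed (use carrier_matD[OF O] carrier_matD[OF Tc] in auto)
  finally have PR: "P * R = ?I" .
  have RP: "R * P = ?I" by (rule mat_mult_left_right_inverse[OF Pc Rc PR])
  obtain R' where R': "pos_def d R'" "P * R' = ?I" "R' * P = ?I" by (rule pos_def_inverse[OF pP])
  have "R' = R' * (P * R)" using PR pos_def_carrier[OF R'(1)] by simp
  also have "\<dots> = R' * P * R" using Pc Rc pos_def_carrier[OF R'(1)] by simp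
  also have "\<dots> = R" using R'(3) Rc by simp
  finally have pR: "pos_def d R" using R'(1) by simp
  have TT: "T * T \<in> carrier_mat d d" using Tc by auto
  have "mtrace (T * ?O * T) = mtrace (T * (T * ?O))" by (rule mtrace_mult_commute[OF TO(1) Tc])
  also have "\<dots> = mtrace (T * T * ?O)" using Tc O by simp
  also have "\<dots> = ((T * T) *\<^sub>v v) \<bullet>c v" by (rule mtrace_mult_outer[OF TT v])
  finally have "Re (mtrace (T * ?O * T)) = quad (T * T) v" by (simp add: quad_def)
  then have "Re (mtrace R) = Re (mtrace T) - \<kappa> * quad (T * T) v"
    unfolding R_def using Tc TO by (simp add: mtrace_minus[of _ d] mtrace_smult[of _ d])
  then show ?thesis using that[of R] pP pR PR RP unfolding P_def \<kappa>_def g_def by blast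
qed

section \<open>The two barrier steps\<close>

text \<open>
  The matrix \<open>P\<close> is the difference between a Gram matrix and a barrier, the larger minus the smaller
  one, and \<open>c\<close> bounds the potential, that is, the trace of the inverse.
\<close>

definition barrier :: "nat \<Rightarrow> complex mat \<Rightarrow> real \<Rightarrow> bool"
  where "barrier d P c \<longleftrightarrow> pos_def d P \<and>
    (\<exists>R. pos_def d R \<and> P * R = 1\<^sub>m d \<and> R * P = 1\<^sub>m d \<and> Re (mtrace R) \<le> c)"

lemma barrier_lower_bound:
  assumes "barrier d P c" "v \<in> carrier_vec d"
  shows "(vnorm2 d v) \<le> c * quad P v"
  using assms trace_inverse_lower_bound unfolding barrier_def by blast

lemma pos_def_dim_0: "A \<in> carrier_mat 0 0 \<Longrightarrow> pos_def 0 A"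
  by (auto simp: pos_def_def madj_def intro!: eq_matI eq_vecI)

lemma barrier_dim_0:
  assumes "A \<in> carrier_mat 0 0" "0 \<le> c"
  shows "barrier 0 A c"
proof -
  have "A * 1\<^sub>m 0 = 1\<^sub>m 0" "1\<^sub>m 0 * A = 1\<^sub>m 0" using assms by (auto intro!: eq_matI)
  moreover have "Re (mtrace (1\<^sub>m 0)) \<le> c" using assms by (simp add: mtrace_def)
  ultimately show ?thesis unfolding barrier_def using pos_def_dim_0[OF assms(1)] pos_def_dim_0[of "1\<^sub>m 0"] by auto
qed

text \<open>
  The barrier moves by \<open>t\<close>, which raises the potential by \<open>D\<close>; adding \<open>w v v\<^sup>*\<close> lowers it by
  \<open>(v, T\<^sup>2 v) / (1/w + (v, T v))\<close> for the new inverse \<open>T\<close>. So the potential does not grow if \<open>1/w\<close> is at most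
  the value at \<open>v\<close> of the form of \<open>X = T\<^sup>2/D - T\<close>. The average of this form over an isotropic random
  vector is the trace of \<open>X\<close>, hence the bound for the trace.
\<close>

lemma lower_barrier_step:
  fixes t c :: real
  assumes P: "barrier d P c" and d: "0 < d" and t: "0 < t" "t * c < 1"
  obtains X where "X \<in> carrier_mat d d" "1 / t - c \<le> Re (mtrace X)"
    "\<And>v w. v \<in> carrier_vec d \<Longrightarrow> 0 < w \<Longrightarrow> 1 / w \<le> quad X v \<Longrightarrow>
      barrier d (P + complex_of_real (- t) \<cdot>\<^sub>m 1\<^sub>m d + complex_of_real w \<cdot>\<^sub>m outer v) c"
proof -
  obtain R where pP: "pos_def d P" and R: "pos_def d R" "P * R = 1\<^sub>m d" "R * P = 1\<^sub>m d" "Re (mtrace R) \<le> c"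
    using P unfolding barrier_def by auto
  note Pc = pos_def_carrier[OF pP] and Rc = pos_def_carrier[OF R(1)]
  define Q where "Q = P + complex_of_real (- t) \<cdot>\<^sub>m 1\<^sub>m d"
  have Qc: "Q \<in> carrier_mat d d" using Pc by (simp add: Q_def)
  have PQ: "Q + complex_of_real t \<cdot>\<^sub>m 1\<^sub>m d = P" using Pc by (intro eq_matI) (auto simp: Q_def)
  have pQ: "pos_def d Q"
    unfolding pos_def_def
  proof (intro conjI ballI impI Qc)
    show "madj Q = Q" using Pc pos_def_madj[OF pP] by (simp add: Q_def madj_add[of _ d d] madj_smult)
    fix v :: "complex Matrix.vec" assume v: "v \<in> carrier_vec d" "v \<noteq> 0\<^sub>v d"
    define s where "s = (vnorm2 d v)"
    have s: "0 < s" unfolding s_def by (rule sumsq_pos[OF v])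
    have "t * s \<le> t * (c * quad P v)"
      unfolding s_def using t barrier_lower_bound[OF P v(1)] by simp
    also have "\<dots> < 1 * quad P v" unfolding mult.assoc[symmetric]
      by (rule mult_strict_right_mono[OF t(2) pos_def_pos[OF pP v]])
    finally show "0 < quad Q v" unfolding Q_def s_def using quad_shift[OF Pc v(1), of "- t"] by simp
  qed
  obtain T where T: "pos_def d T" "Q * T = 1\<^sub>m d" "T * Q = 1\<^sub>m d" by (rule pos_def_inverse[OF pQ])
  note Tc = pos_def_carrier[OF T(1)]
  have TT: "T * T \<in> carrier_mat d d" using Tc by auto
  define b where "b = Re (mtrace (T * R))"
  define a where "a = Re (mtrace (T * R * T))"
  define r where "r = Re (mtrace R)"
  note rs = resolvent_shift[OF Qc t(1) T R(1), unfolded PQ, OF R(2,3), folded b_def a_def r_def]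
  have "0 < Re (mtrace (R * R))" by (rule pos_def_square_trace[OF R(1) d])
  moreover have "0 \<le> Re (mtrace (R * T * R))" by (rule pos_def_congr_trace[OF T(1) Rc pos_def_madj[OF R(1)]])
  ultimately have b: "0 < b" using rs(2) t(1) by (simp add: add_pos_nonneg)
  have r0: "0 \<le> r" unfolding r_def mtrace_quad[OF Rc] by (intro sum_nonneg pos_def_nonneg[OF R(1)]) auto
  define D where "D = t * b"
  have D: "0 < D" using b t by (simp add: D_def)
  define X where "X = complex_of_real (1 / D) \<cdot>\<^sub>m (T * T) - T"
  have Xc: "X \<in> carrier_mat d d" unfolding X_def by (rule minus_carrier_mat[OF Tc])
  have "Re (mtrace X) = (b + t * a) / D - (r + D)"
    unfolding X_def using TT Tc rs(1,3) by (simp add: mtrace_minus[of _ d] mtrace_smult[of _ d] D_def)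
  also have "\<dots> = 1 / t + a / b - r - t * b" using b t by (simp add: D_def field_simps)
  finally have tr: "Re (mtrace X) = 1 / t + a / b - r - t * b" .
  \<comment> \<open>By the last claim of the resolvent lemma, \<open>a / b \<ge> b / r\<close>, and \<open>r t \<le> c t < 1\<close>.\<close>
  have "t * b \<le> a / b"
  proof -
    have "a > 0"
    proof (rule ccontr)
      assume "\<not> a > 0"
      then have "a * r \<le> 0" using r0 by (simp add: mult_nonpos_nonneg)
      with rs(4) b show False by (smt (verit) zero_less_power)
    qed
    have "t * b\<^sup>2 \<le> t * (a * r)" using rs(4) t by simp
    also have "\<dots> \<le> a * (t * c)" using \<open>a > 0\<close> t R(4) by (simp add: r_def)
    also have "\<dots> \<le> a * 1" using \<open>a > 0\<close> t by (intro mult_left_mono) auto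
    finally show ?thesis using b by (simp add: field_simps power2_eq_square)
  qed
  then have X1: "1 / t - c \<le> Re (mtrace X)" using tr R(4) by (simp add: r_def)
  have "barrier d (Q + complex_of_real w \<cdot>\<^sub>m outer v) c"
    if v: "v \<in> carrier_vec d" and w: "0 < w" "1 / w \<le> quad X v" for v w
  proof -
    have g: "0 \<le> quad T v" by (rule pos_def_nonneg[OF T(1) v])
    have "quad X v = 1 / D * quad (T * T) v - quad T v"
      unfolding X_def using v TT Tc quad_minus[OF smult_carrier_mat[OF TT] Tc v] quad_smult[OF TT v, of "1 / D"]
      by simp
    with w(2) have "1 / w + quad T v \<le> quad (T * T) v / D" by simp
    then have le: "D * (1 / w + quad T v) \<le> quad (T * T) v" using D by (simp add: field_simps)
    have p: "0 < 1 + w * quad T v" using w g by (simp add: add_pos_nonneg)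
    obtain R' where R': "pos_def d (Q + complex_of_real w \<cdot>\<^sub>m outer v)" "pos_def d R'"
      "(Q + complex_of_real w \<cdot>\<^sub>m outer v) * R' = 1\<^sub>m d"
      "R' * (Q + complex_of_real w \<cdot>\<^sub>m outer v) = 1\<^sub>m d"
      "Re (mtrace R') = Re (mtrace T) - w / (1 + w * quad T v) * quad (T * T) v"
      by (rule rank_one_update[OF pQ T v p])
    define z where "z = 1 / w + quad T v"
    have z: "1 + w * quad T v = w * z" "0 < z" using w g by (simp_all add: z_def distrib_left add_pos_nonneg)
    have "D = w / (1 + w * quad T v) * (D * (1 / w + quad T v))"
      unfolding z(1) unfolding z_def[symmetric] using w z(2) by simp
    also have "\<dots> \<le> w / (1 + w * quad T v) * quad (T * T) v"
      using le w p by (intro mult_left_mono) auto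
    finally have "Re (mtrace R') \<le> r" using R'(5) rs(1) by (simp add: D_def)
    then show ?thesis unfolding barrier_def using R' R(4) by (auto simp: r_def)
  qed
  then show ?thesis using that[OF Xc X1] unfolding Q_def by blast
qed

text \<open>
  The counterpart for a matrix \<open>P\<close> from which rank-one matrices are subtracted. Now the motion of the
  barrier lowers the potential by \<open>D\<close>, the subtraction of \<open>w v v\<^sup>*\<close> raises it by
  \<open>(v, T\<^sup>2 v) / (1/w - (v, T v))\<close>, and \<open>1/w\<close> has to be at least the value of the form of \<open>X = T\<^sup>2/D + T\<close>.
\<close>

lemma upper_barrier_step:
  fixes t c :: real
  assumes P: "barrier d P c" and t: "0 < t"
  obtains X where "X \<in> carrier_mat d d" "Re (mtrace X) \<le> 1 / t + c"
    "\<And>v. v \<in> carrier_vec d \<Longrightarrow> 0 \<le> quad X v"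
    "\<And>v w. v \<in> carrier_vec d \<Longrightarrow> 0 < w \<Longrightarrow> quad X v \<le> 1 / w \<Longrightarrow>
      barrier d (P + complex_of_real t \<cdot>\<^sub>m 1\<^sub>m d + complex_of_real (- w) \<cdot>\<^sub>m outer v) c"
proof (cases "d = 0")
  case True
  have "c \<ge> 0"
  proof -
    from P obtain R where "R \<in> carrier_mat d d" "Re (mtrace R) \<le> c" by (auto simp: barrier_def pos_def_def)
    then show ?thesis using True by (simp add: mtrace_def)
  qed
  then show ?thesis using True t
    by (intro that[of "1\<^sub>m 0"]) (auto simp: mtrace_def quad_def scalar_prod_def intro!: barrier_dim_0)
next
  case False
  then have d: "0 < d" by simp
  obtain R where pP: "pos_def d P" and R: "pos_def d R" "P * R = 1\<^sub>m d" "R * P = 1\<^sub>m d" "Re (mtrace R) \<le> c"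
    using P unfolding barrier_def by auto
  note Pc = pos_def_carrier[OF pP] and Rc = pos_def_carrier[OF R(1)]
  define Q where "Q = P + complex_of_real t \<cdot>\<^sub>m 1\<^sub>m d"
  have Qc: "Q \<in> carrier_mat d d" using Pc by (simp add: Q_def)
  have pQ: "pos_def d Q"
    unfolding pos_def_def
  proof (intro conjI ballI impI Qc)
    show "madj Q = Q" using Pc pos_def_madj[OF pP] by (simp add: Q_def madj_add[of _ d d] madj_smult)
    fix v :: "complex Matrix.vec" assume v: "v \<in> carrier_vec d" "v \<noteq> 0\<^sub>v d"
    show "0 < quad Q v" unfolding Q_def quad_shift[OF Pc v(1)]
      using sumsq_pos[OF v] pos_def_pos[OF pP v] t by (simp add: add_pos_pos)
  qed
  obtain T where T: "pos_def d T" "Q * T = 1\<^sub>m d" "T * Q = 1\<^sub>m d" by (rule pos_def_inverse[OF pQ])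
  note Tc = pos_def_carrier[OF T(1)]
  have TT: "T * T \<in> carrier_mat d d" using Tc by auto
  define b where "b = Re (mtrace (R * T))"
  note rs = resolvent_shift[OF Pc t R(1-3) T(1), folded Q_def, OF T(2,3), folded b_def]
  have tt: "0 < Re (mtrace (T * T))" by (rule pos_def_square_trace[OF T(1) d])
  have "0 \<le> Re (mtrace (T * R * T))" by (rule pos_def_congr_trace[OF R(1) Tc pos_def_madj[OF T(1)]])
  then have b: "Re (mtrace (T * T)) \<le> b" using rs(2) t by simp
  define D where "D = t * b"
  have D: "0 < D" using b tt t by (simp add: D_def)
  define X where "X = complex_of_real (1 / D) \<cdot>\<^sub>m (T * T) + T"
  have Xc: "X \<in> carrier_mat d d" unfolding X_def by (rule add_carrier_mat[OF Tc])
  have "Re (mtrace X) = Re (mtrace (T * T)) / D + Re (mtrace T)"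
    unfolding X_def using TT Tc by (simp add: mtrace_add[of _ d] mtrace_smult[of _ d])
  also have "\<dots> \<le> b / D + Re (mtrace T)" using b D by (intro add_right_mono divide_right_mono) auto
  also have "b / D = 1 / t" using b tt t by (simp add: D_def)
  also have "Re (mtrace T) \<le> c" using rs(1) R(4) D by (simp add: D_def)
  finally have X1: "Re (mtrace X) \<le> 1 / t + c" by simp
  have qX: "quad X v = quad (T * T) v / D + quad T v" if v: "v \<in> carrier_vec d" for v
    unfolding X_def using v TT Tc quad_add[OF smult_carrier_mat[OF TT] Tc v] quad_smult[OF TT v, of "1 / D"]
    by simp
  have q2: "quad (T * T) v = (\<Sum>i<d. (cmod ((T *\<^sub>v v) $ i))\<^sup>2)" if v: "v \<in> carrier_vec d" for v
    using quad_congr[OF one_carrier_mat Tc v] quad_one[OF mult_mat_vec_carrier[OF Tc v]]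
      pos_def_madj[OF T(1)] Tc by simp
  have q2': "0 \<le> quad (T * T) v" if v: "v \<in> carrier_vec d" for v
    unfolding q2[OF v] by (intro sum_nonneg) auto
  have X2: "0 \<le> quad X v" if v: "v \<in> carrier_vec d" for v
    unfolding qX[OF v] using q2'[OF v] D pos_def_nonneg[OF T(1) v] by simp
  have "barrier d (Q + complex_of_real (- w) \<cdot>\<^sub>m outer v) c"
    if v: "v \<in> carrier_vec d" and w: "0 < w" "quad X v \<le> 1 / w" for v w
  proof -
    define h where "h = 1 / w - quad T v"
    have hq: "quad (T * T) v / D \<le> h" using w(2) qX[OF v] by (simp add: h_def)
    have h: "0 < h"
    proof (cases "v = 0\<^sub>v d")
      case True
      then show ?thesis using w(1) Tc by (simp add: h_def)
    next
      case False
      have "T *\<^sub>v v \<noteq> 0\<^sub>v d"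
      proof
        assume "T *\<^sub>v v = 0\<^sub>v d"
        then have "quad T v = 0" using v by (simp add: quad_def)
        then show False using pos_def_pos[OF T(1) v False] by simp
      qed
      then have "0 < quad (T * T) v" unfolding q2[OF v] using v by (intro sumsq_pos mult_mat_vec_carrier[OF Tc])
      then show ?thesis using hq D by (smt (verit) divide_pos_pos)
    qed
    have ph: "1 + - w * quad T v = w * h" using w by (simp add: h_def field_simps)
    then have p: "0 < 1 + - w * quad T v" using w h by simp
    obtain R' where R': "pos_def d (Q + complex_of_real (- w) \<cdot>\<^sub>m outer v)" "pos_def d R'"
      "(Q + complex_of_real (- w) \<cdot>\<^sub>m outer v) * R' = 1\<^sub>m d"
      "R' * (Q + complex_of_real (- w) \<cdot>\<^sub>m outer v) = 1\<^sub>m d"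
      "Re (mtrace R') = Re (mtrace T) - (- w) / (1 + - w * quad T v) * quad (T * T) v"
      by (rule rank_one_update[OF pQ T v p])
    have "(- w) / (1 + - w * quad T v) * quad (T * T) v = - (quad (T * T) v / h)"
      unfolding ph using w h by (simp add: field_simps)
    moreover have "quad (T * T) v / h \<le> D" using hq h D by (simp add: field_simps)
    ultimately have "Re (mtrace R') \<le> Re (mtrace R)" using R'(5) rs(1) by (simp add: D_def)
    then show ?thesis unfolding barrier_def using R' R(4) by auto
  qed
  then show ?thesis using that[OF Xc X1 X2] unfolding Q_def by blast
qed

section \<open>Choosing points and weights\<close>

lemma quad_expand:
  assumes X: "X \<in> carrier_mat d d"
  shows "quad X (Matrix.vec d z) = Re (\<Sum>i<d. \<Sum>k<d. X $$ (i,k) * (z k * cnj (z i)))"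
proof -
  have v: "Matrix.vec d z \<in> carrier_vec d" by simp
  have "(X *\<^sub>v Matrix.vec d z) \<bullet>c Matrix.vec d z
      = (\<Sum>i<d. (\<Sum>k<d. X $$ (i,k) * z k) * cnj (z i))"
    unfolding cip_sum[OF v]
  proof (intro sum.cong refl)
    fix i assume "i \<in> {..<d}"
    then have i: "i < d" by simp
    show "(X *\<^sub>v Matrix.vec d z) $ i * cnj (Matrix.vec d z $ i) = (\<Sum>k<d. X $$ (i,k) * z k) * cnj (z i)"
      unfolding mult_vec_index[OF X v i] using i by simp
  qed
  also have "\<dots> = (\<Sum>i<d. \<Sum>k<d. X $$ (i,k) * (z k * cnj (z i)))"
    by (simp add: sum_distrib_right mult.assoc)
  finally show ?thesis by (simp only: quad_def)
qed

lemma
  fixes f :: "nat \<Rightarrow> 'a \<Rightarrow> complex"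
  assumes X: "X \<in> carrier_mat d d"
    and int: "\<And>i j. i < d \<Longrightarrow> j < d \<Longrightarrow> integrable M (\<lambda>x. f i x * cnj (f j x))"
    and ortho: "\<And>i j. i < d \<Longrightarrow> j < d \<Longrightarrow> (\<integral>x. f i x * cnj (f j x) \<partial>M) = (if i = j then 1 else 0)"
  shows integrable_quad: "integrable M (\<lambda>x. quad X (Matrix.vec d (\<lambda>k. f k x)))"
    and integral_quad: "(\<integral>x. quad X (Matrix.vec d (\<lambda>k. f k x)) \<partial>M) = Re (mtrace X)"
proof -
  let ?F = "\<lambda>x. \<Sum>i<d. \<Sum>k<d. X $$ (i,k) * (f k x * cnj (f i x))"
  have I: "integrable M ?F"
    by (intro Bochner_Integration.integrable_sum integrable_mult_right int) auto
  have "(\<integral>x. ?F x \<partial>M) = (\<Sum>i<d. \<integral>x. (\<Sum>k<d. X $$ (i,k) * (f k x * cnj (f i x))) \<partial>M)"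
    by (intro Bochner_Integration.integral_sum Bochner_Integration.integrable_sum integrable_mult_right int) auto
  also have "\<dots> = (\<Sum>i<d. \<Sum>k<d. \<integral>x. X $$ (i,k) * (f k x * cnj (f i x)) \<partial>M)"
    by (intro sum.cong refl Bochner_Integration.integral_sum integrable_mult_right int) auto
  also have "\<dots> = (\<Sum>i<d. \<Sum>k<d. if k = i then X $$ (i,i) else 0)"
    by (intro sum.cong refl) (auto simp: ortho)
  also have "\<dots> = mtrace X" using X by (simp add: mtrace_def)
  finally have E: "(\<integral>x. ?F x \<partial>M) = mtrace X" .
  show "integrable M (\<lambda>x. quad X (Matrix.vec d (\<lambda>k. f k x)))"
    unfolding quad_expand[OF X] by (rule integrable_Re[OF I])
  show "(\<integral>x. quad X (Matrix.vec d (\<lambda>k. f k x)) \<partial>M) = Re (mtrace X)"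
    unfolding quad_expand[OF X] integral_Re[OF I] E ..
qed

lemma positive_integral_witness:
  fixes F :: "'a \<Rightarrow> real"
  assumes "0 < (\<integral>x. F x \<partial>M)"
  obtains x where "x \<in> space M" "0 < F x"
proof -
  have "\<exists>x\<in>space M. 0 < F x"
  proof (rule ccontr)
    assume "\<not> ?thesis"
    then have "0 \<le> (\<integral>x. - F x \<partial>M)" by (intro Bochner_Integration.integral_nonneg) (auto simp: not_less)
    with assms show False by simp
  qed
  then show ?thesis using that by blast
qed

definition diagm :: "nat \<Rightarrow> (nat \<Rightarrow> real) \<Rightarrow> complex mat"
  where "diagm d a = mat d d (\<lambda>(i,j). if i = j then complex_of_real (a i) else 0)"

lemma diagm_carrier[simp]: "diagm d a \<in> carrier_mat d d" by (simp add: diagm_def)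

lemma quad_diagm:
  assumes v: "v \<in> carrier_vec d"
  shows "quad (diagm d a) v = (\<Sum>i<d. a i * (cmod (v $ i))\<^sup>2)"
proof -
  have "(diagm d a *\<^sub>v v) $ i = complex_of_real (a i) * v $ i" if "i < d" for i
  proof -
    have "(diagm d a *\<^sub>v v) $ i = (\<Sum>k<d. if k = i then complex_of_real (a i) * v $ i else 0)"
      unfolding mult_vec_index[OF diagm_carrier v that] using that
      by (intro sum.cong) (auto simp: diagm_def)
    then show ?thesis using that by simp
  qed
  then have "(diagm d a *\<^sub>v v) \<bullet>c v = (\<Sum>i<d. complex_of_real (a i * (cmod (v $ i))\<^sup>2))"
    unfolding cip_sum[OF v] by (intro sum.cong) (auto simp: complex_norm_square mult.assoc simp del: index_mult_mat_vec of_real_power)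
  then show ?thesis by (simp add: quad_def del: of_real_mult of_real_power)
qed

lemma diagm_mult: "diagm d a * diagm d b = diagm d (\<lambda>i. a i * b i)"
proof (rule eq_matI)
  fix i j assume "i < dim_row (diagm d (\<lambda>i. a i * b i))" "j < dim_col (diagm d (\<lambda>i. a i * b i))"
  then have ij: "i < d" "j < d" by (auto simp: diagm_def)
  have "(diagm d a * diagm d b) $$ (i,j) = (\<Sum>k<d. if k = i then (if i = j then complex_of_real (a i * b i) else 0) else 0)"
    unfolding mult_index[OF diagm_carrier diagm_carrier ij]
    using ij by (intro sum.cong) (auto simp: diagm_def)
  then show "(diagm d a * diagm d b) $$ (i,j) = diagm d (\<lambda>i. a i * b i) $$ (i,j)"
    using ij by (auto simp: diagm_def)
qed (auto simp: diagm_def)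

lemma pos_def_diagm:
  assumes "\<And>i. i < d \<Longrightarrow> 0 < a i"
  shows "pos_def d (diagm d a)"
  unfolding pos_def_def
proof (intro conjI ballI impI)
  show "madj (diagm d a) = diagm d a" by (rule eq_matI) (auto simp: madj_def diagm_def)
  fix v :: "complex Matrix.vec" assume v: "v \<in> carrier_vec d" "v \<noteq> 0\<^sub>v d"
  from v obtain i where i: "i < d" "v $ i \<noteq> 0" by (metis eq_vecI carrier_vecD index_zero_vec)
  show "0 < quad (diagm d a) v" unfolding quad_diagm[OF v(1)]
    by (rule sum_pos2[of _ i]) (use i assms in \<open>auto simp: less_imp_le\<close>)
qed simp

lemma barrier_diagm:
  assumes a: "\<And>i. i < d \<Longrightarrow> 0 < a i" and c: "(\<Sum>i<d. 1 / a i) \<le> c"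
  shows "barrier d (diagm d a) c"
proof -
  have one: "diagm d (\<lambda>i. a i * (1 / a i)) = 1\<^sub>m d" "diagm d (\<lambda>i. 1 / a i * a i) = 1\<^sub>m d"
    using a by (auto simp: diagm_def intro!: eq_matI) fastforce+
  have "Re (mtrace (diagm d (\<lambda>i. 1 / a i))) = (\<Sum>i<d. 1 / a i)"
    by (simp add: mtrace_def diagm_def)
  then show ?thesis
    unfolding barrier_def using a c one
    by (intro conjI exI[of _ "diagm d (\<lambda>i. 1 / a i)"] pos_def_diagm) (simp_all add: diagm_mult)
qed

text \<open>
  If \<open>X\<close> and \<open>Y\<close> are the matrices of the lower and the upper step, then the form of \<open>X\<close> exceeds the
  sum of the form of \<open>Y\<close> and \<open>h / \<epsilon>\<close> on average, and therefore at some point. The reciprocal of the value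
  of the form of \<open>X\<close> there is a weight that suits both barriers, and its product with \<open>h\<close> is at most
  \<open>\<epsilon>\<close>.
\<close>

lemma two_sided_barrier_walk:
  fixes f g :: "nat \<Rightarrow> 'a \<Rightarrow> complex" and h :: "'a \<Rightarrow> real"
  assumes d: "0 < d"
    and f: "\<And>i j. i < d \<Longrightarrow> j < d \<Longrightarrow> integrable M (\<lambda>x. f i x * cnj (f j x))"
      "\<And>i j. i < d \<Longrightarrow> j < d \<Longrightarrow> (\<integral>x. f i x * cnj (f j x) \<partial>M) = (if i = j then 1 else 0)"
    and g: "\<And>i j. i < e \<Longrightarrow> j < e \<Longrightarrow> integrable M (\<lambda>x. g i x * cnj (g j x))"
      "\<And>i j. i < e \<Longrightarrow> j < e \<Longrightarrow> (\<integral>x. g i x * cnj (g j x) \<partial>M) = (if i = j then 1 else 0)"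
    and h: "integrable M h" "\<And>x. x \<in> space M \<Longrightarrow> 0 \<le> h x"
    and P: "barrier d P c" and Q: "barrier e Q p"
    and s: "0 < s" "s * c < 1" and t: "0 < t" and \<epsilon>: "0 < \<epsilon>"
    and gap: "1 / t + p + (\<integral>x. h x \<partial>M) / \<epsilon> < 1 / s - c"
  shows "\<exists>x w A B. (\<forall>i<n. x i \<in> space M \<and> 0 < w i) \<and> barrier d A c \<and> barrier e B p \<and>
    (\<forall>v\<in>carrier_vec d. quad A v = quad P v - real n * s * (vnorm2 d v)
        + (\<Sum>i<n. w i * (cmod (v \<bullet>c Matrix.vec d (\<lambda>k. f k (x i))))\<^sup>2)) \<and>
    (\<forall>v\<in>carrier_vec e. quad B v = quad Q v + real n * t * (vnorm2 e v)
        - (\<Sum>i<n. w i * (cmod (v \<bullet>c Matrix.vec e (\<lambda>k. g k (x i))))\<^sup>2)) \<and>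
    (\<Sum>i<n. w i * h (x i)) \<le> real n * \<epsilon>"
proof (induction n)
  case 0
  then show ?case using P Q by auto
next
  case (Suc n)
  then obtain x w A B where xw: "\<And>i. i < n \<Longrightarrow> x i \<in> space M \<and> 0 < w i"
    and A: "barrier d A c" and B: "barrier e B p"
    and qA: "\<And>v. v \<in> carrier_vec d \<Longrightarrow> quad A v = quad P v - real n * s * (vnorm2 d v)
        + (\<Sum>i<n. w i * (cmod (v \<bullet>c Matrix.vec d (\<lambda>k. f k (x i))))\<^sup>2)"
    and qB: "\<And>v. v \<in> carrier_vec e \<Longrightarrow> quad B v = quad Q v + real n * t * (vnorm2 e v)
        - (\<Sum>i<n. w i * (cmod (v \<bullet>c Matrix.vec e (\<lambda>k. g k (x i))))\<^sup>2)"
    and hn: "(\<Sum>i<n. w i * h (x i)) \<le> real n * \<epsilon>"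
    by blast
  obtain X where X: "X \<in> carrier_mat d d" "1 / s - c \<le> Re (mtrace X)"
    "\<And>v w. v \<in> carrier_vec d \<Longrightarrow> 0 < w \<Longrightarrow> 1 / w \<le> quad X v \<Longrightarrow>
      barrier d (A + complex_of_real (- s) \<cdot>\<^sub>m 1\<^sub>m d + complex_of_real w \<cdot>\<^sub>m outer v) c"
    using lower_barrier_step[OF A d s] by metis
  obtain Y where Y: "Y \<in> carrier_mat e e" "Re (mtrace Y) \<le> 1 / t + p"
    "\<And>v. v \<in> carrier_vec e \<Longrightarrow> 0 \<le> quad Y v"
    "\<And>v w. v \<in> carrier_vec e \<Longrightarrow> 0 < w \<Longrightarrow> quad Y v \<le> 1 / w \<Longrightarrow>
      barrier e (B + complex_of_real t \<cdot>\<^sub>m 1\<^sub>m e + complex_of_real (- w) \<cdot>\<^sub>m outer v) p"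
    using upper_barrier_step[OF B t] by metis
  let ?f = "\<lambda>x. Matrix.vec d (\<lambda>k. f k x)" and ?g = "\<lambda>x. Matrix.vec e (\<lambda>k. g k x)"
  have "(\<integral>x. quad X (?f x) - quad Y (?g x) - h x / \<epsilon> \<partial>M) = Re (mtrace X) - Re (mtrace Y) - (\<integral>x. h x \<partial>M) / \<epsilon>"
    using integrable_quad[OF X(1) f] integrable_quad[OF Y(1) g] h(1) integral_quad[OF X(1) f] integral_quad[OF Y(1) g]
    by simp
  also have "\<dots> > 0" using X(2) Y(2) gap by linarith
  finally obtain x0 where x0: "x0 \<in> space M" "0 < quad X (?f x0) - quad Y (?g x0) - h x0 / \<epsilon>"
    by (rule positive_integral_witness)
  have hx0: "0 \<le> h x0 / \<epsilon>" using h(2)[OF x0(1)] \<epsilon> by simp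
  have Yx0: "0 \<le> quad Y (?g x0)" by (rule Y(3)) simp
  define w0 where "w0 = 1 / quad X (?f x0)"
  have w0: "0 < w0" "1 / w0 = quad X (?f x0)" using x0(2) hx0 Yx0 by (auto simp: w0_def)
  have "h x0 / \<epsilon> \<le> 1 / w0" using x0(2) Yx0 w0(2) by linarith
  then have wh: "w0 * h x0 \<le> \<epsilon>" using w0(1) \<epsilon> by (simp add: field_simps)
  define A' where "A' = A + complex_of_real (- s) \<cdot>\<^sub>m 1\<^sub>m d + complex_of_real w0 \<cdot>\<^sub>m outer (?f x0)"
  define B' where "B' = B + complex_of_real t \<cdot>\<^sub>m 1\<^sub>m e + complex_of_real (- w0) \<cdot>\<^sub>m outer (?g x0)"
  have A': "barrier d A' c" unfolding A'_def by (rule X(3)) (use w0 in auto)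
  have B': "barrier e B' p" unfolding B'_def by (rule Y(4)) (use w0 x0(2) hx0 in auto)
  have Ac: "A \<in> carrier_mat d d" and Bc: "B \<in> carrier_mat e e"
    using A B by (auto simp: barrier_def pos_def_def)
  have qA': "quad A' v = quad A v - s * (vnorm2 d v) + w0 * (cmod (v \<bullet>c ?f x0))\<^sup>2"
    if v: "v \<in> carrier_vec d" for v
    unfolding A'_def
    by (subst quad_add[where d=d]) (use Ac v in \<open>auto simp: quad_smult[of _ d] quad_outer[of _ d] quad_shift[OF Ac v, of "- s"] simp del: of_real_minus\<close>)
  have qB': "quad B' v = quad B v + t * (vnorm2 e v) - w0 * (cmod (v \<bullet>c ?g x0))\<^sup>2"
    if v: "v \<in> carrier_vec e" for v
    unfolding B'_def
    by (subst quad_add[where d=e]) (use Bc v in \<open>auto simp: quad_smult[of _ e] quad_outer[of _ e] quad_shift[OF Bc v] simp del: of_real_minus\<close>)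
  define x' where "x' = x(n := x0)"
  define w' where "w' = w(n := w0)"
  have eq: "x' i = x i" "w' i = w i" if "i < n" for i using that by (auto simp: x'_def w'_def)
  have eqn: "x' n = x0" "w' n = w0" by (auto simp: x'_def w'_def)
  show ?case
  proof (rule exI[of _ x'], rule exI[of _ w'], rule exI[of _ A'], rule exI[of _ B'], intro conjI A' B' ballI)
    show "\<forall>i<Suc n. x' i \<in> space M \<and> 0 < w' i"
      using xw x0(1) w0(1) by (auto simp: less_Suc_eq eq eqn)
    show "(\<Sum>i<Suc n. w' i * h (x' i)) \<le> real (Suc n) * \<epsilon>"
      using hn wh by (simp add: eq eqn algebra_simps)
  next
    fix v :: "complex Matrix.vec" assume v: "v \<in> carrier_vec d"
    show "quad A' v = quad P v - real (Suc n) * s * (vnorm2 d v)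
        + (\<Sum>i<Suc n. w' i * (cmod (v \<bullet>c Matrix.vec d (\<lambda>k. f k (x' i))))\<^sup>2)"
      unfolding qA'[OF v] qA[OF v] by (simp add: eq eqn algebra_simps)
  next
    fix v :: "complex Matrix.vec" assume v: "v \<in> carrier_vec e"
    show "quad B' v = quad Q v + real (Suc n) * t * (vnorm2 e v)
        - (\<Sum>i<Suc n. w' i * (cmod (v \<bullet>c Matrix.vec e (\<lambda>k. g k (x' i))))\<^sup>2)"
      unfolding qB'[OF v] qB[OF v] by (simp add: eq eqn algebra_simps)
  qed
qed

text \<open>
  The matrices above act on vectors through the conjugate of the values of the functions, while linear
  combinations of the functions involve no conjugate. Only absolute values matter.
\<close>

lemma cip_vec_cnj:
  "cmod (Matrix.vec d (\<lambda>k. cnj (z k)) \<bullet>c Matrix.vec d u) = cmod (\<Sum>k<d. z k * u k)"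
proof -
  have "Matrix.vec d (\<lambda>k. cnj (z k)) \<bullet>c Matrix.vec d u = (\<Sum>k<d. cnj (z k) * cnj (u k))"
    by (subst cip_sum[where d=d]) auto
  also have "\<dots> = cnj (\<Sum>k<d. z k * u k)" by simp
  finally show ?thesis by (simp only: complex_mod_cnj)
qed

text \<open>
  The walk starts from the diagonal matrices with entries \<open>a\<^sub>k\<close> and \<open>b\<^sub>k\<close>. At its end both matrices are
  at least the reciprocal of their potential, and this is the lower bound for the first Gram matrix
  and the upper bound for the second (multiplied by \<open>p\<close>).
\<close>

lemma two_sided_sparsification:
  fixes f g :: "nat \<Rightarrow> 'a \<Rightarrow> complex" and h :: "'a \<Rightarrow> real"
  assumes d: "0 < d"
    and f: "\<And>i j. i < d \<Longrightarrow> j < d \<Longrightarrow> integrable M (\<lambda>x. f i x * cnj (f j x))"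
      "\<And>i j. i < d \<Longrightarrow> j < d \<Longrightarrow> (\<integral>x. f i x * cnj (f j x) \<partial>M) = (if i = j then 1 else 0)"
    and g: "\<And>i j. i < e \<Longrightarrow> j < e \<Longrightarrow> integrable M (\<lambda>x. g i x * cnj (g j x))"
      "\<And>i j. i < e \<Longrightarrow> j < e \<Longrightarrow> (\<integral>x. g i x * cnj (g j x) \<partial>M) = (if i = j then 1 else 0)"
    and h: "integrable M h" "\<And>x. x \<in> space M \<Longrightarrow> 0 \<le> h x"
    and a: "\<And>i. i < d \<Longrightarrow> 0 < a i" "(\<Sum>i<d. 1 / a i) \<le> 1 / y"
    and b: "\<And>i. i < e \<Longrightarrow> 0 < b i" "(\<Sum>i<e. 1 / b i) \<le> p"
    and y: "0 < y" and s: "0 < s" "s < y" and t: "0 < t" and \<epsilon>: "0 < \<epsilon>"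
    and gap: "1 / t + p + (\<integral>x. h x \<partial>M) / \<epsilon> < 1 / s - 1 / y"
  obtains x w where "\<And>i. i < n \<Longrightarrow> x i \<in> space M" "\<And>i. i < n \<Longrightarrow> 0 < w i"
    "\<And>z. y * (norm2 d z) + real n * s * (norm2 d z) - (\<Sum>k<d. a k * (cmod (z k))\<^sup>2)
        \<le> (\<Sum>i<n. w i * (cmod (\<Sum>k<d. z k * f k (x i)))\<^sup>2)"
    "\<And>z. p * (\<Sum>i<n. w i * (cmod (\<Sum>k<e. z k * g k (x i)))\<^sup>2)
        \<le> p * (\<Sum>k<e. b k * (cmod (z k))\<^sup>2) + (p * (real n * t) - 1) * (norm2 e z)"
    "(\<Sum>i<n. w i * h (x i)) \<le> real n * \<epsilon>"
proof -
  have sy: "s * (1 / y) < 1" using s y by simp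
  obtain x w A B where xw: "\<And>i. i < n \<Longrightarrow> x i \<in> space M \<and> 0 < w i"
    and A: "barrier d A (1 / y)" and B: "barrier e B p"
    and qA: "\<And>v. v \<in> carrier_vec d \<Longrightarrow> quad A v = quad (diagm d a) v - real n * s * (vnorm2 d v)
        + (\<Sum>i<n. w i * (cmod (v \<bullet>c Matrix.vec d (\<lambda>k. f k (x i))))\<^sup>2)"
    and qB: "\<And>v. v \<in> carrier_vec e \<Longrightarrow> quad B v = quad (diagm e b) v + real n * t * (vnorm2 e v)
        - (\<Sum>i<n. w i * (cmod (v \<bullet>c Matrix.vec e (\<lambda>k. g k (x i))))\<^sup>2)"
    and hn: "(\<Sum>i<n. w i * h (x i)) \<le> real n * \<epsilon>"
    using two_sided_barrier_walk[OF d f g h barrier_diagm[OF a] barrier_diagm[OF b] s(1) sy t \<epsilon> gap, of n]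
    by blast
  show ?thesis
  proof (rule that)
    fix z :: "nat \<Rightarrow> complex"
    define v where "v = Matrix.vec d (\<lambda>k. cnj (z k))"
    have v: "v \<in> carrier_vec d" by (simp add: v_def)
    have n2: "(vnorm2 d v) = (norm2 d z)" by (simp add: v_def)
    have q: "quad (diagm d a) v = (\<Sum>k<d. a k * (cmod (z k))\<^sup>2)" unfolding quad_diagm[OF v] by (simp add: v_def)
    have "(norm2 d z) \<le> 1 / y * quad A v"
      using barrier_lower_bound[OF A v] by (simp add: n2)
    then have "y * (norm2 d z) \<le> quad A v" using y by (simp add: field_simps)
    then show "y * (norm2 d z) + real n * s * (norm2 d z) - (\<Sum>k<d. a k * (cmod (z k))\<^sup>2)
        \<le> (\<Sum>i<n. w i * (cmod (\<Sum>k<d. z k * f k (x i)))\<^sup>2)"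
      unfolding qA[OF v] n2 q unfolding v_def cip_vec_cnj by simp
  next
    fix z :: "nat \<Rightarrow> complex"
    define v where "v = Matrix.vec e (\<lambda>k. cnj (z k))"
    have v: "v \<in> carrier_vec e" by (simp add: v_def)
    have n2: "(vnorm2 e v) = (norm2 e z)" by (simp add: v_def)
    have q: "quad (diagm e b) v = (\<Sum>k<e. b k * (cmod (z k))\<^sup>2)" unfolding quad_diagm[OF v] by (simp add: v_def)
    have "(norm2 e z) \<le> p * quad B v"
      using barrier_lower_bound[OF B v] by (simp add: n2)
    then show "p * (\<Sum>i<n. w i * (cmod (\<Sum>k<e. z k * g k (x i)))\<^sup>2)
        \<le> p * (\<Sum>k<e. b k * (cmod (z k))\<^sup>2) + (p * (real n * t) - 1) * (norm2 e z)"
      unfolding qB[OF v] n2 q unfolding v_def cip_vec_cnj by (simp add: algebra_simps)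
  qed (use xw hn in auto)
qed

section \<open>Weighted least squares\<close>

text \<open>
  The rows of \<open>C\<close> give the coefficients of the fit as functionals of the data \<open>y\<close>. They solve the normal
  equations, whose matrix \<open>G\<close> is positive definite by the lower bound. The second claim says that the fit
  does not increase the weighted norm of the data, expressed in terms of the coefficients.
\<close>

lemma weighted_least_squares:
  fixes F :: "nat \<Rightarrow> nat \<Rightarrow> complex" and w :: "nat \<Rightarrow> real"
  assumes a: "0 < a" and w: "\<And>i. i < n \<Longrightarrow> 0 < w i"
    and lower: "\<And>z. a * (norm2 d z) \<le> (\<Sum>i<n. w i * (cmod (\<Sum>k<d. z k * F k i))\<^sup>2)"
  obtains C where "\<And>z k. k < d \<Longrightarrow> (\<Sum>i<n. C k i * (\<Sum>j<d. z j * F j i)) = z k"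
    "\<And>y. a * (\<Sum>k<d. (cmod (\<Sum>i<n. C k i * y i))\<^sup>2) \<le> (\<Sum>i<n. w i * (cmod (y i))\<^sup>2)"
proof -
  define G where "G = mat d d (\<lambda>(k,j). \<Sum>i<n. complex_of_real (w i) * cnj (F k i) * F j i)"
  define r where "r y = Matrix.vec d (\<lambda>k. \<Sum>i<n. complex_of_real (w i) * cnj (F k i) * y i)" for y
  have Gc: "G \<in> carrier_mat d d" by (simp add: G_def)
  have rc: "r y \<in> carrier_vec d" for y by (simp add: r_def)
  have Gz: "G *\<^sub>v Matrix.vec d z = r (\<lambda>i. \<Sum>j<d. z j * F j i)" for z
  proof (rule eq_vecI)
    fix k assume "k < dim_vec (r (\<lambda>i. \<Sum>j<d. z j * F j i))"
    then have k: "k < d" by (simp add: r_def)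
    have "(G *\<^sub>v Matrix.vec d z) $ k = (\<Sum>j<d. \<Sum>i<n. complex_of_real (w i) * cnj (F k i) * F j i * z j)"
      unfolding mult_vec_index[OF Gc vec_carrier k] using k by (simp add: G_def sum_distrib_right)
    also have "\<dots> = (\<Sum>i<n. complex_of_real (w i) * cnj (F k i) * (\<Sum>j<d. z j * F j i))"
      by (subst sum.swap) (simp add: sum_distrib_left mult_ac)
    finally show "(G *\<^sub>v Matrix.vec d z) $ k = r (\<lambda>i. \<Sum>j<d. z j * F j i) $ k" using k by (simp add: r_def)
  qed (use Gc in \<open>simp add: r_def\<close>)
  have rz: "r y \<bullet>c Matrix.vec d z = (\<Sum>i<n. complex_of_real (w i) * (y i * cnj (\<Sum>k<d. z k * F k i)))" for y z
  proof -
    have "r y \<bullet>c Matrix.vec d z = (\<Sum>k<d. \<Sum>i<n. complex_of_real (w i) * cnj (F k i) * y i * cnj (z k))"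
      by (subst cip_sum[OF vec_carrier]) (simp add: r_def sum_distrib_right)
    also have "\<dots> = (\<Sum>i<n. complex_of_real (w i) * (y i * cnj (\<Sum>k<d. z k * F k i)))"
      by (subst sum.swap) (simp add: sum_distrib_left mult_ac)
    finally show ?thesis .
  qed
  have qG: "quad G (Matrix.vec d z) = (\<Sum>i<n. w i * (cmod (\<Sum>k<d. z k * F k i))\<^sup>2)" for z
    unfolding quad_def Gz rz complex_norm_square[symmetric] of_real_mult[symmetric] of_real_sum[symmetric] Re_complex_of_real ..
  have pG: "pos_def d G"
    unfolding pos_def_def
  proof (intro conjI ballI impI Gc)
    show "madj G = G" by (rule eq_matI) (auto simp: madj_def G_def mult_ac)
    fix v :: "complex Matrix.vec" assume v: "v \<in> carrier_vec d" "v \<noteq> 0\<^sub>v d"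
    have vz: "v = Matrix.vec d (\<lambda>k. v $ k)" using v by auto
    have "0 < a * (vnorm2 d v)" using a sumsq_pos[OF v] by simp
    also have "\<dots> \<le> quad G v" by (subst (2) vz) (simp only: qG lower)
    finally show "0 < quad G v" .
  qed
  obtain R where R: "pos_def d R" "G * R = 1\<^sub>m d" "R * G = 1\<^sub>m d" by (rule pos_def_inverse[OF pG])
  note Rc = pos_def_carrier[OF R(1)]
  define C where "C k i = (\<Sum>l<d. R $$ (k,l) * (complex_of_real (w i) * cnj (F l i)))" for k i
  have Ck: "(R *\<^sub>v r y) $ k = (\<Sum>i<n. C k i * y i)" if k: "k < d" for k y
  proof -
    have "(R *\<^sub>v r y) $ k = (\<Sum>l<d. \<Sum>i<n. R $$ (k,l) * (complex_of_real (w i) * cnj (F l i) * y i))"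
      unfolding mult_vec_index[OF Rc rc k] by (simp add: r_def sum_distrib_left)
    also have "\<dots> = (\<Sum>i<n. C k i * y i)"
      by (subst sum.swap) (simp add: C_def sum_distrib_right mult.assoc)
    finally show ?thesis .
  qed
  show ?thesis
  proof (rule that)
    fix z :: "nat \<Rightarrow> complex" and k assume k: "k < d"
    have "R *\<^sub>v (G *\<^sub>v Matrix.vec d z) = Matrix.vec d z"
      using assoc_mult_mat_vec[OF Rc Gc vec_carrier[of d z]] R(3) by simp
    then show "(\<Sum>i<n. C k i * (\<Sum>j<d. z j * F j i)) = z k"
      unfolding Gz using Ck[OF k, of "\<lambda>i. \<Sum>j<d. z j * F j i"] k by simp
  next
    fix y :: "nat \<Rightarrow> complex"
    define c where "c k = (\<Sum>i<n. C k i * y i)" for k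
    define h where "h i = (\<Sum>k<d. c k * F k i)" for i
    have cv: "R *\<^sub>v r y = Matrix.vec d c"
      by (rule eq_vecI) (use Rc Ck in \<open>auto simp: c_def simp del: index_mult_mat_vec\<close>)
    have "G *\<^sub>v Matrix.vec d c = r y"
      unfolding cv[symmetric] using assoc_mult_mat_vec[OF Gc Rc rc] R(2) rc by simp
    then have "quad G (Matrix.vec d c) = Re (\<Sum>i<n. complex_of_real (w i) * (y i * cnj (h i)))"
      unfolding quad_def h_def rz[symmetric] by simp
    also have "\<dots> = (\<Sum>i<n. w i * Re (y i * cnj (h i)))" by (simp add: Re_sum)
    \<comment> \<open>The fit \<open>h\<close> satisfies \<open>\<parallel>h\<parallel>\<^sup>2 = Re \<langle>y, h\<rangle> \<le> (\<parallel>y\<parallel>\<^sup>2 + \<parallel>h\<parallel>\<^sup>2) / 2\<close>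
      in the weighted norm.\<close>
    also have "\<dots> \<le> (\<Sum>i<n. w i * (((cmod (y i))\<^sup>2 + (cmod (h i))\<^sup>2) / 2))"
    proof (intro sum_mono mult_left_mono)
      fix i assume "i \<in> {..<n}"
      show "Re (y i * cnj (h i)) \<le> ((cmod (y i))\<^sup>2 + (cmod (h i))\<^sup>2) / 2"
        using complex_Re_le_cmod[of "y i * cnj (h i)"] sum_squares_bound[of "cmod (y i)" "cmod (h i)"]
        by (simp add: norm_mult)
    qed (use w in \<open>auto simp: less_imp_le\<close>)
    also have "\<dots> = ((\<Sum>i<n. w i * (cmod (y i))\<^sup>2) + (\<Sum>i<n. w i * (cmod (h i))\<^sup>2)) / 2"
      by (simp add: sum.distrib[symmetric] sum_divide_distrib distrib_left)
    also have "(\<Sum>i<n. w i * (cmod (h i))\<^sup>2) = quad G (Matrix.vec d c)" by (simp add: qG h_def)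
    finally have "quad G (Matrix.vec d c) \<le> (\<Sum>i<n. w i * (cmod (y i))\<^sup>2)" by simp
    then show "a * (\<Sum>k<d. (cmod (\<Sum>i<n. C k i * y i))\<^sup>2) \<le> (\<Sum>i<n. w i * (cmod (y i))\<^sup>2)"
      using lower[of c] unfolding qG c_def by linarith
  qed
qed

lemma weighted_minkowski:
  fixes P Q :: "nat \<Rightarrow> complex"
  assumes w: "\<And>i. i < n \<Longrightarrow> 0 \<le> w i"
    and P: "(\<Sum>i<n. w i * (cmod (P i))\<^sup>2) \<le> \<alpha>" and Q: "(\<Sum>i<n. w i * (cmod (Q i))\<^sup>2) \<le> \<beta>"
  shows "(\<Sum>i<n. w i * (cmod (P i + Q i))\<^sup>2) \<le> (sqrt \<alpha> + sqrt \<beta>)\<^sup>2"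
proof -
  let ?p = "\<lambda>i. sqrt (w i) * cmod (P i)" and ?q = "\<lambda>i. sqrt (w i) * cmod (Q i)"
  have L: "L2_set (\<lambda>i. sqrt (w i) * cmod (X i)) {..<n} = sqrt (\<Sum>i<n. w i * (cmod (X i))\<^sup>2)" for X :: "nat \<Rightarrow> complex"
    unfolding L2_set_def using w by (intro arg_cong[where f = sqrt] sum.cong) (auto simp: power_mult_distrib)
  have "(\<Sum>i<n. w i * (cmod (P i + Q i))\<^sup>2) \<le> (\<Sum>i<n. (?p i + ?q i)\<^sup>2)"
  proof (intro sum_mono)
    fix i assume "i \<in> {..<n}"
    then have wi: "0 \<le> w i" using w by simp
    have "(cmod (P i + Q i))\<^sup>2 \<le> (cmod (P i) + cmod (Q i))\<^sup>2" by (intro power_mono norm_triangle_ineq) auto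
    then have "w i * (cmod (P i + Q i))\<^sup>2 \<le> (sqrt (w i))\<^sup>2 * (cmod (P i) + cmod (Q i))\<^sup>2"
      using wi by (simp add: mult_left_mono)
    also have "\<dots> = (?p i + ?q i)\<^sup>2" by (simp only: power_mult_distrib[symmetric] distrib_left)
    finally show "w i * (cmod (P i + Q i))\<^sup>2 \<le> (?p i + ?q i)\<^sup>2" .
  qed
  also have "\<dots> = (L2_set (\<lambda>i. ?p i + ?q i) {..<n})\<^sup>2" by (simp add: L2_set_def sum_nonneg)
  also have "\<dots> \<le> (L2_set ?p {..<n} + L2_set ?q {..<n})\<^sup>2" by (intro power_mono L2_set_triangle_ineq L2_set_nonneg)
  also have "\<dots> \<le> (sqrt \<alpha> + sqrt \<beta>)\<^sup>2"
    unfolding L using P Q by (intro power_mono add_mono real_sqrt_le_mono add_nonneg_nonneg real_sqrt_ge_zero sum_nonneg) (use w in auto)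
  finally show ?thesis .
qed

section \<open>Square integrable functions\<close>

lemma sum_cscale_apply: "(\<Sum>i\<in>I. cscale (c i) (f i)) x = (\<Sum>i\<in>I. c i * f i x)"
  by (induction I rule: infinite_finite_induct) (auto simp: cscale_def)

lemma L2_mult_integrable:
  assumes "f \<in> L2_funs M" "g \<in> L2_funs M"
  shows "integrable M (\<lambda>x. f x * cnj (g x))"
proof (rule Bochner_Integration.integrable_bound)
  show "integrable M (\<lambda>x. (cmod (f x))\<^sup>2 + (cmod (g x))\<^sup>2)"
    using assms by (auto simp: L2_funs_def)
  have [measurable]: "f \<in> borel_measurable M" "g \<in> borel_measurable M" using assms by (auto simp: L2_funs_def)
  have [measurable]: "(\<lambda>x. cnj (g x)) \<in> borel_measurable M"
    by (rule measurable_compose[of g M borel cnj]) (auto intro!: borel_measurable_continuous_onI continuous_intros)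
  show "(\<lambda>x. f x * cnj (g x)) \<in> borel_measurable M" by measurable
  have "cmod a * cmod b \<le> (cmod a)\<^sup>2 + (cmod b)\<^sup>2" for a b
    using sum_squares_bound[of "cmod a" "cmod b"] mult_nonneg_nonneg[OF norm_ge_zero[of a] norm_ge_zero[of b]] by linarith
  then show "AE x in M. norm (f x * cnj (g x)) \<le> norm ((cmod (f x))\<^sup>2 + (cmod (g x))\<^sup>2)"
    by (intro AE_I2) (simp add: norm_mult)
qed

lemma L2_add: "f \<in> L2_funs M \<Longrightarrow> g \<in> L2_funs M \<Longrightarrow> f + g \<in> L2_funs M"
proof -
  assume f: "f \<in> L2_funs M" and g: "g \<in> L2_funs M"
  have [measurable]: "f \<in> borel_measurable M" "g \<in> borel_measurable M" using f g by (auto simp: L2_funs_def)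
  have "integrable M (\<lambda>x. (cmod (f x + g x))\<^sup>2)"
  proof (rule Bochner_Integration.integrable_bound)
    show "integrable M (\<lambda>x. 2 * (cmod (f x))\<^sup>2 + 2 * (cmod (g x))\<^sup>2)"
      using f g by (auto simp: L2_funs_def)
    have "(cmod (a + b))\<^sup>2 \<le> 2 * (cmod a)\<^sup>2 + 2 * (cmod b)\<^sup>2" for a b
    proof -
      have "(cmod (a + b))\<^sup>2 \<le> (cmod a + cmod b)\<^sup>2" by (intro power_mono norm_triangle_ineq) auto
      also have "\<dots> \<le> 2 * (cmod a)\<^sup>2 + 2 * (cmod b)\<^sup>2"
        using sum_squares_bound[of "cmod a" "cmod b"] by (simp add: power2_sum)
      finally show ?thesis .
    qed
    then show "AE x in M. norm ((cmod (f x + g x))\<^sup>2) \<le> norm (2 * (cmod (f x))\<^sup>2 + 2 * (cmod (g x))\<^sup>2)"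
      by (intro AE_I2) simp
  qed measurable
  then show ?thesis using f g by (auto simp: L2_funs_def functions_on_def plus_fun_def)
qed

lemma L2_scale: "f \<in> L2_funs M \<Longrightarrow> cscale c f \<in> L2_funs M"
  by (auto simp: L2_funs_def functions_on_def cscale_def norm_mult power_mult_distrib)

lemma L2_inner_add:
  "f \<in> L2_funs M \<Longrightarrow> g \<in> L2_funs M \<Longrightarrow> h \<in> L2_funs M \<Longrightarrow>
    L2_inner M (f + g) h = L2_inner M f h + L2_inner M g h"
  by (simp add: L2_inner_def distrib_right L2_mult_integrable)

lemma L2_inner_scale: "L2_inner M (cscale c f) g = c * L2_inner M f g"
  by (simp add: L2_inner_def cscale_def mult.assoc)

lemma L2_inner_commute: "L2_inner M g f = cnj (L2_inner M f g)"
proof -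
  have "(\<integral>x. cnj (f x * cnj (g x)) \<partial>M) = cnj (L2_inner M f g)"
    unfolding L2_inner_def by (rule Bochner_Integration.integral_cnj)
  then show ?thesis by (simp add: L2_inner_def mult.commute)
qed

lemma L2_norm_sq: "(L2_norm M f)\<^sup>2 = (\<integral>x. (cmod (f x))\<^sup>2 \<partial>M)"
  by (simp add: L2_norm_def)

lemma L2_inner_self: "L2_inner M f f = complex_of_real ((L2_norm M f)\<^sup>2)"
  by (simp only: L2_norm_sq L2_inner_def complex_norm_square[symmetric] integral_complex_of_real)

section \<open>Hilbert spaces of functions\<close>

text \<open>
  Orthonormality of indexed families also covers sets, by taking the identity as the family.
\<close>

definition orthonormal_family :: "(('a \<Rightarrow> complex) \<Rightarrow> ('a \<Rightarrow> complex) \<Rightarrow> complex) \<Rightarrow> 'i set \<Rightarrow> ('i \<Rightarrow> 'a \<Rightarrow> complex) \<Rightarrow> bool"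
  where "orthonormal_family ip I e \<longleftrightarrow> (\<forall>i\<in>I. \<forall>j\<in>I. ip (e i) (e j) = (if i = j then 1 else 0))"

context hilbert_function_space
begin

abbreviation "nrm f \<equiv> ip_norm ip f"

lemma zero_in: "0 \<in> H" by (rule cfun.subspace_0[OF subspace])
lemma add_in: "f \<in> H \<Longrightarrow> g \<in> H \<Longrightarrow> f + g \<in> H" by (rule cfun.subspace_add[OF subspace])
lemma diff_in: "f \<in> H \<Longrightarrow> g \<in> H \<Longrightarrow> f - g \<in> H" by (rule cfun.subspace_diff[OF subspace])
lemma scale_in: "f \<in> H \<Longrightarrow> cscale c f \<in> H" by (rule cfun.subspace_scale[OF subspace])
lemma sum_in: "(\<And>i. i \<in> I \<Longrightarrow> f i \<in> H) \<Longrightarrow> (\<Sum>i\<in>I. cscale (c i) (f i)) \<in> H"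
  by (intro cfun.subspace_sum[OF subspace] scale_in)
lemmas in_H = zero_in add_in diff_in scale_in sum_in

lemma ip_zero_left [simp]: "g \<in> H \<Longrightarrow> ip 0 g = 0"
  using ip_scale[of 0 g 0] zero_in by simp

lemma ip_diff: "f \<in> H \<Longrightarrow> g \<in> H \<Longrightarrow> h \<in> H \<Longrightarrow> ip (f - g) h = ip f h - ip g h"
  using ip_add[of "f - g" g h] by (simp add: in_H)

lemma ip_sum: "(\<And>i. i \<in> I \<Longrightarrow> f i \<in> H) \<Longrightarrow> g \<in> H \<Longrightarrow>
    ip (\<Sum>i\<in>I. cscale (c i) (f i)) g = (\<Sum>i\<in>I. c i * ip (f i) g)"
  by (induction I rule: infinite_finite_induct) (auto simp: ip_add ip_scale in_H)

lemma ip_add_right: "f \<in> H \<Longrightarrow> g \<in> H \<Longrightarrow> h \<in> H \<Longrightarrow> ip h (f + g) = ip h f + ip h g"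
  using ip_commute[of "f + g" h] ip_commute[of f h] ip_commute[of g h] by (simp add: in_H ip_add)
lemma ip_diff_right: "f \<in> H \<Longrightarrow> g \<in> H \<Longrightarrow> h \<in> H \<Longrightarrow> ip h (f - g) = ip h f - ip h g"
  using ip_commute[of "f - g" h] ip_commute[of f h] ip_commute[of g h] by (simp add: in_H ip_diff)
lemma ip_scale_right: "f \<in> H \<Longrightarrow> h \<in> H \<Longrightarrow> ip h (cscale c f) = cnj c * ip h f"
  using ip_commute[of "cscale c f" h] ip_commute[of f h] by (simp add: in_H ip_scale)

lemma Re_ip_nonneg: "f \<in> H \<Longrightarrow> 0 \<le> Re (ip f f)"
  using ip_pos[of f] by (cases "f = 0") (auto simp: zero_in)

lemma nrm_sq: "f \<in> H \<Longrightarrow> (nrm f)\<^sup>2 = Re (ip f f)"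
  by (simp add: ip_norm_def Re_ip_nonneg)

lemma ip_self: "f \<in> H \<Longrightarrow> ip f f = complex_of_real ((nrm f)\<^sup>2)"
  using ip_commute[of f f] by (simp add: nrm_sq complex_eq_iff)

lemma nrm_nonneg: "f \<in> H \<Longrightarrow> 0 \<le> nrm f" by (simp add: ip_norm_def Re_ip_nonneg)

lemma nrm_eq_0: "f \<in> H \<Longrightarrow> nrm f = 0 \<longleftrightarrow> f = 0"
  using ip_pos[of f] nrm_sq[of f] by (cases "f = 0") (auto simp: ip_norm_def zero_in)

lemma nrm_pos: "f \<in> H \<Longrightarrow> f \<noteq> 0 \<Longrightarrow> 0 < nrm f" using nrm_eq_0 nrm_nonneg by (smt (verit))

lemma nrm_scale: "f \<in> H \<Longrightarrow> nrm (cscale c f) = cmod c * nrm f"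
proof -
  assume f: "f \<in> H"
  have "(nrm (cscale c f))\<^sup>2 = Re ((c * cnj c) * ip f f)"
    unfolding nrm_sq[OF scale_in[OF f]] ip_scale[OF f scale_in[OF f]] ip_scale_right[OF f f] mult.assoc ..
  also have "\<dots> = (cmod c * nrm f)\<^sup>2"
    unfolding complex_norm_square[symmetric] ip_self[OF f]
    by (simp add: power_mult_distrib flip: of_real_mult del: of_real_power)
  finally show ?thesis using f nrm_nonneg[OF f] nrm_nonneg[OF scale_in[OF f]] by (simp add: power2_eq_iff_nonneg)
qed

lemma normalize:
  assumes "f \<in> H" "f \<noteq> 0"
  shows "nrm (cscale (complex_of_real (1 / nrm f)) f) = 1"
  using assms nrm_pos[OF assms] by (simp add: nrm_scale norm_divide)

lemma cauchy_schwarz: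
  assumes f: "f \<in> H" and g: "g \<in> H"
  shows "(cmod (ip f g))\<^sup>2 \<le> (nrm f)\<^sup>2 * (nrm g)\<^sup>2"
proof (cases "g = 0")
  case True
  then show ?thesis using f ip_commute[of 0 f] by (simp add: zero_in)
next
  case False
  define a where "a = (nrm g)\<^sup>2"
  have a: "0 < a" using nrm_pos[OF g False] by (simp add: a_def)
  define t where "t = ip f g / complex_of_real a"
  have "ip (f - cscale t g) (f - cscale t g) = ip f f - cnj t * ip f g - t * ip g f + t * cnj t * ip g g"
    using f g by (simp add: ip_diff ip_diff_right ip_scale ip_scale_right in_H algebra_simps)
  also have "\<dots> = ip f f - complex_of_real ((cmod (ip f g))\<^sup>2 / a)"
    using a ip_commute[OF f g] unfolding ip_self[OF g] a_def[symmetric] t_def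
    by (simp add: field_simps complex_norm_square[symmetric] power2_eq_square[of "complex_of_real a"])
  finally have "0 \<le> Re (ip f f) - (cmod (ip f g))\<^sup>2 / a"
    using Re_ip_nonneg[of "f - cscale t g"] f g by (simp add: in_H)
  then have "(cmod (ip f g))\<^sup>2 / a \<le> (nrm f)\<^sup>2" using nrm_sq[OF f] by simp
  then show ?thesis using a by (simp add: a_def pos_divide_le_eq)
qed

definition proj :: "'i set \<Rightarrow> ('i \<Rightarrow> 'a \<Rightarrow> complex) \<Rightarrow> ('a \<Rightarrow> complex) \<Rightarrow> 'a \<Rightarrow> complex"
  where "proj I e f = (\<Sum>i\<in>I. cscale (ip f (e i)) (e i))"

lemma proj_in: "(\<And>i. i \<in> I \<Longrightarrow> e i \<in> H) \<Longrightarrow> proj I e f \<in> H"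
  by (simp add: proj_def in_H)

lemma ip_combination:
  assumes "finite I" "\<And>i. i \<in> I \<Longrightarrow> e i \<in> H" "orthonormal_family ip I e" "j \<in> I"
  shows "ip (\<Sum>i\<in>I. cscale (c i) (e i)) (e j) = c j"
proof -
  have "ip (\<Sum>i\<in>I. cscale (c i) (e i)) (e j) = (\<Sum>i\<in>I. c i * ip (e i) (e j))"
    using assms by (intro ip_sum) auto
  also have "\<dots> = (\<Sum>i\<in>I. if i = j then c j else 0)"
    using assms(3,4) by (intro sum.cong) (auto simp: orthonormal_family_def)
  finally show ?thesis using assms by simp
qed

lemma residual_orthogonal:
  assumes "finite I" "\<And>i. i \<in> I \<Longrightarrow> e i \<in> H" "orthonormal_family ip I e" "j \<in> I" "f \<in> H"
  shows "ip (f - proj I e f) (e j) = 0"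
  using assms ip_combination[OF assms(1-4), of "\<lambda>i. ip f (e i)"]
  by (subst ip_diff) (auto simp: proj_in, simp add: proj_def)

lemma nrm_combination:
  assumes "finite I" "\<And>i. i \<in> I \<Longrightarrow> e i \<in> H" "orthonormal_family ip I e"
  shows "(nrm (\<Sum>i\<in>I. cscale (c i) (e i)))\<^sup>2 = (\<Sum>i\<in>I. (cmod (c i))\<^sup>2)"
proof -
  let ?s = "\<Sum>i\<in>I. cscale (c i) (e i)"
  have s: "?s \<in> H" using assms by (simp add: in_H)
  have "ip ?s ?s = (\<Sum>i\<in>I. c i * ip (e i) ?s)" using assms s by (intro ip_sum) auto
  also have "\<dots> = (\<Sum>i\<in>I. complex_of_real ((cmod (c i))\<^sup>2))"
  proof (intro sum.cong refl)
    fix i assume i: "i \<in> I"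
    have "ip (e i) ?s = cnj (ip ?s (e i))" using i assms s by (intro ip_commute) auto
    then have "ip (e i) ?s = cnj (c i)" by (simp only: ip_combination[OF assms i])
    then show "c i * ip (e i) ?s = complex_of_real ((cmod (c i))\<^sup>2)"
      by (simp only: complex_norm_square)
  qed
  finally show ?thesis using nrm_sq[OF s] by (simp del: of_real_power)
qed

lemma pythagoras:
  assumes "finite I" "\<And>i. i \<in> I \<Longrightarrow> e i \<in> H" "orthonormal_family ip I e" "f \<in> H"
  shows "(nrm f)\<^sup>2 = (\<Sum>i\<in>I. (cmod (ip f (e i)))\<^sup>2) + (nrm (f - proj I e f))\<^sup>2"
proof -
  define g where "g = f - proj I e f"
  have p: "proj I e f \<in> H" and g: "g \<in> H" using assms by (auto simp: g_def in_H proj_in)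
  have "ip (proj I e f) g = (\<Sum>i\<in>I. ip f (e i) * ip (e i) g)"
    unfolding proj_def using assms g by (intro ip_sum) auto
  also have "\<dots> = 0"
  proof (intro sum.neutral ballI)
    fix i assume i: "i \<in> I"
    have "ip (e i) g = cnj (ip g (e i))" using i assms g by (intro ip_commute) auto
    then show "ip f (e i) * ip (e i) g = 0"
      using residual_orthogonal[OF assms(1-3) i assms(4)] by (simp add: g_def)
  qed
  finally have p1: "ip (proj I e f) g = 0" .
  then have p2: "ip g (proj I e f) = 0" using ip_commute[OF p g] by simp
  have "f = proj I e f + g" by (simp add: g_def)
  then have "ip f f = ip (proj I e f + g) (proj I e f + g)" by simp
  also have "\<dots> = ip (proj I e f) (proj I e f) + ip g g" using p g p1 p2 by (simp add: ip_add ip_add_right in_H)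
  finally have "(nrm f)\<^sup>2 = (nrm (proj I e f))\<^sup>2 + (nrm g)\<^sup>2" using assms p g by (simp add: nrm_sq)
  then show ?thesis using nrm_combination[OF assms(1-3), of "\<lambda>i. ip f (e i)"] by (simp add: proj_def g_def)
qed

lemma bessel:
  assumes "finite I" "\<And>i. i \<in> I \<Longrightarrow> e i \<in> H" "orthonormal_family ip I e" "f \<in> H"
  shows "(\<Sum>i\<in>I. (cmod (ip f (e i)))\<^sup>2) \<le> (nrm f)\<^sup>2"
  using pythagoras[OF assms] by simp

text \<open>
  The orthonormal family is indexed by the given vectors, so that it inherits their number and any
  indexing of them.
\<close>

lemma gram_schmidt:
  assumes "finite B" "cfun.independent B" "B \<subseteq> H"
  shows "\<exists>e. e ` B \<subseteq> H \<and> orthonormal_family ip B e \<and> cfun.span (e ` B) = cfun.span B"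
  using assms
proof (induction B rule: finite_induct)
  case empty
  then show ?case by (auto simp: orthonormal_family_def)
next
  case (insert b B)
  have indB: "cfun.independent B" using insert.prems(1) insert.hyps by (simp add: cfun.independent_insert)
  obtain e where e: "e ` B \<subseteq> H" "orthonormal_family ip B e" "cfun.span (e ` B) = cfun.span B"
    using insert.IH[OF indB] insert.prems(2) by auto
  have eH: "\<And>i. i \<in> B \<Longrightarrow> e i \<in> H" using e(1) by auto
  have b: "b \<in> H" using insert.prems by simp
  define r where "r = b - proj B e b"
  have pr: "proj B e b \<in> cfun.span (e ` B)"
    unfolding proj_def by (intro cfun.span_sum cfun.span_scale cfun.span_base) auto
  have r: "r \<in> H" using b eH by (simp add: r_def in_H proj_in)
  have "b \<notin> cfun.span B" using insert.prems(1) insert.hyps by (simp add: cfun.independent_insert)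
  then have r0: "r \<noteq> 0" using pr e(3) by (auto simp: r_def)
  define u where "u = cscale (complex_of_real (1 / nrm r)) r"
  have u: "u \<in> H" "nrm u = 1" unfolding u_def using scale_in[OF r] normalize[OF r r0] by simp_all
  have nr: "nrm r \<noteq> 0" using nrm_eq_0[OF r] r0 by simp
  have ru: "cscale (complex_of_real (nrm r)) u = r"
  proof -
    have "complex_of_real (nrm r) * complex_of_real (1 / nrm r) = 1" using nr by simp
    then show ?thesis by (simp only: u_def cfun.scale_scale cfun.scale_one)
  qed
  define e' where "e' = e(b := u)"
  have e'B: "e' ` B = e ` B" "e' b = u" using insert.hyps by (auto simp: e'_def)
  have ue: "ip u (e j) = 0" "ip (e j) u = 0" if j: "j \<in> B" for j
  proof -
    show "ip u (e j) = 0"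
      unfolding u_def using ip_scale[OF r eH[OF j]] residual_orthogonal[OF insert.hyps(1) eH e(2) j b] by (simp add: r_def)
    then show "ip (e j) u = 0" using ip_commute[OF u(1) eH[OF j]] by simp
  qed
  have uu: "ip u u = 1" using ip_self[OF u(1)] u(2) by simp
  have "orthonormal_family ip (insert b B) e'"
    unfolding orthonormal_family_def
  proof (intro ballI)
    fix i j assume ij: "i \<in> insert b B" "j \<in> insert b B"
    have e'u: "e' i = (if i = b then u else e i)" "e' j = (if j = b then u else e j)" by (simp_all add: e'_def)
    have ee: "ip (e i) (e j) = (if i = j then 1 else 0)" if "i \<in> B" "j \<in> B"
      using e(2) that unfolding orthonormal_family_def by blast
    show "ip (e' i) (e' j) = (if i = j then 1 else 0)"
      unfolding e'u using ij insert.hyps(2) by (cases "i = b"; cases "j = b") (simp_all add: uu ue ee)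
  qed
  moreover have "cfun.span (e' ` insert b B) = cfun.span (insert b B)"
  proof -
    have "cfun.span (insert r (e ` B)) = cfun.span (insert b (e ` B))"
      by (rule cfun.eq_span_insert_eq) (use pr in \<open>simp add: r_def cfun.span_neg\<close>)
    also have "\<dots> = cfun.span (insert b B)" by (simp only: cfun.span_insert e(3))
    finally have 1: "cfun.span (insert r (e ` B)) = cfun.span (insert b B)" .
    have "cfun.span (insert u (e ` B)) = cfun.span (insert r (e ` B))"
    proof (intro equalityI cfun.span_minimal cfun.subspace_span insert_subsetI)
      show "u \<in> cfun.span (insert r (e ` B))" unfolding u_def by (intro cfun.span_scale cfun.span_base) simp
      show "r \<in> cfun.span (insert u (e ` B))" by (subst ru[symmetric]) (intro cfun.span_scale cfun.span_base, simp)
      show "e ` B \<subseteq> cfun.span (insert r (e ` B))" "e ` B \<subseteq> cfun.span (insert u (e ` B))"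
        by (auto intro: cfun.span_base)
    qed
    then show ?thesis using 1 e'B by simp
  qed
  moreover have "e' ` insert b B \<subseteq> H" using e(1) e'B u by simp
  ultimately show ?case by blast
qed

end

section \<open>The Rayleigh quotient of the embedding\<close>

locale embedded_rkhs = rkhs "space M" H ip K
  for M :: "'a measure" and H ip K +
  assumes H_L2: "H \<subseteq> L2_funs M"
    and embedding_bounded: "\<exists>C. \<forall>f\<in>H. (L2_norm M f)\<^sup>2 \<le> C * (ip_norm ip f)\<^sup>2"
    and embedding_injective: "\<And>f. f \<in> H \<Longrightarrow> f \<noteq> 0 \<Longrightarrow> L2_norm M f \<noteq> 0"
    and kernel_integrable: "integrable M (\<lambda>x. K x x)"
begin

abbreviation "q f \<equiv> (L2_norm M f)\<^sup>2"

lemma in_L2: "f \<in> H \<Longrightarrow> f \<in> L2_funs M" using H_L2 by auto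

lemma q_pos: "f \<in> H \<Longrightarrow> f \<noteq> 0 \<Longrightarrow> 0 < q f" using embedding_injective by simp

lemma kernel_diagonal:
  assumes x: "x \<in> space M"
  shows "K x x = complex_of_real ((nrm (K x))\<^sup>2)"
  using reproducing[OF x kernel_mem[OF x]] ip_self[OF kernel_mem[OF x]] by simp

lemma kernel_bessel:
  assumes "finite I" "\<And>i. i \<in> I \<Longrightarrow> e i \<in> H" "orthonormal_family ip I e" "x \<in> space M"
  shows "(\<Sum>i\<in>I. (cmod (e i x))\<^sup>2) \<le> Re (K x x)"
proof -
  have k: "K x \<in> H" by (rule kernel_mem[OF assms(4)])
  have "(\<Sum>i\<in>I. (cmod (e i x))\<^sup>2) = (\<Sum>i\<in>I. (cmod (ip (K x) (e i)))\<^sup>2)"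
  proof (intro sum.cong refl)
    fix i assume i: "i \<in> I"
    show "(cmod (e i x))\<^sup>2 = (cmod (ip (K x) (e i)))\<^sup>2"
      using reproducing[OF assms(4) assms(2)[OF i]] ip_commute[OF assms(2)[OF i] k] by simp
  qed
  also have "\<dots> \<le> (nrm (K x))\<^sup>2" by (rule bessel[OF assms(1-3) k])
  finally show ?thesis using kernel_diagonal[OF assms(4)] by (simp del: of_real_power)
qed

definition trace_K :: real where "trace_K = (\<integral>x. Re (K x x) \<partial>M)"

lemma q_integrable: "f \<in> H \<Longrightarrow> integrable M (\<lambda>x. (cmod (f x))\<^sup>2)"
  using in_L2 by (auto simp: L2_funs_def)

text \<open>
  By Bessel's inequality for \<open>K x\<close>, the sum of \<open>|e\<^sub>i(x)|\<^sup>2\<close> is at most \<open>K x x\<close>; integrate. This is the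
  Hilbert-Schmidt property of the embedding, and the only compactness that is used.
\<close>

lemma q_sum_bound:
  assumes "finite I" "\<And>i. i \<in> I \<Longrightarrow> e i \<in> H" "orthonormal_family ip I e"
  shows "(\<Sum>i\<in>I. q (e i)) \<le> trace_K"
proof -
  have "(\<Sum>i\<in>I. q (e i)) = (\<integral>x. (\<Sum>i\<in>I. (cmod (e i x))\<^sup>2) \<partial>M)"
    using assms(2) by (subst Bochner_Integration.integral_sum) (auto simp: L2_norm_sq q_integrable)
  also have "\<dots> \<le> trace_K"
    unfolding trace_K_def
    by (intro integral_mono Bochner_Integration.integrable_sum q_integrable assms(2) integrable_Re
          kernel_integrable kernel_bessel[OF assms]) auto
  finally show ?thesis .
qed

text \<open>
  The form of \<open>\<theta> - T\<^sup>* T\<close>, where \<open>T\<close> is the embedding. It is positive semidefinite where \<open>\<theta>\<close> bounds the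
  Rayleigh quotient, and \<open>gap \<theta> f g\<close> vanishes for all \<open>g\<close> exactly if \<open>f\<close> is zero or an eigenvector for \<open>\<theta>\<close>.
\<close>

definition gap :: "real \<Rightarrow> ('a \<Rightarrow> complex) \<Rightarrow> ('a \<Rightarrow> complex) \<Rightarrow> complex"
  where "gap \<theta> f g = complex_of_real \<theta> * ip f g - L2_inner M f g"

lemma gap_add: "f \<in> H \<Longrightarrow> g \<in> H \<Longrightarrow> h \<in> H \<Longrightarrow> gap \<theta> (f + g) h = gap \<theta> f h + gap \<theta> g h"
  by (simp add: gap_def ip_add L2_inner_add in_L2 algebra_simps)
lemma gap_scale: "f \<in> H \<Longrightarrow> h \<in> H \<Longrightarrow> gap \<theta> (cscale c f) h = c * gap \<theta> f h"
  by (simp add: gap_def ip_scale L2_inner_scale algebra_simps)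
lemma gap_commute: "f \<in> H \<Longrightarrow> h \<in> H \<Longrightarrow> gap \<theta> h f = cnj (gap \<theta> f h)"
  using ip_commute[of f h] L2_inner_commute[of M h f] by (simp add: gap_def)
lemma gap_add_right: "f \<in> H \<Longrightarrow> g \<in> H \<Longrightarrow> h \<in> H \<Longrightarrow> gap \<theta> h (f + g) = gap \<theta> h f + gap \<theta> h g"
  using gap_commute[of "f + g" h] gap_commute[of f h] gap_commute[of g h] by (simp add: in_H gap_add)
lemma gap_scale_right: "f \<in> H \<Longrightarrow> h \<in> H \<Longrightarrow> gap \<theta> h (cscale c f) = cnj c * gap \<theta> h f"
  using gap_commute[of "cscale c f" h] gap_commute[of f h] by (simp add: in_H gap_scale)
lemma gap_self: "f \<in> H \<Longrightarrow> Re (gap \<theta> f f) = \<theta> * (nrm f)\<^sup>2 - q f"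
  by (simp add: gap_def ip_self L2_inner_self flip: of_real_power)

lemma minus_cscale: "f - g = f + cscale (-1) (g :: 'a \<Rightarrow> complex)"
  by (auto simp: cscale_def fun_eq_iff)

lemma gap_expand:
  assumes f: "f \<in> H" and g: "g \<in> H"
  shows "gap \<theta> (f + cscale c g) (f + cscale c g) =
    gap \<theta> f f + cnj c * gap \<theta> f g + c * gap \<theta> g f + c * cnj c * gap \<theta> g g"
proof -
  have cg: "cscale c g \<in> H" using g by (rule scale_in)
  have "gap \<theta> (f + cscale c g) (f + cscale c g) = gap \<theta> f f + gap \<theta> f (cscale c g)
      + (gap \<theta> (cscale c g) f + gap \<theta> (cscale c g) (cscale c g))"
    unfolding gap_add[OF f cg add_in[OF f cg]] gap_add_right[OF f cg f] gap_add_right[OF f cg cg] ..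
  then show ?thesis
    unfolding gap_scale[OF g f] gap_scale[OF g cg] gap_scale_right[OF g f] gap_scale_right[OF g g]
    by (simp only: mult.assoc add.assoc)
qed

lemma gap_diff_bound:
  assumes f: "f \<in> H" and g: "g \<in> H" and s: "0 \<le> Re (gap \<theta> (f + g) (f + g))"
  shows "Re (gap \<theta> (f - g) (f - g)) \<le> 2 * Re (gap \<theta> f f) + 2 * Re (gap \<theta> g g)"
proof -
  have "gap \<theta> (f - g) (f - g) =
      gap \<theta> f f + cnj (-1) * gap \<theta> f g + (-1) * gap \<theta> g f + (-1) * cnj (-1) * gap \<theta> g g"
    unfolding minus_cscale[of f g] by (rule gap_expand[OF f g])
  moreover have "gap \<theta> (f + g) (f + g) = gap \<theta> f f + gap \<theta> f g + gap \<theta> g f + gap \<theta> g g"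
    using gap_expand[OF f g, of \<theta> 1] by simp
  ultimately have "gap \<theta> (f - g) (f - g) + gap \<theta> (f + g) (f + g) = 2 * gap \<theta> f f + 2 * gap \<theta> g g"
    by simp
  then have "Re (gap \<theta> (f - g) (f - g)) + Re (gap \<theta> (f + g) (f + g)) = 2 * Re (gap \<theta> f f) + 2 * Re (gap \<theta> g g)"
    by (simp add: complex_eq_iff)
  with s show ?thesis by linarith
qed

definition perp :: "('a \<Rightarrow> complex) set \<Rightarrow> ('a \<Rightarrow> complex) set"
  where "perp F = {f \<in> H. \<forall>u\<in>F. ip f u = 0}"

lemma perp_subspace: "F \<subseteq> H \<Longrightarrow> cfun.subspace (perp F)"
  by (rule cfun.subspaceI) (auto simp: perp_def in_H ip_add ip_scale)

lemma perp_H: "f \<in> perp F \<Longrightarrow> f \<in> H" by (simp add: perp_def)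

lemma perp_in:
  assumes "F \<subseteq> H"
  shows "f \<in> perp F \<Longrightarrow> g \<in> perp F \<Longrightarrow> f + g \<in> perp F"
    "f \<in> perp F \<Longrightarrow> g \<in> perp F \<Longrightarrow> f - g \<in> perp F"
    "f \<in> perp F \<Longrightarrow> cscale c f \<in> perp F"
  using cfun.subspace_add[OF perp_subspace[OF assms]] cfun.subspace_diff[OF perp_subspace[OF assms]]
    cfun.subspace_scale[OF perp_subspace[OF assms]] by blast+

definition bounds_on :: "('a \<Rightarrow> complex) set \<Rightarrow> real \<Rightarrow> bool"
  where "bounds_on W \<theta> \<longleftrightarrow> (\<forall>f\<in>W. q f \<le> \<theta> * (nrm f)\<^sup>2)"

lemma q_scale: "q (cscale c f) = (cmod c)\<^sup>2 * q f"
  by (simp add: L2_norm_sq cscale_def norm_mult power_mult_distrib)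

lemma limit_in_perp:
  assumes F: "F \<subseteq> H" and s: "\<And>k::nat. s k \<in> perp F" and f: "f \<in> H"
    and lim: "(\<lambda>k. nrm (s k - f)) \<longlonglongrightarrow> 0"
  shows "f \<in> perp F"
  unfolding perp_def
proof (intro CollectI conjI f ballI)
  fix u assume u: "u \<in> F"
  then have uH: "u \<in> H" using F by auto
  have "(cmod (ip f u))\<^sup>2 \<le> (nrm (s k - f))\<^sup>2 * (nrm u)\<^sup>2" for k
  proof -
    have sk: "s k \<in> H" "ip (s k) u = 0" using s[of k] u by (auto simp: perp_def)
    have "ip (s k - f) u = - ip f u" using sk f uH by (simp add: ip_diff)
    then show ?thesis using cauchy_schwarz[OF diff_in[OF sk(1) f] uH] by simp
  qed
  moreover have "(\<lambda>k. (nrm (s k - f))\<^sup>2 * (nrm u)\<^sup>2) \<longlonglongrightarrow> 0\<^sup>2 * (nrm u)\<^sup>2"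
    by (intro tendsto_intros lim)
  ultimately have "(cmod (ip f u))\<^sup>2 \<le> 0\<^sup>2 * (nrm u)\<^sup>2"
    by (intro LIMSEQ_le_const) auto
  then show "ip f u = 0" by simp
qed

text \<open>
  Suppose that the supremum \<open>\<theta>\<close> of the Rayleigh quotient on \<open>perp F\<close> drops to some \<open>\<mu> < \<theta>\<close> on the
  orthogonal complement of \<open>u\<close>. Then \<open>\<theta>\<close> is attained: for a maximizing sequence, the coefficients along
  \<open>u\<close> converge after passing to a subsequence. The remaining components form a Cauchy sequence, because
  there the gap form dominates \<open>(\<theta> - \<mu>) \<parallel>g\<parallel>\<^sup>2\<close>, while it tends to zero along the maximizing sequence. So
  if the supremum is not attained, then it is not lowered by passing to the complement of \<open>u\<close>.
\<close>

lemma rayleigh_codim_one: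
  assumes F: "F \<subseteq> H" and u: "u \<in> perp F" "nrm u = 1"
    and \<theta>: "bounds_on (perp F) \<theta>" "\<And>\<mu>. \<mu> < \<theta> \<Longrightarrow> \<not> bounds_on (perp F) \<mu>"
    and notatt: "\<And>f. f \<in> perp F \<Longrightarrow> f \<noteq> 0 \<Longrightarrow> q f < \<theta> * (nrm f)\<^sup>2"
    and \<mu>: "\<mu> < \<theta>"
  shows "\<not> bounds_on (perp (insert u F)) \<mu>"
proof
  assume b: "bounds_on (perp (insert u F)) \<mu>"
  note pin = perp_in[OF F]
  have uH: "u \<in> H" using u perp_H by auto
  have gap0: "0 \<le> Re (gap \<theta> f f)" if "f \<in> perp F" for f
    using \<theta>(1) that gap_self[OF perp_H[OF that]] by (auto simp: bounds_on_def)
  have "\<exists>f. f \<in> perp F \<and> nrm f = 1 \<and> \<theta> - 1 / real (Suc k) < q f" for k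
  proof -
    have "\<theta> - 1 / real (Suc k) < \<theta>" by simp
    from \<theta>(2)[OF this] obtain f where f: "f \<in> perp F" "(\<theta> - 1 / real (Suc k)) * (nrm f)\<^sup>2 < q f"
      by (auto simp: bounds_on_def not_le)
    have fH: "f \<in> H" using f perp_H by auto
    have f0: "f \<noteq> 0"
    proof
      assume "f = 0"
      then have "nrm f = 0" "q f = 0" using nrm_eq_0[OF zero_in] by (auto simp: L2_norm_sq)
      with f(2) show False by simp
    qed
    note np = nrm_pos[OF fH f0]
    let ?f = "cscale (complex_of_real (1 / nrm f)) f"
    have "q ?f = q f / (nrm f)\<^sup>2" using np by (simp add: q_scale norm_divide power_divide)
    moreover have "\<theta> - 1 / real (Suc k) < q f / (nrm f)\<^sup>2" using f(2) np by (simp add: pos_less_divide_eq)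
    ultimately show ?thesis using normalize[OF fH f0] pin(3)[OF f(1)] by metis
  qed
  then obtain s where s: "\<And>k. s k \<in> perp F" "\<And>k. nrm (s k) = 1" "\<And>k. \<theta> - 1 / real (Suc k) < q (s k)"
    by metis
  have sH: "s k \<in> H" for k using s(1) perp_H by auto
  have gs: "Re (gap \<theta> (s k) (s k)) < 1 / real (Suc k)" for k
    using s(3)[of k] s(2)[of k] gap_self[OF sH] by simp
  have "bounded (range (\<lambda>k. ip (s k) u))"
  proof (rule boundedI)
    fix c assume "c \<in> range (\<lambda>k. ip (s k) u)"
    then obtain k where "c = ip (s k) u" by auto
    then show "norm c \<le> 1" using cauchy_schwarz[OF sH uH, of k] s(2) u(2) by (simp add: power_le_one_iff abs_square_le_1)
  qed
  from bounded_imp_convergent_subsequence[OF this] obtain l r where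
    r: "strict_mono r" and l: "((\<lambda>k. ip (s k) u) \<circ> r) \<longlonglongrightarrow> l" by blast
  define t where "t k = s (r k)" for k
  define \<alpha> where "\<alpha> k = ip (t k) u" for k
  have \<alpha>: "\<alpha> \<longlonglongrightarrow> l" 
  proof -
    have "\<alpha> = (\<lambda>k. ip (s k) u) \<circ> r" by (auto simp: \<alpha>_def t_def)
    then show ?thesis using l by simp
  qed
  have tp: "t k \<in> perp F" and tH: "t k \<in> H" for k using s(1) sH by (auto simp: t_def)
  have gt: "Re (gap \<theta> (t k) (t k)) < 1 / real (Suc k)" for k
  proof -
    have "Re (gap \<theta> (t k) (t k)) < 1 / real (Suc (r k))" using gs by (simp add: t_def)
    also have "\<dots> \<le> 1 / real (Suc k)"
      using seq_suble[OF r, of k] by (intro divide_left_mono) auto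
    finally show ?thesis .
  qed
  define pu where "pu = Re (gap \<theta> u u)"
  have pu: "0 \<le> pu" unfolding pu_def by (rule gap0[OF u(1)])
  \<comment> \<open>Split \<open>t i - t j\<close> into its component along \<open>u\<close> and a rest \<open>g\<close> in the complement of \<open>u\<close>.\<close>
  have key: "(nrm (t i - t j))\<^sup>2 \<le> (cmod (\<alpha> i - \<alpha> j))\<^sup>2 +
      (4 * (1 / real (Suc i)) + 4 * (1 / real (Suc j)) + 2 * (cmod (\<alpha> i - \<alpha> j))\<^sup>2 * pu) / (\<theta> - \<mu>)" for i j
  proof -
    define c where "c = \<alpha> i - \<alpha> j"
    define d where "d = t i - t j"
    have dp: "d \<in> perp F" unfolding d_def by (rule pin(2)[OF tp tp])
    have dH: "d \<in> H" by (rule perp_H[OF dp])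
    have cd: "ip d u = c" using tH uH by (simp add: d_def c_def \<alpha>_def ip_diff)
    define g where "g = d - cscale c u"
    have cu: "cscale c u \<in> perp F" by (rule pin(3)[OF u(1)])
    have gp: "g \<in> perp F" unfolding g_def by (rule pin(2)[OF dp cu])
    have uu: "ip u u = 1" using ip_self[OF uH] u(2) by simp
    have gu: "ip g u = 0" using dH uH cd uu by (simp add: g_def ip_diff ip_scale in_H)
    have g_in: "g \<in> perp (insert u F)" using gp gu by (auto simp: perp_def)
    have gH: "g \<in> H" by (rule perp_H[OF gp])
    have "q g \<le> \<mu> * (nrm g)\<^sup>2" using b g_in unfolding bounds_on_def by blast
    then have "(\<theta> - \<mu>) * (nrm g)\<^sup>2 \<le> Re (gap \<theta> g g)"
      unfolding gap_self[OF gH] left_diff_distrib by simp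
    also have "\<dots> \<le> 2 * Re (gap \<theta> d d) + 2 * Re (gap \<theta> (cscale c u) (cscale c u))"
      unfolding g_def by (intro gap_diff_bound gap0 pin(1) dp cu dH perp_H[OF cu])
    also have "Re (gap \<theta> (cscale c u) (cscale c u)) = (cmod c)\<^sup>2 * pu"
    proof -
      have "gap \<theta> (cscale c u) (cscale c u) = complex_of_real ((cmod c)\<^sup>2) * gap \<theta> u u"
        unfolding gap_scale[OF uH scale_in[OF uH]] gap_scale_right[OF uH uH] complex_norm_square mult.assoc ..
      then show ?thesis by (simp add: pu_def del: of_real_power)
    qed
    also have "Re (gap \<theta> d d) \<le> 2 * Re (gap \<theta> (t i) (t i)) + 2 * Re (gap \<theta> (t j) (t j))"
      unfolding d_def by (intro gap_diff_bound gap0 pin(1) tp tH)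
    also have "\<dots> \<le> 2 * (1 / real (Suc i)) + 2 * (1 / real (Suc j))"
      using gt[of i] gt[of j] by linarith
    finally have "(\<theta> - \<mu>) * (nrm g)\<^sup>2 \<le> 4 * (1 / real (Suc i)) + 4 * (1 / real (Suc j)) + 2 * (cmod c)\<^sup>2 * pu"
      by simp
    then have gb: "(nrm g)\<^sup>2 \<le> (4 * (1 / real (Suc i)) + 4 * (1 / real (Suc j)) + 2 * (cmod c)\<^sup>2 * pu) / (\<theta> - \<mu>)"
      using \<mu> by (simp add: pos_le_divide_eq mult.commute)
    have "(nrm d)\<^sup>2 = (cmod c)\<^sup>2 + (nrm g)\<^sup>2"
      using pythagoras[of "{u}" "\<lambda>i. i" d] uH dH uu cd by (simp add: orthonormal_family_def proj_def g_def)
    with gb show ?thesis by (simp add: d_def c_def)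
  qed
  have cauchy: "\<exists>N. \<forall>i\<ge>N. \<forall>j\<ge>N. nrm (t i - t j) < e" if e: "e > 0" for e
  proof -
    define C where "C = 1 + 2 * pu / (\<theta> - \<mu>)"
    have C: "0 < C" using pu \<mu> by (simp add: C_def add_pos_nonneg)
    define \<delta> where "\<delta> = sqrt (e\<^sup>2 / (2 * C))"
    have \<delta>: "0 < \<delta>" "\<delta>\<^sup>2 = e\<^sup>2 / (2 * C)" using e C by (auto simp: \<delta>_def)
    from \<alpha> have "Cauchy \<alpha>" by (rule LIMSEQ_imp_Cauchy)
    then obtain N1 where N1: "\<And>i j. i \<ge> N1 \<Longrightarrow> j \<ge> N1 \<Longrightarrow> cmod (\<alpha> i - \<alpha> j) < \<delta>"
      using \<delta>(1) by (metis CauchyD)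
    obtain N2 where N2: "8 / (\<theta> - \<mu>) / (e\<^sup>2 / 2) < real N2" using reals_Archimedean2 by blast
    have "nrm (t i - t j) < e" if ij: "i \<ge> max N1 N2" "j \<ge> max N1 N2" for i j
    proof -
      have a: "(cmod (\<alpha> i - \<alpha> j))\<^sup>2 < \<delta>\<^sup>2" using N1[of i j] ij by (intro power_strict_mono) auto
      have fr: "1 / real (Suc k) \<le> 1 / real (Suc N2)" if "k \<ge> N2" for k
        using that by (intro divide_left_mono) auto
      have "(nrm (t i - t j))\<^sup>2 \<le> (cmod (\<alpha> i - \<alpha> j))\<^sup>2 +
        (4 * (1 / real (Suc i)) + 4 * (1 / real (Suc j)) + 2 * (cmod (\<alpha> i - \<alpha> j))\<^sup>2 * pu) / (\<theta> - \<mu>)" by (rule key)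
      also have "\<dots> \<le> (cmod (\<alpha> i - \<alpha> j))\<^sup>2 +
        (8 * (1 / real (Suc N2)) + 2 * (cmod (\<alpha> i - \<alpha> j))\<^sup>2 * pu) / (\<theta> - \<mu>)"
        using fr[of i] fr[of j] ij \<mu> by (intro add_left_mono divide_right_mono) auto
      also have "\<dots> = (cmod (\<alpha> i - \<alpha> j))\<^sup>2 * C + 8 / (\<theta> - \<mu>) / real (Suc N2)"
        by (simp add: C_def add_divide_distrib algebra_simps del: of_nat_Suc)
      also have "\<dots> < \<delta>\<^sup>2 * C + e\<^sup>2 / 2"
      proof (rule add_strict_mono)
        show "(cmod (\<alpha> i - \<alpha> j))\<^sup>2 * C < \<delta>\<^sup>2 * C" using a C by simp
        have swap: "a / N < x" if "0 < N" "0 < x" "a / x < N" for a N x :: real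
          using that by (simp add: field_simps)
        show "8 / (\<theta> - \<mu>) / real (Suc N2) < e\<^sup>2 / 2"
          by (rule swap) (use N2 e in auto)
      qed
      also have "\<delta>\<^sup>2 * C + e\<^sup>2 / 2 = e\<^sup>2" using C by (simp add: \<delta>(2) field_simps)
      finally show ?thesis using e by (simp add: power_less_imp_less_base)
    qed
    then show ?thesis by blast
  qed
  obtain f where f: "f \<in> H" "(\<lambda>k. nrm (t k - f)) \<longlonglongrightarrow> 0" using complete[of t] tH cauchy by blast
  have fp: "f \<in> perp F" by (rule limit_in_perp[OF F tp f])
  have lim2: "(\<lambda>k. (nrm (t k - f))\<^sup>2) \<longlonglongrightarrow> 0" using tendsto_power[OF f(2), of 2] by simp
  have "f \<noteq> 0"
  proof
    assume "f = 0"
    then have "(\<lambda>k. nrm (t k)) \<longlonglongrightarrow> 0" using f(2) by simp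
    then show False using s(2) by (simp add: t_def LIMSEQ_const_iff)
  qed
  then have pos: "0 < Re (gap \<theta> f f)" using notatt[OF fp] gap_self[OF f(1)] by simp
  have "Re (gap \<theta> f f) \<le> 2 * (1 / real (Suc k)) + 2 * \<theta> * (nrm (t k - f))\<^sup>2" for k
  proof -
    define d where "d = t k - f"
    have dp: "d \<in> perp F" and dH: "d \<in> H" using pin(2)[OF tp fp] perp_H by (auto simp: d_def)
    have "f = t k - d" by (simp add: d_def)
    then have "Re (gap \<theta> f f) \<le> 2 * Re (gap \<theta> (t k) (t k)) + 2 * Re (gap \<theta> d d)"
      using gap_diff_bound[OF tH dH gap0[OF pin(1)[OF tp dp]]] by simp
    moreover have "Re (gap \<theta> d d) \<le> \<theta> * (nrm d)\<^sup>2" using gap_self[OF dH] by simp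
    ultimately show ?thesis using gt[of k] by (simp add: d_def)
  qed
  moreover have "(\<lambda>k. 2 * (1 / real (Suc k)) + 2 * \<theta> * (nrm (t k - f))\<^sup>2) \<longlonglongrightarrow> 2 * 0 + 2 * \<theta> * 0"
    by (intro tendsto_intros lim2) (rule LIMSEQ_Suc[OF lim_1_over_n])
  ultimately have "Re (gap \<theta> f f) \<le> 2 * 0 + 2 * \<theta> * 0" by (intro LIMSEQ_le_const) auto
  with pos show False by simp
qed

text \<open>
  If the supremum \<open>\<theta>\<close> were not attained, the preceding lemma would allow to choose orthonormal vectors one
  after another, all of them with Rayleigh quotient at least \<open>\<theta>/2\<close>. This contradicts the bound for the sum
  of these quotients.
\<close>

lemma rayleigh_attained:
  assumes F: "F \<subseteq> H" and ne: "perp F \<noteq> {0}"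
  obtains \<theta> f where "0 < \<theta>" "bounds_on (perp F) \<theta>" "f \<in> perp F" "f \<noteq> 0" "q f = \<theta> * (nrm f)\<^sup>2"
proof -
  obtain f0 where f0: "f0 \<in> perp F" "f0 \<noteq> 0"
    using ne cfun.subspace_0[OF perp_subspace[OF F]] by auto
  obtain C where C: "\<And>f. f \<in> H \<Longrightarrow> q f \<le> C * (nrm f)\<^sup>2" using embedding_bounded by blast
  let ?S = "{\<mu>. bounds_on (perp F) \<mu>}"
  define \<theta> where "\<theta> = Inf ?S"
  have ne: "?S \<noteq> {}" using C perp_H by (auto simp: bounds_on_def)
  have f0H: "f0 \<in> H" using f0 perp_H by auto
  define \<rho> where "\<rho> = q f0 / (nrm f0)\<^sup>2"
  have n0: "0 < (nrm f0)\<^sup>2" using nrm_pos[OF f0H f0(2)] by simp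
  have \<rho>: "0 < \<rho>" using q_pos[OF f0H f0(2)] n0 by (simp add: \<rho>_def)
  have lb: "\<rho> \<le> \<mu>" if "\<mu> \<in> ?S" for \<mu>
    using that f0 n0 by (auto simp: bounds_on_def \<rho>_def pos_divide_le_eq)
  have bdd: "bdd_below ?S" using lb by (rule bdd_belowI)
  have \<theta>0: "0 < \<theta>" using cInf_greatest[OF ne lb] \<rho> by (simp add: \<theta>_def)
  have \<theta>1: "bounds_on (perp F) \<theta>"
    unfolding bounds_on_def
  proof
    fix f assume f: "f \<in> perp F"
    show "q f \<le> \<theta> * (nrm f)\<^sup>2"
    proof (cases "f = 0")
      case True
      then show ?thesis using \<theta>0 by (simp add: L2_norm_sq)
    next
      case False
      have n: "0 < (nrm f)\<^sup>2" using nrm_pos[OF perp_H[OF f] False] by simp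
      have "q f / (nrm f)\<^sup>2 \<le> \<theta>"
        unfolding \<theta>_def by (rule cInf_greatest[OF ne]) (use f n in \<open>auto simp: bounds_on_def pos_divide_le_eq\<close>)
      then show ?thesis using n by (simp add: pos_divide_le_eq)
    qed
  qed
  have \<theta>2: "\<not> bounds_on (perp F) \<mu>" if "\<mu> < \<theta>" for \<mu>
    using that cInf_lower[OF _ bdd, of \<mu>] by (auto simp: \<theta>_def)
  have "\<exists>f. f \<in> perp F \<and> f \<noteq> 0 \<and> \<theta> * (nrm f)\<^sup>2 \<le> q f"
  proof (rule ccontr)
    assume "\<not> ?thesis"
    then have na: "\<And>f. f \<in> perp F \<Longrightarrow> f \<noteq> 0 \<Longrightarrow> q f < \<theta> * (nrm f)\<^sup>2" by force
    have ext: "\<exists>U. finite U \<and> card U = k \<and> U \<subseteq> H \<and> orthonormal_family ip U (\<lambda>u. u) \<and>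
        (\<forall>u\<in>U. \<theta> / 2 \<le> q u) \<and> (\<forall>\<mu><\<theta>. \<not> bounds_on (perp (F \<union> U)) \<mu>)" for k
    proof (induction k)
      case 0
      then show ?case using \<theta>2 by (intro exI[of _ "{}"]) (auto simp: orthonormal_family_def)
    next
      case (Suc k)
      then obtain U where U: "finite U" "card U = k" "U \<subseteq> H" "orthonormal_family ip U (\<lambda>u. u)"
        "\<forall>u\<in>U. \<theta> / 2 \<le> q u" "\<And>\<mu>. \<mu> < \<theta> \<Longrightarrow> \<not> bounds_on (perp (F \<union> U)) \<mu>" by blast
      have FU: "F \<union> U \<subseteq> H" using F U by auto
      have sub: "perp (F \<union> U) \<subseteq> perp F" by (auto simp: perp_def)
      have "\<not> bounds_on (perp (F \<union> U)) (\<theta> / 2)" by (rule U(6)) (use \<theta>0 in simp)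
      then obtain v where v: "v \<in> perp (F \<union> U)" "\<theta> / 2 * (nrm v)\<^sup>2 < q v" by (auto simp: bounds_on_def not_le)
      have vH: "v \<in> H" using v perp_H by auto
      have v0: "v \<noteq> 0" using v(2) nrm_eq_0[OF zero_in] by (auto simp: L2_norm_sq)
      define u where "u = cscale (complex_of_real (1 / nrm v)) v"
      have u: "u \<in> perp (F \<union> U)" "nrm u = 1"
        unfolding u_def using perp_in(3)[OF FU v(1)] normalize[OF vH v0] by simp_all
      have uH: "u \<in> H" using u perp_H by auto
      have "q u = q v / (nrm v)\<^sup>2"
        using nrm_pos[OF vH v0] by (simp add: u_def q_scale norm_divide power_divide)
      then have qu: "\<theta> / 2 \<le> q u" using v(2) nrm_pos[OF vH v0] by (simp add: pos_le_divide_eq)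
      have uu: "ip u u = 1" using ip_self[OF uH] u(2) by simp
      have uU: "ip u w = 0" "ip w u = 0" if w: "w \<in> U" for w
      proof -
        show "ip u w = 0" using u(1) w by (simp add: perp_def)
        then show "ip w u = 0" using ip_commute[OF uH, of w] w U(3) by auto
      qed
      have unU: "u \<notin> U" using uU uu by fastforce
      have on: "orthonormal_family ip (insert u U) (\<lambda>u. u)"
        using U(4) uu uU unU unfolding orthonormal_family_def by (metis insert_iff)
      have b1: "bounds_on (perp (F \<union> U)) \<theta>" using \<theta>1 sub by (auto simp: bounds_on_def)
      have eq: "F \<union> insert u U = insert u (F \<union> U)" by auto
      have "\<forall>\<mu><\<theta>. \<not> bounds_on (perp (F \<union> insert u U)) \<mu>"
        unfolding eq
      proof (intro allI impI)
        fix \<mu> assume \<mu>: "\<mu> < \<theta>"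
        show "\<not> bounds_on (perp (insert u (F \<union> U))) \<mu>"
          by (rule rayleigh_codim_one[OF FU u b1 U(6) na \<mu>]) (use sub in auto)
      qed
      then show ?case using U on unU uH qu by (intro exI[of _ "insert u U"]) auto
    qed
    obtain k where k: "trace_K < real k * (\<theta> / 2)"
      using reals_Archimedean3[of "\<theta> / 2"] \<theta>0 by auto
    obtain U where U: "finite U" "card U = k" "U \<subseteq> H" "orthonormal_family ip U (\<lambda>u. u)" "\<forall>u\<in>U. \<theta> / 2 \<le> q u"
      using ext[of k] by blast
    have "real k * (\<theta> / 2) = (\<Sum>u\<in>U. \<theta> / 2)" using U(2) by simp
    also have "\<dots> \<le> (\<Sum>u\<in>U. q u)" using U(5) by (intro sum_mono) auto
    also have "\<dots> \<le> trace_K" by (rule q_sum_bound) (use U in auto)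
    finally show False using k by simp
  qed
  then obtain f where f: "f \<in> perp F" "f \<noteq> 0" "\<theta> * (nrm f)\<^sup>2 \<le> q f" by blast
  moreover have "q f \<le> \<theta> * (nrm f)\<^sup>2" using \<theta>1 f by (auto simp: bounds_on_def)
  ultimately show ?thesis using that \<theta>0 \<theta>1 by force
qed

text \<open>
  A zero of a positive semidefinite form is orthogonal, in the sense of the form, to all vectors;
  otherwise moving a little in the direction of \<open>g\<close> would make the form negative.
\<close>

lemma gap_vanishes:
  assumes F: "F \<subseteq> H" and b: "bounds_on (perp F) \<theta>" and f: "f \<in> perp F" "q f = \<theta> * (nrm f)\<^sup>2"
    and g: "g \<in> perp F"
  shows "gap \<theta> f g = 0"
proof (rule ccontr)
  assume n: "gap \<theta> f g \<noteq> 0"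
  note fH = perp_H[OF f(1)] and gH = perp_H[OF g]
  define \<beta> where "\<beta> = gap \<theta> f g"
  define P where "P = Re (gap \<theta> g g)"
  have gap0: "0 \<le> Re (gap \<theta> h h)" if "h \<in> perp F" for h
    using b that gap_self[OF perp_H[OF that]] by (auto simp: bounds_on_def)
  have P: "0 \<le> P" unfolding P_def by (rule gap0[OF g])
  define s where "s = 1 / (P + 1)"
  have s: "0 < s" "s * P < 1" using P by (auto simp: s_def)
  define c where "c = - complex_of_real s * \<beta>"
  have cg: "cscale c g \<in> H" using gH by (simp add: in_H)
  have bc: "gap \<theta> g f = cnj \<beta>" unfolding \<beta>_def by (rule gap_commute[OF fH gH])
  have "gap \<theta> (f + cscale c g) (f + cscale c g) = gap \<theta> f f + cnj c * \<beta> + c * cnj \<beta> + c * cnj c * gap \<theta> g g"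
    unfolding gap_expand[OF fH gH] bc \<beta>_def[symmetric] ..
  also have "\<dots> = gap \<theta> f f + complex_of_real ((cmod \<beta>)\<^sup>2) * (complex_of_real (s\<^sup>2) * gap \<theta> g g - complex_of_real (2 * s))"
    unfolding complex_norm_square c_def by (simp add: algebra_simps power2_eq_square)
  finally have "Re (gap \<theta> (f + cscale c g) (f + cscale c g)) = (cmod \<beta>)\<^sup>2 * (s\<^sup>2 * P - 2 * s)"
    using gap_self[OF fH, of \<theta>] f(2) by (simp add: P_def del: of_real_power of_real_mult)
  moreover have "0 \<le> Re (gap \<theta> (f + cscale c g) (f + cscale c g))"
    by (intro gap0 perp_in[OF F] f(1) g)
  moreover have "(cmod \<beta>)\<^sup>2 * (s\<^sup>2 * P - 2 * s) < 0"
  proof (rule mult_pos_neg)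
    show "0 < (cmod \<beta>)\<^sup>2" using n by (simp add: \<beta>_def)
    have "s * (s * P) < s * 1" using s by (intro mult_strict_left_mono) auto
    then show "s\<^sup>2 * P - 2 * s < 0" using s by (simp add: power2_eq_square)
  qed
  ultimately show False by simp
qed

section \<open>Singular functions\<close>

abbreviation "eigenspace \<equiv> embedding_eigenspace M H ip"

lemma eigenspace_H: "f \<in> eigenspace a \<Longrightarrow> f \<in> H" by (simp add: embedding_eigenspace_def)

lemma eigenspace_inner: "f \<in> eigenspace a \<Longrightarrow> g \<in> H \<Longrightarrow> L2_inner M f g = complex_of_real a * ip f g"
  by (simp add: embedding_eigenspace_def)

lemma eigenspace_q: "f \<in> eigenspace a \<Longrightarrow> q f = a * (nrm f)\<^sup>2"
  using eigenspace_inner[of f a f] eigenspace_H[of f a]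
  by (simp add: L2_inner_self ip_self flip: of_real_mult of_real_power)

lemma eigenspace_orthogonal:
  assumes f: "f \<in> eigenspace a" and g: "g \<in> eigenspace b" and "a \<noteq> b"
  shows "ip f g = 0"
proof -
  note fH = eigenspace_H[OF f] and gH = eigenspace_H[OF g]
  have "complex_of_real a * ip f g = cnj (L2_inner M g f)"
    using eigenspace_inner[OF f gH] L2_inner_commute[of M f g] by simp
  also have "\<dots> = complex_of_real b * ip f g"
    using eigenspace_inner[OF g fH] ip_commute[OF gH fH] by simp
  finally show ?thesis using assms(3) by simp
qed

lemma eigenspace_card:
  assumes "finite I" "\<And>i. i \<in> I \<Longrightarrow> e i \<in> eigenspace a" "orthonormal_family ip I e"
  shows "real (card I) * a \<le> trace_K"
proof -
  have "q (e i) = a" if i: "i \<in> I" for i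
  proof -
    have "ip (e i) (e i) = 1" using assms(3) i by (simp add: orthonormal_family_def)
    then show ?thesis using eigenspace_q[OF assms(2)[OF i]] nrm_sq[OF eigenspace_H[OF assms(2)[OF i]]] by simp
  qed
  then have "real (card I) * a = (\<Sum>i\<in>I. q (e i))" by simp
  also have "\<dots> \<le> trace_K" using assms eigenspace_H by (intro q_sum_bound) auto
  finally show ?thesis .
qed

text \<open>
  An infinite set \<open>B\<close> would contain arbitrarily many independent eigenvectors, and hence give arbitrarily
  large orthonormal families in the eigenspace, contrary to the bound for their number.
\<close>

lemma eigenspace_orthonormal_basis:
  assumes ind: "cfun.independent B" and sp: "cfun.span B = eigenspace a" and a: "0 < a"
  shows "\<exists>e. e ` B \<subseteq> eigenspace a \<and> orthonormal_family ip B e \<and> cfun.span (e ` B) = eigenspace a"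
proof -
  have BH: "B \<subseteq> H" using cfun.span_superset[of B] sp eigenspace_H by auto
  have "finite B"
  proof (rule ccontr)
    assume inf: "infinite B"
    obtain k where k: "trace_K < real k * a" using reals_Archimedean3[OF a] by auto
    obtain C where C: "finite C" "card C = k" "C \<subseteq> B" using infinite_arbitrarily_large[OF inf] by blast
    obtain e where e: "orthonormal_family ip C e" "cfun.span (e ` C) = cfun.span C"
      using gram_schmidt[OF C(1) cfun.independent_mono[OF ind C(3)]] C(3) BH by blast
    have "e i \<in> eigenspace a" if "i \<in> C" for i
      using that cfun.span_base[of "e i" "e ` C"] e(2) cfun.span_mono[OF C(3)] sp by auto
    from eigenspace_card[OF C(1) this e(1)] k C(2) show False by simp
  qed
  then obtain e where e: "orthonormal_family ip B e" "cfun.span (e ` B) = cfun.span B"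
    using gram_schmidt[OF _ ind BH] by blast
  then show ?thesis using sp cfun.span_superset[of "e ` B"] by (intro exI[of _ e]) auto
qed

text \<open>
  The bijections between indices and bases of the eigenspaces, for each value of \<open>\<sigma>\<close> separately, are
  combined into one family. Different eigenspaces are orthogonal.
\<close>

lemma singular_basis_exists:
  assumes sv: "embedding_singular_values M H ip \<sigma>"
  shows "\<exists>e. (\<forall>k. 0 < \<sigma> k \<longrightarrow> e k \<in> eigenspace ((\<sigma> k)\<^sup>2)) \<and> orthonormal_family ip {k. 0 < \<sigma> k} e \<and>
    (\<forall>t>0. cfun.span (e ` {k. \<sigma> k = t}) = eigenspace (t\<^sup>2))"
proof -
  have "\<exists>e. (\<forall>k. \<sigma> k = t \<longrightarrow> e k \<in> eigenspace (t\<^sup>2)) \<and> orthonormal_family ip {k. \<sigma> k = t} e \<and>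
    cfun.span (e ` {k. \<sigma> k = t}) = eigenspace (t\<^sup>2)" if t: "0 < t" for t
  proof -
    obtain B b where B: "cfun.independent B" "cfun.span B = eigenspace (t\<^sup>2)" "bij_betw b {k. \<sigma> k = t} B"
      using sv t unfolding embedding_singular_values_def by blast
    obtain e where e: "e ` B \<subseteq> eigenspace (t\<^sup>2)" "orthonormal_family ip B e" "cfun.span (e ` B) = eigenspace (t\<^sup>2)"
      using eigenspace_orthonormal_basis[OF B(1,2)] t by auto
    have bB: "b ` {k. \<sigma> k = t} = B" and inj: "inj_on b {k. \<sigma> k = t}" using B(3) by (auto simp: bij_betw_def)
    have "(\<lambda>k. e (b k)) ` {k. \<sigma> k = t} = e ` B" unfolding bB[symmetric] by (simp add: image_image)
    moreover have "orthonormal_family ip {k. \<sigma> k = t} (\<lambda>k. e (b k))"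
      unfolding orthonormal_family_def
    proof (intro ballI)
      fix i j assume ij: "i \<in> {k. \<sigma> k = t}" "j \<in> {k. \<sigma> k = t}"
      then have "b i \<in> B" "b j \<in> B" using bB by auto
      then have "ip (e (b i)) (e (b j)) = (if b i = b j then 1 else 0)"
        using e(2) by (simp add: orthonormal_family_def)
      also have "b i = b j \<longleftrightarrow> i = j" using inj ij by (auto dest: inj_onD)
      finally show "ip (e (b i)) (e (b j)) = (if i = j then 1 else 0)" .
    qed
    moreover have "\<forall>k. \<sigma> k = t \<longrightarrow> e (b k) \<in> eigenspace (t\<^sup>2)" using e(1) bB by auto
    ultimately show ?thesis using e(3) by (intro exI[of _ "\<lambda>k. e (b k)"]) simp
  qed
  then obtain e where e: "\<And>t k. 0 < t \<Longrightarrow> \<sigma> k = t \<Longrightarrow> e t k \<in> eigenspace (t\<^sup>2)"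
    "\<And>t. 0 < t \<Longrightarrow> orthonormal_family ip {k. \<sigma> k = t} (e t)"
    "\<And>t. 0 < t \<Longrightarrow> cfun.span (e t ` {k. \<sigma> k = t}) = eigenspace (t\<^sup>2)" by metis
  define v where "v k = e (\<sigma> k) k" for k
  have v1: "\<And>k. 0 < \<sigma> k \<Longrightarrow> v k \<in> eigenspace ((\<sigma> k)\<^sup>2)" using e(1) by (simp add: v_def)
  have "orthonormal_family ip {k. 0 < \<sigma> k} v"
    unfolding orthonormal_family_def
  proof (intro ballI)
    fix i j assume "i \<in> {k. 0 < \<sigma> k}" "j \<in> {k. 0 < \<sigma> k}"
    then have ij: "0 < \<sigma> i" "0 < \<sigma> j" by auto
    show "ip (v i) (v j) = (if i = j then 1 else 0)"
    proof (cases "\<sigma> i = \<sigma> j")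
      case True
      then show ?thesis using e(2)[OF ij(1)] by (simp add: orthonormal_family_def v_def)
    next
      case False
      then have "(\<sigma> i)\<^sup>2 \<noteq> (\<sigma> j)\<^sup>2" using ij by (simp add: power2_eq_iff)
      then show ?thesis using eigenspace_orthogonal[OF v1[OF ij(1)] v1[OF ij(2)]] False by auto
    qed
  qed
  moreover have "cfun.span (v ` {k. \<sigma> k = t}) = eigenspace (t\<^sup>2)" if "0 < t" for t
  proof -
    have "v ` {k. \<sigma> k = t} = e t ` {k. \<sigma> k = t}" by (rule image_cong) (auto simp: v_def)
    then show ?thesis using e(3)[OF that] by simp
  qed
  ultimately show ?thesis using v1 by blast
qed

end

locale singular_basis = embedded_rkhs M H ip K
  for M :: "'a measure" and H ip K +
  fixes \<sigma> :: "nat \<Rightarrow> real" and e :: "nat \<Rightarrow> 'a \<Rightarrow> complex"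
  assumes \<sigma>_nonneg: "0 \<le> \<sigma> k" and \<sigma>_decseq: "decseq \<sigma>"
    and e_eigen: "0 < \<sigma> k \<Longrightarrow> e k \<in> embedding_eigenspace M H ip ((\<sigma> k)\<^sup>2)"
    and e_orthonormal: "orthonormal_family ip {k. 0 < \<sigma> k} e"
    and e_span: "0 < t \<Longrightarrow> cfun.span (e ` {k. \<sigma> k = t}) = embedding_eigenspace M H ip (t\<^sup>2)"
begin

text \<open>
  \<open>W N\<close> is the orthogonal complement of the first \<open>N\<close> singular functions, and \<open>tail N\<close> is the diagonal of its
  reproducing kernel. If \<open>H\<close> has a finite dimension below \<open>N\<close>, there are fewer than \<open>N\<close> singular
  functions, hence the set \<open>J N\<close>.
\<close>

definition J :: "nat \<Rightarrow> nat set" where "J N = {k. k < N \<and> 0 < \<sigma> k}"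

definition W :: "nat \<Rightarrow> ('a \<Rightarrow> complex) set" where "W N = perp (e ` J N)"

definition residual :: "nat \<Rightarrow> ('a \<Rightarrow> complex) \<Rightarrow> 'a \<Rightarrow> complex" where "residual N f = f - proj (J N) e f"

definition tail :: "nat \<Rightarrow> 'a \<Rightarrow> real" where "tail N x = Re (K x x) - (\<Sum>k\<in>J N. (cmod (e k x))\<^sup>2)"

lemma e_H: "0 < \<sigma> k \<Longrightarrow> e k \<in> H" using e_eigen eigenspace_H by blast

lemma J_fin [simp]: "finite (J N)" by (simp add: J_def)
lemma J_H: "k \<in> J N \<Longrightarrow> e k \<in> H" by (simp add: J_def e_H)
lemma orthonormal_J: "orthonormal_family ip (J N) e"
  using e_orthonormal by (auto simp: orthonormal_family_def J_def)
lemma W_H: "f \<in> W N \<Longrightarrow> f \<in> H" by (simp add: W_def perp_H)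

lemma residual_W:
  assumes f: "f \<in> H"
  shows "residual N f \<in> W N"
proof -
  have "ip (f - proj (J N) e f) (e j) = 0" if "j \<in> J N" for j
    by (rule residual_orthogonal[OF J_fin J_H orthonormal_J that f])
  moreover have "f - proj (J N) e f \<in> H" by (intro diff_in f proj_in J_H)
  ultimately show ?thesis by (auto simp: W_def perp_def residual_def)
qed

lemma \<sigma>_mono: "i \<le> j \<Longrightarrow> \<sigma> j \<le> \<sigma> i" using \<sigma>_decseq by (simp add: decseq_def)

text \<open>
  A maximizer of the Rayleigh quotient on \<open>W N\<close> is an eigenvector, since \<open>W N\<close> is invariant. So it lies
  in the span of the singular functions for one singular value. They cannot all have an index below
  \<open>N\<close>, because the maximizer is orthogonal to those. Hence the singular value is at most \<open>\<sigma> N\<close>.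
\<close>

lemma W_bound:
  assumes f: "f \<in> W N"
  shows "q f \<le> (\<sigma> N)\<^sup>2 * (nrm f)\<^sup>2"
proof (cases "W N = {0}")
  case True
  then show ?thesis using f by (simp add: L2_norm_sq)
next
  case False
  have F: "e ` J N \<subseteq> H" using J_H by auto
  obtain \<theta> g where g: "0 < \<theta>" "bounds_on (perp (e ` J N)) \<theta>" "g \<in> perp (e ` J N)" "g \<noteq> 0" "q g = \<theta> * (nrm g)\<^sup>2"
    by (rule rayleigh_attained[OF F False[unfolded W_def]])
  have gH: "g \<in> H" by (rule perp_H[OF g(3)])
  have ge: "ip g (e k) = 0" if "k \<in> J N" for k using g(3) that by (simp add: perp_def)
  have "gap \<theta> g h = 0" if h: "h \<in> H" for h
  proof -
    have r: "residual N h \<in> perp (e ` J N)" using residual_W[OF h] by (simp add: W_def)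
    have rH: "residual N h \<in> H" by (rule perp_H[OF r])
    have pH: "proj (J N) e h \<in> H" by (rule proj_in) (rule J_H)
    have "gap \<theta> (proj (J N) e h) g = (\<Sum>k\<in>J N. ip h (e k) * gap \<theta> (e k) g)"
    proof -
      have "gap \<theta> (\<Sum>k\<in>I. cscale (c k) (e k)) g = (\<Sum>k\<in>I. c k * gap \<theta> (e k) g)" if "finite I" "I \<subseteq> J N" for I c
        using that
      proof (induction I rule: finite_induct)
        case empty
        then show ?case using gap_scale[OF zero_in gH, of \<theta> 0] by (simp add: zero_fun_def)
      next
        case (insert k I)
        have "e k \<in> H" "(\<Sum>k\<in>I. cscale (c k) (e k)) \<in> H" using insert.prems J_H by (auto intro!: sum_in)
        note ek = this
        have step: "gap \<theta> (\<Sum>k\<in>insert k I. cscale (c k) (e k)) g = c k * gap \<theta> (e k) g + gap \<theta> (\<Sum>k\<in>I. cscale (c k) (e k)) g"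
          unfolding sum.insert[OF insert.hyps] gap_add[OF scale_in[OF ek(1)] ek(2) gH] gap_scale[OF ek(1) gH] ..
        have IH: "gap \<theta> (\<Sum>k\<in>I. cscale (c k) (e k)) g = (\<Sum>k\<in>I. c k * gap \<theta> (e k) g)"
          using insert.IH insert.prems by blast
        show ?case by (simp only: step IH) (simp only: sum.insert[OF insert.hyps])
      qed
      then show ?thesis by (simp add: proj_def)
    qed
    also have "\<dots> = 0"
    proof (intro sum.neutral ballI)
      fix k assume k: "k \<in> J N"
      have s: "0 < \<sigma> k" using k by (simp add: J_def)
      have "ip (e k) g = 0" using ge[OF k] ip_commute[OF gH J_H[OF k]] by simp
      then show "ip h (e k) * gap \<theta> (e k) g = 0"
        using eigenspace_inner[OF e_eigen[OF s] gH] by (simp add: gap_def)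
    qed
    finally have "gap \<theta> g (proj (J N) e h) = 0" using gap_commute[OF pH gH] by simp
    moreover have "gap \<theta> g (residual N h) = 0" by (rule gap_vanishes[OF F g(2,3,5) r])
    moreover have "h = proj (J N) e h + residual N h" by (simp add: residual_def)
    ultimately show ?thesis using gap_add_right[OF pH rH gH, of \<theta>] by simp
  qed
  then have "g \<in> eigenspace \<theta>" using gH by (simp add: embedding_eigenspace_def gap_def)
  then have "g \<in> cfun.span (e ` {k. \<sigma> k = sqrt \<theta>})" using e_span[of "sqrt \<theta>"] g(1) by simp
  have "\<exists>k\<ge>N. \<sigma> k = sqrt \<theta>"
  proof (rule ccontr)
    assume "\<not> ?thesis"
    then have lt: "k < N" if "\<sigma> k = sqrt \<theta>" for k using that not_le by blast
    have Z: "cfun.subspace {f \<in> H. ip f g = 0}"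
      by (rule cfun.subspaceI) (auto simp: in_H ip_add ip_scale gH)
    have "e ` {k. \<sigma> k = sqrt \<theta>} \<subseteq> {f \<in> H. ip f g = 0}"
    proof
      fix f assume "f \<in> e ` {k. \<sigma> k = sqrt \<theta>}"
      then obtain k where k: "f = e k" "\<sigma> k = sqrt \<theta>" by auto
      then have "k \<in> J N" using lt g(1) by (simp add: J_def)
      then show "f \<in> {f \<in> H. ip f g = 0}" using ge ip_commute[OF gH J_H] J_H k by force
    qed
    from cfun.span_minimal[OF this Z] have "ip g g = 0" using \<open>g \<in> cfun.span _\<close> by auto
    then show False using ip_pos[OF gH g(4)] by simp
  qed
  then have "sqrt \<theta> \<le> \<sigma> N" using \<sigma>_mono by metis
  then have "(sqrt \<theta>)\<^sup>2 \<le> (\<sigma> N)\<^sup>2" using g(1) by (intro power_mono) auto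
  then have "\<theta> \<le> (\<sigma> N)\<^sup>2" using g(1) by simp
  then have "\<theta> * (nrm f)\<^sup>2 \<le> (\<sigma> N)\<^sup>2 * (nrm f)\<^sup>2" by (intro mult_right_mono) auto
  moreover have "q f \<le> \<theta> * (nrm f)\<^sup>2" using g(2) f by (simp add: W_def bounds_on_def)
  ultimately show ?thesis by linarith
qed

lemma W_trivial:
  assumes "\<sigma> N = 0" "f \<in> W N"
  shows "f = 0"
  using W_bound[OF assms(2)] assms(1) q_pos[OF W_H[OF assms(2)]] by force

lemma e_q: "0 < \<sigma> k \<Longrightarrow> q (e k) = (\<sigma> k)\<^sup>2"
proof -
  assume k: "0 < \<sigma> k"
  have "ip (e k) (e k) = 1" using e_orthonormal k by (simp add: orthonormal_family_def)
  then show ?thesis using eigenspace_q[OF e_eigen[OF k]] nrm_sq[OF e_H[OF k]] by simp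
qed

lemma \<sigma>_sum_bound:
  assumes "finite I"
  shows "(\<Sum>k\<in>I. (\<sigma> k)\<^sup>2) \<le> trace_K"
proof -
  have "(\<Sum>k\<in>I. (\<sigma> k)\<^sup>2) = (\<Sum>k\<in>I \<inter> {k. 0 < \<sigma> k}. (\<sigma> k)\<^sup>2)"
    using assms \<sigma>_nonneg by (intro sum.mono_neutral_right) (auto simp: order_le_less)
  also have "\<dots> = (\<Sum>k\<in>I \<inter> {k. 0 < \<sigma> k}. q (e k))" by (intro sum.cong) (auto simp: e_q)
  also have "\<dots> \<le> trace_K"
    by (rule q_sum_bound) (use assms e_orthonormal e_H in \<open>auto simp: orthonormal_family_def\<close>)
  finally show ?thesis .
qed

lemma \<sigma>_sq_summable: "summable (\<lambda>k. (\<sigma> k)\<^sup>2)"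
  by (rule summableI_nonneg_bounded[where x = trace_K]) (auto intro: \<sigma>_sum_bound)

lemma \<sigma>_sq_tendsto: "(\<lambda>k. (\<sigma> k)\<^sup>2) \<longlonglongrightarrow> 0"
  by (rule summable_LIMSEQ_zero[OF \<sigma>_sq_summable])

lemma tail_eq:
  assumes x: "x \<in> space M"
  shows "tail N x = (nrm (residual N (K x)))\<^sup>2"
proof -
  have k: "K x \<in> H" by (rule kernel_mem[OF x])
  have "(nrm (K x))\<^sup>2 = (\<Sum>i\<in>J N. (cmod (ip (K x) (e i)))\<^sup>2) + (nrm (residual N (K x)))\<^sup>2"
    unfolding residual_def by (rule pythagoras[OF J_fin J_H orthonormal_J k])
  moreover have "(cmod (ip (K x) (e i)))\<^sup>2 = (cmod (e i x))\<^sup>2" if i: "i \<in> J N" for i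
    using reproducing[OF x J_H[OF i]] ip_commute[OF J_H[OF i] k] by simp
  ultimately show ?thesis using kernel_diagonal[OF x] by (simp add: tail_def del: of_real_power)
qed

lemma point_bound:
  assumes x: "x \<in> space M" and g: "g \<in> W N"
  shows "(cmod (g x))\<^sup>2 \<le> tail N x * (nrm g)\<^sup>2"
proof -
  have k: "K x \<in> H" by (rule kernel_mem[OF x])
  note gH = W_H[OF g]
  have rH: "residual N (K x) \<in> H" by (rule W_H[OF residual_W[OF k]])
  have pH: "proj (J N) e (K x) \<in> H" by (rule proj_in) (rule J_H)
  have "ip (proj (J N) e (K x)) g = (\<Sum>i\<in>J N. ip (K x) (e i) * ip (e i) g)"
    unfolding proj_def using J_H gH by (intro ip_sum) auto
  also have "\<dots> = 0"
  proof (intro sum.neutral ballI)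
    fix i assume i: "i \<in> J N"
    have "ip g (e i) = 0" using g i by (simp add: W_def perp_def)
    then show "ip (K x) (e i) * ip (e i) g = 0" using ip_commute[OF gH J_H[OF i]] by simp
  qed
  finally have "ip g (proj (J N) e (K x)) = 0" using ip_commute[OF pH gH] by simp
  then have "g x = ip g (residual N (K x))"
    unfolding residual_def using reproducing[OF x gH] ip_diff_right[OF k pH gH] by simp
  then show ?thesis using cauchy_schwarz[OF gH rH] tail_eq[OF x] by (simp add: mult.commute)
qed

lemma tail_nonneg: "x \<in> space M \<Longrightarrow> 0 \<le> tail N x" by (simp add: tail_eq)

lemma tail_le: "tail N x \<le> Re (K x x)" by (simp add: tail_def sum_nonneg)

lemma tail_integrable: "integrable M (tail N)"
  unfolding tail_def
  by (intro Bochner_Integration.integrable_diff Bochner_Integration.integrable_sum integrable_Re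
      kernel_integrable q_integrable J_H)

lemma proj_J_diff:
  assumes "i \<le> j"
  shows "residual i f - residual j f = (\<Sum>k\<in>J j - J i. cscale (ip f (e k)) (e k))"
proof -
  have "J i \<subseteq> J j" using assms by (auto simp: J_def)
  then have "proj (J j) e f = (\<Sum>k\<in>J j - J i. cscale (ip f (e k)) (e k)) + proj (J i) e f"
    unfolding proj_def by (intro sum.subset_diff) auto
  then show ?thesis by (simp add: residual_def)
qed

text \<open>
  The residuals form a Cauchy sequence, and their limit lies in every \<open>W N\<close>. So its norm in \<open>L\<^sub>2\<close> is at
  most a multiple of \<open>\<sigma> N\<close> for all \<open>N\<close>. Since the embedding is injective, the limit is zero.
\<close>

lemma residual_tendsto:
  assumes f: "f \<in> H"
  shows "(\<lambda>N. nrm (residual N f)) \<longlonglongrightarrow> 0"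
proof -
  define s where "s N = (\<Sum>k\<in>J N. (cmod (ip f (e k)))\<^sup>2)" for N
  have sb: "s N \<le> (nrm f)\<^sup>2" for N unfolding s_def by (rule bessel[OF J_fin J_H orthonormal_J f])
  have "incseq s" unfolding s_def by (intro incseq_SucI sum_mono2) (auto simp: J_def)
  then have "convergent s" using sb by (metis incseq_convergent convergent_def)
  then have C: "Cauchy s" by (rule convergent_Cauchy)
  have diff: "(nrm (residual i f - residual j f))\<^sup>2 = s j - s i" if "i \<le> j" for i j
  proof -
    have sub: "J i \<subseteq> J j" using that by (auto simp: J_def)
    have "orthonormal_family ip (J j - J i) e" using orthonormal_J[of j] by (auto simp: orthonormal_family_def)
    then have "(nrm (residual i f - residual j f))\<^sup>2 = (\<Sum>k\<in>J j - J i. (cmod (ip f (e k)))\<^sup>2)"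
      unfolding proj_J_diff[OF that] by (intro nrm_combination) (auto intro: J_H)
    also have "\<dots> = s j - s i" unfolding s_def using sub by (intro sum_diff) auto
    finally show ?thesis .
  qed
  have rH: "residual N f \<in> H" for N by (rule W_H[OF residual_W[OF f]])
  have sym: "nrm (residual i f - residual j f) = nrm (residual j f - residual i f)" for i j
  proof -
    have "residual i f - residual j f = cscale (-1) (residual j f - residual i f)"
      by (auto simp: cscale_def fun_eq_iff)
    then show ?thesis using nrm_scale[OF diff_in[OF rH rH], of "-1" j i] by (simp only: norm_minus_cancel norm_one mult_1)
  qed
  have cauchy: "\<exists>N. \<forall>i\<ge>N. \<forall>j\<ge>N. nrm (residual i f - residual j f) < d" if d: "d > 0" for d
  proof -
    have "0 < d\<^sup>2" using d by simp
    then obtain N where N: "\<And>i j. i \<ge> N \<Longrightarrow> j \<ge> N \<Longrightarrow> norm (s i - s j) < d\<^sup>2" using CauchyD[OF C] by metis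
    have lt: "nrm (residual i f - residual j f) < d" if "i \<ge> N" "i \<le> j" for i j
    proof -
      have "(nrm (residual i f - residual j f))\<^sup>2 < d\<^sup>2" using N[of j i] that diff[OF that(2)] by simp
      then show ?thesis using d by (simp add: power_less_imp_less_base)
    qed
    have "nrm (residual i f - residual j f) < d" if "i \<ge> N" "j \<ge> N" for i j
      using lt[of i j] lt[of j i] that sym[of i j] by (cases "i \<le> j") auto
    then show ?thesis by blast
  qed
  obtain g where g: "g \<in> H" "(\<lambda>k. nrm (residual k f - g)) \<longlonglongrightarrow> 0"
    using complete[of "\<lambda>k. residual k f"] rH cauchy by blast
  have gW: "g \<in> W N" for N
    unfolding W_def
  proof (rule limit_in_perp[where s = "\<lambda>k. residual (k + N) f"])
    show "e ` J N \<subseteq> H" using J_H by auto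
    show "residual (k + N) f \<in> perp (e ` J N)" for k
      using residual_W[OF f, of "k + N"] by (auto simp: W_def perp_def J_def)
    show "(\<lambda>k. nrm (residual (k + N) f - g)) \<longlonglongrightarrow> 0" by (rule LIMSEQ_ignore_initial_segment[OF g(2)])
  qed (rule g(1))
  have "q g \<le> (\<sigma> N)\<^sup>2 * (nrm g)\<^sup>2" for N by (rule W_bound[OF gW])
  moreover have "(\<lambda>N. (\<sigma> N)\<^sup>2 * (nrm g)\<^sup>2) \<longlonglongrightarrow> 0 * (nrm g)\<^sup>2" by (intro tendsto_intros \<sigma>_sq_tendsto)
  ultimately have "q g \<le> 0 * (nrm g)\<^sup>2" by (intro LIMSEQ_le_const) auto
  then have "g = 0" using q_pos[OF g(1)] by force
  then show ?thesis using g(2) by simp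
qed

lemma tail_integral_tendsto: "(\<lambda>N. \<integral>x. tail N x \<partial>M) \<longlonglongrightarrow> 0"
proof -
  have "(\<lambda>N. \<integral>x. tail N x \<partial>M) \<longlonglongrightarrow> (\<integral>x. 0 \<partial>M)"
  proof (rule integral_dominated_convergence[where w = "\<lambda>x. Re (K x x)"])
    show "AE x in M. (\<lambda>N. tail N x) \<longlonglongrightarrow> 0"
    proof (rule AE_I2)
      fix x assume x: "x \<in> space M"
      have "(\<lambda>N. (nrm (residual N (K x)))\<^sup>2) \<longlonglongrightarrow> 0\<^sup>2"
        by (intro tendsto_power residual_tendsto kernel_mem x)
      then show "(\<lambda>N. tail N x) \<longlonglongrightarrow> 0" using tail_eq[OF x] by simp
    qed
    show "AE x in M. norm (tail N x) \<le> Re (K x x)" for N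
      by (rule AE_I2) (simp add: tail_nonneg tail_le)
  qed (use tail_integrable kernel_integrable in \<open>auto intro: borel_measurable_integrable integrable_Re\<close>)
  then show ?thesis by simp
qed

text \<open>
  The alternative \<open>\<sigma> N = 0\<close> occurs if \<open>H\<close> has finite dimension \<open>N\<close>; then nothing remains beyond \<open>N\<close>.
\<close>

lemma truncation:
  assumes \<eta>: "0 < \<eta>"
  obtains N where "\<And>k. k < N \<Longrightarrow> 0 < \<sigma> k" "m \<le> N \<or> \<sigma> N = 0" "(\<integral>x. tail N x \<partial>M) < \<eta>"
proof (cases "\<exists>k. \<sigma> k = 0")
  case True
  define N where "N = (LEAST k. \<sigma> k = 0)"
  have N: "\<sigma> N = 0" unfolding N_def using True by (rule LeastI_ex)
  have pos: "0 < \<sigma> k" if "k < N" for k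
    using not_less_Least[of k "\<lambda>k. \<sigma> k = 0"] that \<sigma>_nonneg[of k] by (simp add: N_def less_le)
  have "tail N x = 0" if x: "x \<in> space M" for x
    using W_trivial[OF N residual_W[OF kernel_mem[OF x]]] tail_eq[OF x] nrm_eq_0[OF zero_in] by simp
  then have "(\<integral>x. tail N x \<partial>M) = (\<integral>x. 0 \<partial>M)" by (intro Bochner_Integration.integral_cong) auto
  then show ?thesis using that[OF pos] N \<eta> by simp
next
  case False
  then have pos: "0 < \<sigma> k" for k using \<sigma>_nonneg[of k] by (metis order_le_less)
  have "eventually (\<lambda>N. (\<integral>x. tail N x \<partial>M) < \<eta>) sequentially"
    by (rule order_tendstoD(2)[OF tail_integral_tendsto \<eta>])
  then have "eventually (\<lambda>N. (\<integral>x. tail N x \<partial>M) < \<eta> \<and> m \<le> N) sequentially"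
    using eventually_ge_at_top[of m] by (rule eventually_conj)
  then obtain N where "(\<integral>x. tail N x \<partial>M) < \<eta>" "m \<le> N" by (auto dest: eventually_happens)
  then show ?thesis using that pos by blast
qed

section \<open>The sampling operator\<close>

text \<open>
  The left singular vectors of the embedding, an orthonormal family in \<open>L\<^sub>2\<close>.
\<close>

definition lsv :: "nat \<Rightarrow> 'a \<Rightarrow> complex" where "lsv k = cscale (complex_of_real (1 / \<sigma> k)) (e k)"

lemma lsv_H: "0 < \<sigma> k \<Longrightarrow> lsv k \<in> H" by (simp only: lsv_def scale_in e_H)

lemma L2_inner_lsv:
  assumes k: "0 < \<sigma> k" and f: "f \<in> H"
  shows "L2_inner M (lsv k) f = complex_of_real (\<sigma> k) * ip (e k) f"
  unfolding lsv_def L2_inner_scale eigenspace_inner[OF e_eigen[OF k] f]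
  using k by (simp add: power2_eq_square)

lemma lsv_orthonormal:
  assumes "0 < \<sigma> i" "0 < \<sigma> j"
  shows "L2_inner M (lsv i) (lsv j) = (if i = j then 1 else 0)"
proof -
  have "ip (e i) (lsv j) = complex_of_real (1 / \<sigma> j) * ip (e i) (e j)"
    unfolding lsv_def ip_scale_right[OF e_H[OF assms(2)] e_H[OF assms(1)]] by simp
  moreover have "ip (e i) (e j) = (if i = j then 1 else 0)"
    using e_orthonormal assms by (simp add: orthonormal_family_def)
  ultimately show ?thesis using L2_inner_lsv[OF assms(1) lsv_H[OF assms(2)]] assms by simp
qed

lemma lsv_L2:
  assumes "0 < \<sigma> i" "0 < \<sigma> j"
  shows "integrable M (\<lambda>x. lsv i x * cnj (lsv j x))"
    "(\<integral>x. lsv i x * cnj (lsv j x) \<partial>M) = (if i = j then 1 else 0)"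
  using L2_mult_integrable[OF in_L2[OF lsv_H[OF assms(1)]] in_L2[OF lsv_H[OF assms(2)]]]
    lsv_orthonormal[OF assms] by (auto simp: L2_inner_def)

lemma L2_inner_lsv_sum:
  assumes "finite I" "\<And>k. k \<in> I \<Longrightarrow> 0 < \<sigma> k" "f \<in> H"
  shows "L2_inner M (\<Sum>k\<in>I. cscale (c k) (lsv k)) f = (\<Sum>k\<in>I. c k * L2_inner M (lsv k) f)"
  using assms
proof (induction I rule: finite_induct)
  case empty
  show ?case using L2_inner_scale[of M 0 0 f] by (simp add: zero_fun_def)
next
  case (insert k I)
  have "lsv k \<in> H" "(\<Sum>k\<in>I. cscale (c k) (lsv k)) \<in> H" using insert.prems by (auto intro!: sum_in lsv_H)
  note nk = this
  have step: "L2_inner M (\<Sum>k\<in>insert k I. cscale (c k) (lsv k)) f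
      = c k * L2_inner M (lsv k) f + L2_inner M (\<Sum>k\<in>I. cscale (c k) (lsv k)) f"
    unfolding sum.insert[OF insert.hyps]
      L2_inner_add[OF in_L2[OF scale_in[OF nk(1)]] in_L2[OF nk(2)] in_L2[OF insert.prems(2)]] L2_inner_scale ..
  have IH: "L2_inner M (\<Sum>k\<in>I. cscale (c k) (lsv k)) f = (\<Sum>k\<in>I. c k * L2_inner M (lsv k) f)"
    by (rule insert.IH) (use insert.prems in auto)
  show ?case by (simp only: step IH) (simp only: sum.insert[OF insert.hyps])
qed

text \<open>
  A function that is orthogonal in \<open>H\<close> to some singular functions is also orthogonal to them in \<open>L\<^sub>2\<close>.
\<close>

lemma error_pythagoras:
  assumes I: "finite I" "\<And>k. k \<in> I \<Longrightarrow> 0 < \<sigma> k" and g: "g \<in> H" "\<And>k. k \<in> I \<Longrightarrow> ip g (e k) = 0"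
  shows "q (g - (\<Sum>k\<in>I. cscale (c k) (lsv k))) = q g + (\<Sum>k\<in>I. (cmod (c k))\<^sup>2)"
proof -
  define h where "h = (\<Sum>k\<in>I. cscale (c k) (lsv k))"
  have hH: "h \<in> H" unfolding h_def using I by (intro sum_in lsv_H) auto
  have "ip (e k) g = 0" if "k \<in> I" for k using g(2)[OF that] ip_commute[OF g(1) e_H[OF I(2)[OF that]]] by simp
  then have hg: "L2_inner M h g = 0"
    unfolding h_def using I g(1) by (subst L2_inner_lsv_sum) (auto simp: L2_inner_lsv)
  have gh: "L2_inner M g h = 0" using hg L2_inner_commute[of M g h] by simp
  have "L2_inner M (lsv k) h = cnj (c k)" if k: "k \<in> I" for k
  proof -
    have "L2_inner M h (lsv k) = (\<Sum>j\<in>I. c j * L2_inner M (lsv j) (lsv k))"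
      unfolding h_def by (rule L2_inner_lsv_sum[OF I lsv_H[OF I(2)[OF k]]])
    also have "\<dots> = (\<Sum>j\<in>I. if j = k then c k else 0)"
      using I k by (intro sum.cong) (auto simp: lsv_orthonormal)
    finally have "L2_inner M h (lsv k) = (\<Sum>j\<in>I. if j = k then c k else 0)" .
    then have "L2_inner M h (lsv k) = c k" using I k by simp
    then show ?thesis using L2_inner_commute[of M "lsv k" h] by simp
  qed
  then have hh: "L2_inner M h h = complex_of_real (\<Sum>k\<in>I. (cmod (c k))\<^sup>2)"
    using L2_inner_lsv_sum[OF I hH, of c] unfolding h_def[symmetric] by (simp add: complex_norm_square del: of_real_power)
  have mh: "cscale (-1) h \<in> H" using hH by (rule scale_in)
  have eq: "g - h = g + cscale (-1) h" by (rule minus_cscale)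
  have D: "L2_inner M (g - h) f = L2_inner M g f - L2_inner M h f" if f: "f \<in> H" for f
    unfolding eq L2_inner_add[OF in_L2[OF g(1)] in_L2[OF mh] in_L2[OF f]] L2_inner_scale by simp
  have ghH: "g - h \<in> H" by (rule diff_in[OF g(1) hH])
  have "L2_inner M g (g - h) = L2_inner M g g"
    using L2_inner_commute[of M g "g - h"] D[OF g(1)] hg L2_inner_commute[of M g g] by simp
  moreover have "L2_inner M h (g - h) = - L2_inner M h h"
    using L2_inner_commute[of M h "g - h"] D[OF hH] gh L2_inner_commute[of M h h] by simp
  ultimately have "L2_inner M (g - h) (g - h) = L2_inner M g g + L2_inner M h h"
    using D[OF ghH] by simp
  then have "L2_inner M (g - h) (g - h) = L2_inner M g g + complex_of_real (\<Sum>k\<in>I. (cmod (c k))\<^sup>2)"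
    by (simp only: hh)
  then have "complex_of_real (q (g - h)) = complex_of_real (q g + (\<Sum>k\<in>I. (cmod (c k))\<^sup>2))"
    by (simp only: L2_inner_self of_real_add)
  then show ?thesis unfolding h_def[symmetric] by (simp only: of_real_eq_iff)
qed

text \<open>
  With \<open>d = min m N\<close>, the lower barrier concerns the first \<open>d\<close> left singular vectors, and the upper one
  those with index from \<open>d\<close> to \<open>N - 1\<close>. The latter exist only if \<open>d = m\<close>. For \<open>\<sigma> m = 0\<close> the operator is
  exact, which has to be said separately since the truncation error \<open>\<epsilon>\<close> does not vanish.
\<close>

lemma sampling_operator:
  fixes m n :: nat and y s t p \<epsilon> u :: real
  assumes m: "1 \<le> m" and \<sigma>0: "0 < \<sigma> 0"
    and y: "0 < y" and s: "0 < s" "s < y" and t: "0 < t" and p: "0 < p" and \<epsilon>: "0 < \<epsilon>" and u: "0 < u"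
    and gp: "1 / t + p < 1 / s - 1 / y"
    and a: "0 < y + real n * s - real m * y"
    and pu: "\<And>l. (\<Sum>k<l. (\<sigma> (m + k))\<^sup>2) \<le> p * u"
    and pnt: "1 \<le> p * (real n * t)"
  obtains x \<phi> where "\<And>i. i < n \<Longrightarrow> x i \<in> space M" "\<And>i. i < n \<Longrightarrow> \<phi> i \<in> H"
    "\<And>f. f \<in> H \<Longrightarrow> nrm f \<le> 1 \<Longrightarrow> q (f - (\<Sum>i<n. cscale (f (x i)) (\<phi> i))) \<le>
      (if \<sigma> m = 0 then 0 else (\<sigma> m)\<^sup>2 +
        (sqrt (u + (real n * t - 1 / p) * (\<sigma> m)\<^sup>2) + sqrt (real n * \<epsilon>))\<^sup>2 / (y + real n * s - real m * y))"
proof -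
  define \<alpha> where "\<alpha> = y + real n * s - real m * y"
  have \<alpha>: "0 < \<alpha>" using a by (simp add: \<alpha>_def)
  define \<eta> where "\<eta> = \<epsilon> * (1 / s - 1 / y - 1 / t - p)"
  have "0 < \<eta>" using gp \<epsilon> by (simp add: \<eta>_def)
  then obtain N where N: "\<And>k. k < N \<Longrightarrow> 0 < \<sigma> k" "m \<le> N \<or> \<sigma> N = 0" "(\<integral>x. tail N x \<partial>M) < \<eta>"
    by (rule truncation[where m = m]) blast
  define d where "d = min m N"
  define l where "l = N - d"
  have dN: "d \<le> N" "d \<le> m" "d + l = N" by (auto simp: d_def l_def)
  have N0: "0 < N" using N(2) \<sigma>0 m by (cases "N = 0") auto
  have d0: "0 < d" using N0 m by (simp add: d_def)
  have Jd: "J d = {..<d}" using N(1) dN by (auto simp: J_def)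
  have JN: "J N = {..<N}" using N(1) by (auto simp: J_def)
  have gap': "1 / t + p + (\<integral>x. tail N x \<partial>M) / \<epsilon> < 1 / s - 1 / y"
  proof -
    have "(\<integral>x. tail N x \<partial>M) / \<epsilon> < \<eta> / \<epsilon>" using N(3) \<epsilon> by (simp add: divide_strict_right_mono)
    also have "\<eta> / \<epsilon> = 1 / s - 1 / y - 1 / t - p" using \<epsilon> by (simp add: \<eta>_def)
    finally show ?thesis by simp
  qed
  have sumd: "(\<Sum>i<d. 1 / (real m * y)) \<le> 1 / y"
    using dN(2) y m by (simp add: field_simps)
  have suml: "(\<Sum>k<l. 1 / (u / (\<sigma> (d + k))\<^sup>2)) \<le> p"
  proof (cases "l = 0")
    case True
    then show ?thesis using p by simp
  next
    case False
    then have "d = m" by (auto simp: d_def l_def)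
    then have "(\<Sum>k<l. 1 / (u / (\<sigma> (d + k))\<^sup>2)) = (\<Sum>k<l. (\<sigma> (m + k))\<^sup>2) / u" by (simp add: sum_divide_distrib)
    also have "\<dots> \<le> p" using pu[of l] u by (simp add: pos_divide_le_eq)
    finally show ?thesis .
  qed
  have int_f: "integrable M (\<lambda>x. lsv i x * cnj (lsv j x))"
    "(\<integral>x. lsv i x * cnj (lsv j x) \<partial>M) = (if i = j then 1 else 0)" if "i < d" "j < d" for i j
    using lsv_L2[of i j] N(1) that dN by auto
  have int_g: "integrable M (\<lambda>x. lsv (d + i) x * cnj (lsv (d + j) x))"
    "(\<integral>x. lsv (d + i) x * cnj (lsv (d + j) x) \<partial>M) = (if i = j then 1 else 0)" if "i < l" "j < l" for i j
    using lsv_L2[of "d + i" "d + j"] N(1) that dN by auto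
  have my: "0 < real m * y" using m y by simp
  have ul: "0 < u / (\<sigma> (d + k))\<^sup>2" if "k < l" for k using N(1)[of "d + k"] that dN u by simp
  obtain x w where x: "\<And>i. i < n \<Longrightarrow> x i \<in> space M" and w: "\<And>i. i < n \<Longrightarrow> 0 < w i"
    and lo: "\<And>z. y * (norm2 d z) + real n * s * (norm2 d z) - (\<Sum>k<d. real m * y * (cmod (z k))\<^sup>2)
        \<le> (\<Sum>i<n. w i * (cmod (\<Sum>k<d. z k * lsv k (x i)))\<^sup>2)"
    and up: "\<And>z. p * (\<Sum>i<n. w i * (cmod (\<Sum>k<l. z k * lsv (d + k) (x i)))\<^sup>2)
        \<le> p * (\<Sum>k<l. u / (\<sigma> (d + k))\<^sup>2 * (cmod (z k))\<^sup>2) + (p * (real n * t) - 1) * (norm2 l z)"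
    and tl: "(\<Sum>i<n. w i * tail N (x i)) \<le> real n * \<epsilon>"
    by (rule two_sided_sparsification[where f = lsv and g = "\<lambda>k. lsv (d + k)" and d = d and e = l and n = n and
          h = "tail N" and a = "\<lambda>k. real m * y" and b = "\<lambda>k. u / (\<sigma> (d + k))\<^sup>2" and M = M,
          OF d0 int_f int_g tail_integrable tail_nonneg my sumd ul suml y s t \<epsilon> gap']) blast+
  have lo': "\<alpha> * (norm2 d z) \<le> (\<Sum>i<n. w i * (cmod (\<Sum>k<d. z k * lsv k (x i)))\<^sup>2)" for z
  proof -
    have "(\<Sum>k<d. real m * y * (cmod (z k))\<^sup>2) = real m * y * (norm2 d z)"
      by (simp add: sum_distrib_left)
    then show ?thesis using lo[of z] by (simp only: \<alpha>_def left_diff_distrib distrib_right)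
  qed
  obtain C where C: "\<And>z k. k < d \<Longrightarrow> (\<Sum>i<n. C k i * (\<Sum>j<d. z j * lsv j (x i))) = z k"
    "\<And>y. \<alpha> * (\<Sum>k<d. (cmod (\<Sum>i<n. C k i * y i))\<^sup>2) \<le> (\<Sum>i<n. w i * (cmod (y i))\<^sup>2)"
    by (rule weighted_least_squares[OF \<alpha> w lo']) blast+
  define \<phi> where "\<phi> i = (\<Sum>k<d. cscale (C k i) (lsv k))" for i
  have pos: "0 < \<sigma> k" if "k < d" for k using N(1) that dN by simp
  have \<phi>H: "\<phi> i \<in> H" if "i < n" for i unfolding \<phi>_def using pos by (intro sum_in lsv_H) auto
  have err: "q (f - (\<Sum>i<n. cscale (f (x i)) (\<phi> i))) \<le>
      (if \<sigma> m = 0 then 0 else (\<sigma> m)\<^sup>2 +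
        (sqrt (u + (real n * t - 1 / p) * (\<sigma> m)\<^sup>2) + sqrt (real n * \<epsilon>))\<^sup>2 / \<alpha>)"
    if f: "f \<in> H" "nrm f \<le> 1" for f
  proof -
    define g where "g = residual d f"
    have gW: "g \<in> W d" unfolding g_def by (rule residual_W[OF f(1)])
    note gH = W_H[OF gW]
    have ge: "ip g (e k) = 0" if "k < d" for k using gW that by (simp add: W_def perp_def Jd)
    \<comment> \<open>The function \<open>f\<close> is the sum of \<open>g\<close> and a part that the operator reproduces.\<close>
    define z where "z k = complex_of_real (\<sigma> k) * ip f (e k)" for k
    have fg: "f b = (\<Sum>k<d. z k * lsv k b) + g b" for b
    proof -
      have "(\<Sum>k<d. z k * lsv k b) = (\<Sum>k<d. ip f (e k) * e k b)"
      proof (intro sum.cong refl)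
        fix k assume "k \<in> {..<d}"
        then have "0 < \<sigma> k" using pos by simp
        then show "z k * lsv k b = ip f (e k) * e k b" by (simp add: z_def lsv_def cscale_def)
      qed
      then show ?thesis by (simp add: g_def residual_def proj_def Jd sum_cscale_apply)
    qed
    define c where "c k = (\<Sum>i<n. C k i * g (x i))" for k
    have Af: "(\<Sum>i<n. cscale (f (x i)) (\<phi> i)) b = (\<Sum>k<d. z k * lsv k b) + (\<Sum>k<d. c k * lsv k b)" for b
    proof -
      have "(\<Sum>i<n. cscale (f (x i)) (\<phi> i)) b = (\<Sum>i<n. \<Sum>k<d. C k i * f (x i) * lsv k b)"
        by (simp add: sum_cscale_apply \<phi>_def sum_distrib_left mult_ac)
      also have "\<dots> = (\<Sum>k<d. (\<Sum>i<n. C k i * f (x i)) * lsv k b)"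
        by (subst sum.swap) (simp add: sum_distrib_right)
      also have "\<dots> = (\<Sum>k<d. (z k + c k) * lsv k b)"
      proof (intro sum.cong refl)
        fix k assume "k \<in> {..<d}"
        then have k: "k < d" by simp
        have "(\<Sum>i<n. C k i * f (x i)) = (\<Sum>i<n. C k i * (\<Sum>j<d. z j * lsv j (x i))) + c k"
          unfolding c_def by (subst fg) (simp add: distrib_left sum.distrib)
        then show "(\<Sum>i<n. C k i * f (x i)) * lsv k b = (z k + c k) * lsv k b" by (simp only: C(1)[OF k])
      qed
      finally show ?thesis by (simp add: distrib_right sum.distrib)
    qed
    have "f - (\<Sum>i<n. cscale (f (x i)) (\<phi> i)) = g - (\<Sum>k<d. cscale (c k) (lsv k))"
    proof
      fix b
      show "(f - (\<Sum>i<n. cscale (f (x i)) (\<phi> i))) b = (g - (\<Sum>k<d. cscale (c k) (lsv k))) b"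
        unfolding fun_diff_def Af fg[of b] unfolding sum_cscale_apply by simp
    qed
    then have err: "q (f - (\<Sum>i<n. cscale (f (x i)) (\<phi> i))) = q g + (\<Sum>k<d. (cmod (c k))\<^sup>2)"
      using error_pythagoras[of "{..<d}" g c] pos gH ge by simp
    show ?thesis
    proof (cases "\<sigma> m = 0")
      case True
      have "J d = J m"
      proof (cases "m \<le> N")
        case False
        then have "\<sigma> k = 0" if "N \<le> k" for k using N(2) \<sigma>_mono[OF that] \<sigma>_nonneg[of k] by simp
        then have "k < N \<and> k < m" if "0 < \<sigma> k" for k using that False by (metis less_irrefl not_le less_trans)
        then show ?thesis using False by (auto simp: J_def d_def)
      qed (simp add: d_def)
      then have "g = 0" using W_trivial[OF True] gW by (simp add: W_def)
      then have "q g = 0" "c k = 0" for k by (simp_all add: c_def L2_norm_sq)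
      then show ?thesis using err True by simp
    next
      case False
      then have \<sigma>m: "0 < \<sigma> m" using \<sigma>_nonneg[of m] by simp
      have mN: "m \<le> N"
      proof (rule ccontr)
        assume "\<not> m \<le> N"
        then have "\<sigma> m \<le> 0" using N(2) \<sigma>_mono[of N m] by simp
        then show False using \<sigma>m by simp
      qed
      then have dm: "d = m" by (simp add: d_def)
      have pyJ: "(nrm f)\<^sup>2 = (\<Sum>k\<in>J i. (cmod (ip f (e k)))\<^sup>2) + (nrm (residual i f))\<^sup>2" for i
        unfolding residual_def by (rule pythagoras[OF J_fin J_H orthonormal_J f(1)])
      have pyN: "(nrm f)\<^sup>2 = (\<Sum>k<N. (cmod (ip f (e k)))\<^sup>2) + (nrm (residual N f))\<^sup>2"
        using pyJ[of N] by (simp only: JN)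
      have pyd: "(nrm f)\<^sup>2 = (\<Sum>k<d. (cmod (ip f (e k)))\<^sup>2) + (nrm g)\<^sup>2"
        using pyJ[of d] by (simp only: Jd g_def)
      have nf: "(nrm f)\<^sup>2 \<le> 1" using f(2) nrm_nonneg[OF f(1)] by (simp add: power_le_one)
      have "(nrm g)\<^sup>2 \<le> 1" using pyd nf by (smt (verit) sum_nonneg zero_le_power2)
      then have qg: "q g \<le> (\<sigma> m)\<^sup>2"
        using W_bound[OF gW] dm mult_left_le[of "(nrm g)\<^sup>2" "(\<sigma> m)\<^sup>2"] by simp
      have split: "(\<Sum>k<N. v k) = (\<Sum>k<d. v k) + (\<Sum>k<l. v (d + k))" for v :: "nat \<Rightarrow> real"
      proof -
        have "(\<Sum>k<d + j. v k) = (\<Sum>k<d. v k) + (\<Sum>k<j. v (d + k))" for j by (induction j) auto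
        from this[of l] show ?thesis by (simp add: dN(3))
      qed
      \<comment> \<open>Split \<open>g\<close> at \<open>N\<close>: the upper barrier controls the samples of the first part, and
        the bound for \<open>tail N\<close> those of the second.\<close>
      define \<gamma> where "\<gamma> k = ip f (e (d + k))" for k
      define gN where "gN = residual N f"
      have gNW: "gN \<in> W N" unfolding gN_def by (rule residual_W[OF f(1)])
      have \<gamma>1: "(\<Sum>k<l. (cmod (\<gamma> k))\<^sup>2) \<le> 1" and gN1: "(nrm gN)\<^sup>2 \<le> 1"
      proof -
        have "0 \<le> (\<Sum>k<d. (cmod (ip f (e k)))\<^sup>2)" "0 \<le> (\<Sum>k<l. (cmod (\<gamma> k))\<^sup>2)" "0 \<le> (nrm gN)\<^sup>2"
          by (auto intro: sum_nonneg)
        then show "(\<Sum>k<l. (cmod (\<gamma> k))\<^sup>2) \<le> 1" "(nrm gN)\<^sup>2 \<le> 1"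
          using pyN nf split[of "\<lambda>k. (cmod (ip f (e k)))\<^sup>2"] unfolding \<gamma>_def gN_def by linarith+
      qed
      define \<zeta> where "\<zeta> k = complex_of_real (\<sigma> (d + k)) * \<gamma> k" for k
      have gdec: "g b = (\<Sum>k<l. \<zeta> k * lsv (d + k) b) + gN b" for b
      proof -
        have "(g - gN) b = (\<Sum>k\<in>{..<N} - {..<d}. cscale (ip f (e k)) (e k)) b"
          using proj_J_diff[OF dN(1), of f] by (simp add: g_def gN_def JN Jd)
        also have "\<dots> = (\<Sum>k\<in>{..<N} - {..<d}. ip f (e k) * e k b)" by (rule sum_cscale_apply)
        also have "\<dots> = (\<Sum>k<l. ip f (e (d + k)) * e (d + k) b)"
          by (rule sum.reindex_bij_witness[of _ "\<lambda>k. d + k" "\<lambda>k. k - d"]) (use dN in auto)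
        also have "\<dots> = (\<Sum>k<l. \<zeta> k * lsv (d + k) b)"
        proof (intro sum.cong refl)
          fix k assume "k \<in> {..<l}"
          then have "0 < \<sigma> (d + k)" using N(1) dN by simp
          then show "ip f (e (d + k)) * e (d + k) b = \<zeta> k * lsv (d + k) b"
            by (simp add: \<zeta>_def \<gamma>_def lsv_def cscale_def)
        qed
        finally show ?thesis by (simp add: fun_diff_def algebra_simps)
      qed
      have "(\<Sum>i<n. w i * (cmod (\<Sum>k<l. \<zeta> k * lsv (d + k) (x i)))\<^sup>2) \<le> u + (real n * t - 1 / p) * (\<sigma> m)\<^sup>2"
      proof -
        have "(\<Sum>k<l. u / (\<sigma> (d + k))\<^sup>2 * (cmod (\<zeta> k))\<^sup>2) = (\<Sum>k<l. u * (cmod (\<gamma> k))\<^sup>2)"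
        proof (intro sum.cong refl)
          fix k assume "k \<in> {..<l}"
          then have "0 < \<sigma> (d + k)" using N(1) dN by simp
          then show "u / (\<sigma> (d + k))\<^sup>2 * (cmod (\<zeta> k))\<^sup>2 = u * (cmod (\<gamma> k))\<^sup>2"
            by (simp add: \<zeta>_def norm_mult power_mult_distrib)
        qed
        also have "\<dots> = u * (\<Sum>k<l. (cmod (\<gamma> k))\<^sup>2)" by (simp add: sum_distrib_left)
        also have "\<dots> \<le> u * 1" using \<gamma>1 u by (intro mult_left_mono) auto
        finally have 1: "(\<Sum>k<l. u / (\<sigma> (d + k))\<^sup>2 * (cmod (\<zeta> k))\<^sup>2) \<le> u" by simp
        have "(\<Sum>k<l. (cmod (\<zeta> k))\<^sup>2) \<le> (\<Sum>k<l. (\<sigma> m)\<^sup>2 * (cmod (\<gamma> k))\<^sup>2)"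
        proof (intro sum_mono)
          fix k
          have "(\<sigma> (d + k))\<^sup>2 \<le> (\<sigma> m)\<^sup>2" using \<sigma>_mono[of m "d + k"] \<sigma>_nonneg dm by (intro power_mono) auto
          then show "(cmod (\<zeta> k))\<^sup>2 \<le> (\<sigma> m)\<^sup>2 * (cmod (\<gamma> k))\<^sup>2"
            by (simp add: \<zeta>_def norm_mult power_mult_distrib mult_right_mono)
        qed
        also have "\<dots> = (\<sigma> m)\<^sup>2 * (\<Sum>k<l. (cmod (\<gamma> k))\<^sup>2)" by (simp add: sum_distrib_left)
        also have "\<dots> \<le> (\<sigma> m)\<^sup>2 * 1" using \<gamma>1 by (intro mult_left_mono) auto
        finally have 2: "(\<Sum>k<l. (cmod (\<zeta> k))\<^sup>2) \<le> (\<sigma> m)\<^sup>2" by simp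
        have "p * (\<Sum>i<n. w i * (cmod (\<Sum>k<l. \<zeta> k * lsv (d + k) (x i)))\<^sup>2) \<le> p * u + (p * (real n * t) - 1) * (\<sigma> m)\<^sup>2"
          by (rule order_trans[OF up[of \<zeta>]]) (intro add_mono mult_left_mono 1 2, use p pnt in auto)
        also have "\<dots> = p * (u + (real n * t - 1 / p) * (\<sigma> m)\<^sup>2)" using p by (simp add: algebra_simps)
        finally show ?thesis using p by simp
      qed
      moreover have "(\<Sum>i<n. w i * (cmod (gN (x i)))\<^sup>2) \<le> real n * \<epsilon>"
      proof (rule order_trans[OF sum_mono tl])
        fix i assume "i \<in> {..<n}"
        then have i: "i < n" by simp
        have "(cmod (gN (x i)))\<^sup>2 \<le> tail N (x i) * (nrm gN)\<^sup>2" by (rule point_bound[OF x[OF i] gNW])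
        also have "\<dots> \<le> tail N (x i) * 1" by (intro mult_left_mono gN1 tail_nonneg x i)
        finally show "w i * (cmod (gN (x i)))\<^sup>2 \<le> w i * tail N (x i)" using w[OF i] by simp
      qed
      ultimately have wg: "(\<Sum>i<n. w i * (cmod (g (x i)))\<^sup>2) \<le>
          (sqrt (u + (real n * t - 1 / p) * (\<sigma> m)\<^sup>2) + sqrt (real n * \<epsilon>))\<^sup>2"
        unfolding gdec by (rule weighted_minkowski[rotated]) (rule less_imp_le, rule w)
      have "\<alpha> * (\<Sum>k<d. (cmod (c k))\<^sup>2) \<le> (sqrt (u + (real n * t - 1 / p) * (\<sigma> m)\<^sup>2) + sqrt (real n * \<epsilon>))\<^sup>2"
        unfolding c_def by (rule order_trans[OF C(2) wg])
      then have "(\<Sum>k<d. (cmod (c k))\<^sup>2) \<le> (sqrt (u + (real n * t - 1 / p) * (\<sigma> m)\<^sup>2) + sqrt (real n * \<epsilon>))\<^sup>2 / \<alpha>"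
        using \<alpha> by (simp add: pos_le_divide_eq mult.commute)
      then show ?thesis using err qg False by simp
    qed
  qed
  show ?thesis by (rule that[of x \<phi>]) (fact x \<phi>H err[unfolded \<alpha>_def])+
qed

end

section \<open>Choice of the parameters\<close>

text \<open>
  The initial matrix \<open>m y\<close> of the lower barrier has potential \<open>1/y\<close>, and \<open>s = y / (1 + y)\<close> normalizes the
  budget \<open>1/s - 1/y\<close> of the averaging to one. The final bound \<open>y + n s - m y\<close> is maximal for
  \<open>y = 1/r - 1\<close>, with value \<open>n (1 - r)\<^sup>2\<close>. For \<open>m = 1\<close> we have \<open>r = 0\<close> and this maximizer is infinite, but \<open>y = 3\<close>
  is good enough.
\<close>

lemma lower_parameters:
  fixes m n :: nat and r :: real
  assumes m: "1 \<le> m" and mn: "m \<le> n" and r: "r = sqrt ((real m - 1) / real n)"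
  obtains y s A where "0 < y" "0 < s" "s < y" "1 / s - 1 / y = 1" "0 < A"
    "y + real n * s - real m * y = real n * A"
    "1 + (1 + 1 / (2 * real n))\<^sup>2 / A \<le> (1 + 1 / (1 - r))\<^sup>2"
proof -
  define N where "N = real n"
  have N: "1 \<le> N" using m mn by (simp add: N_def)
  have sv: "0 < y / (1 + y)" "y / (1 + y) < y" "1 / (y / (1 + y)) - 1 / y = 1" if "0 < y" for y :: real
    using that by (auto simp: field_simps)
  show ?thesis
  proof (cases "m = 1")
    case True
    then have "r = 0" using r by simp
    have c: "1 + 1 / (2 * N) \<le> 3 / 2" using N by (simp add: field_simps)
    have "(1 + 1 / (2 * N))\<^sup>2 \<le> (3 / 2)\<^sup>2" using N by (intro power_mono c) auto
    then have "1 + (1 + 1 / (2 * N))\<^sup>2 / (3 / 4) \<le> (1 + 1 / (1 - r))\<^sup>2"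
      using \<open>r = 0\<close> by (simp add: power2_eq_square)
    moreover have "3 + N * (3 / (1 + 3)) - real m * 3 = N * (3 / 4)" using True by simp
    ultimately show ?thesis using that[of 3 "3 / (1 + 3)" "3 / 4"] sv[of 3] unfolding N_def by simp
  next
    case False
    then have m2: "2 \<le> m" using m by simp
    have r0: "0 < r" using m2 N by (simp add: r N_def[symmetric])
    have rr: "r\<^sup>2 = (real m - 1) / N" using m N by (simp add: r N_def[symmetric])
    \<comment> \<open>This is half of \<open>(1 + 1/(2N))\<^sup>2 - 1\<close>. The last claim amounts to \<open>h \<le> 1 - r\<close>, which follows
      from \<open>r\<^sup>2 \<le> 1 - 1/N\<close>.\<close>
    define h where "h = 1 / (2 * N) + 1 / (8 * N\<^sup>2)"
    have h1: "h \<le> 1"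
    proof -
      have "1 / (2 * N) \<le> 1 / 2" "1 / (8 * N\<^sup>2) \<le> 1 / 8" using N by (simp_all add: field_simps)
      then show ?thesis by (simp add: h_def)
    qed
    have h0: "0 < h" using N by (simp add: h_def add_pos_pos)
    have "(real m - 1) / N \<le> (N - 1) / N" using mn N by (intro divide_right_mono) (auto simp: N_def)
    also have "\<dots> \<le> (1 - h)\<^sup>2"
    proof -
      have "(1 - h)\<^sup>2 - (N - 1) / N = 1 / (8 * N ^ 3) + 1 / (64 * N ^ 4)"
        using N by (simp add: h_def field_simps power2_eq_square power3_eq_cube power4_eq_xxxx)
      moreover have "0 \<le> 1 / (8 * N ^ 3) + 1 / (64 * N ^ 4)" using N by simp
      ultimately show ?thesis by linarith
    qed
    finally have "r\<^sup>2 \<le> (1 - h)\<^sup>2" by (simp only: rr)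
    then have rh: "r \<le> 1 - h" by (rule power2_le_imp_le) (use h1 in simp)
    then have r1: "r < 1" using h0 by simp
    define y where "y = 1 / r - 1"
    have y: "0 < y" using r0 r1 by (simp add: y_def)
    have ys: "y / (1 + y) = 1 - r" using r0 by (simp add: y_def field_simps)
    have "real m = 1 + N * r\<^sup>2" using rr N by simp
    then have "y + N * (y / (1 + y)) - real m * y = N * (1 - r) - N * (r * (r * y))"
      unfolding ys by (simp add: algebra_simps power2_eq_square)
    also have "r * y = 1 - r" using r0 by (simp add: y_def field_simps)
    also have "N * (1 - r) - N * (r * (1 - r)) = N * (1 - r)\<^sup>2" by (simp add: algebra_simps power2_eq_square)
    finally have a: "y + N * (y / (1 + y)) - real m * y = N * (1 - r)\<^sup>2" .
    define R where "R = 1 / (1 - r)"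
    have R: "0 < R" using r1 by (simp add: R_def)
    have "(1 + 1 / (2 * N))\<^sup>2 - 1 = 2 * h" using N by (simp add: h_def field_simps power2_eq_square)
    then have "R * ((1 + 1 / (2 * N))\<^sup>2 - 1) \<le> R * (2 * (1 - r))"
      using rh R by (intro mult_left_mono) auto
    also have "\<dots> = 2" using r1 by (simp add: R_def field_simps)
    finally have "R * (R * ((1 + 1 / (2 * N))\<^sup>2 - 1)) \<le> R * 2" using R by (intro mult_left_mono) auto
    then have "1 + (1 + 1 / (2 * N))\<^sup>2 * R\<^sup>2 \<le> (1 + R)\<^sup>2"
      by (simp add: algebra_simps power2_eq_square)
    moreover have "(1 + 1 / (2 * N))\<^sup>2 / (1 - r)\<^sup>2 = (1 + 1 / (2 * N))\<^sup>2 * R\<^sup>2"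
      by (simp add: R_def power_divide)
    ultimately have "1 + (1 + 1 / (2 * N))\<^sup>2 / (1 - r)\<^sup>2 \<le> (1 + 1 / (1 - r))\<^sup>2" by (simp only: R_def)
    then show ?thesis using that[of y "y / (1 + y)" "(1 - r)\<^sup>2"] y sv[OF y] a r1 unfolding N_def by simp
  qed
qed

text \<open>
  For \<open>t = 1 / (1 - p)\<close> the expression under the first root is \<open>\<tau>/p + n \<sigma>\<^sup>2 / (1 - p)\<close>. Its minimum
  \<open>n X\<^sup>2\<close> is attained at \<open>p = P / (P + v \<sigma>)\<close> with \<open>P = sqrt \<tau>\<close> and \<open>v = sqrt n\<close>, but
  \<open>1 \<le> p n t\<close> requires \<open>P \<ge> \<sigma> / v\<close>. The choice \<open>P = sqrt \<tau> + \<sigma> / v\<close> satisfies this always,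
  and the expression is still at most \<open>(n + 1) X\<^sup>2\<close>. The gap between the root of \<open>1 + 1/n\<close> and
  \<open>1 + 1/(2n)\<close> leaves room to enlarge \<open>t\<close> by the factor \<open>k\<^sup>2 > 1\<close>, for a strict inequality in the budget, and
  for the truncation error \<open>\<epsilon>\<close>.
\<close>

lemma upper_parameters:
  fixes n :: nat and \<sigma> \<tau> :: real
  assumes n: "1 \<le> n" and \<sigma>: "0 < \<sigma>" and \<tau>: "0 \<le> \<tau>"
  obtains t p u \<epsilon> where "0 < t" "0 < p" "0 < u" "0 < \<epsilon>" "1 / t + p < 1" "\<sigma>\<^sup>2 + \<tau> = p * u" "1 \<le> p * (real n * t)"
    "sqrt (u + (real n * t - 1 / p) * \<sigma>\<^sup>2) + sqrt (real n * \<epsilon>) \<le>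
      sqrt (real n) * ((1 + 1 / (2 * real n)) * (\<sigma> + sqrt (1 / real n * \<tau>)))"
proof -
  define N where "N = real n"
  have N: "1 \<le> N" using n by (simp add: N_def)
  define v where "v = sqrt N"
  have v: "0 < v" "v * v = N" using N by (simp_all add: v_def)
  define T where "T = sqrt \<tau>"
  have T: "0 \<le> T" "T * T = \<tau>" using \<tau> by (simp_all add: T_def)
  define X where "X = \<sigma> + sqrt (1 / N * \<tau>)"
  have vX: "v * X = v * \<sigma> + T"
    using v N by (simp add: X_def T_def v_def real_sqrt_mult real_sqrt_divide algebra_simps)
  have X: "\<sigma> \<le> X" "0 < X" using \<sigma> \<tau> N by (auto simp: X_def add_pos_nonneg)
  define P where "P = T + \<sigma> / v"
  have P: "0 < P" "T \<le> P" "\<sigma> \<le> P * v" using T \<sigma> v by (auto simp: P_def add_nonneg_pos distrib_right)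
  define S where "S = P + v * \<sigma>"
  have S: "0 < S" "P < S" using P v \<sigma> by (auto simp: S_def add_pos_pos)
  define p where "p = P / S"
  have p: "0 < p" "1 - p = v * \<sigma> / S" "p < 1" using P S by (auto simp: p_def S_def field_simps)
  define g where "g = sqrt (1 + 1 / N)"
  define c where "c = 1 + 1 / (2 * N)"
  have g: "0 < g" "g\<^sup>2 = 1 + 1 / N" using N by (auto simp: g_def add_pos_pos)
  have "g\<^sup>2 < c\<^sup>2" using N unfolding g(2) by (simp add: c_def power2_eq_square field_simps)
  moreover have "0 \<le> c" using N by (simp add: c_def)
  ultimately have gc: "g < c" by (simp add: power2_less_imp_less)
  define k where "k = (g + c) / (2 * g)"
  have k: "1 < k" using g gc by (simp add: k_def field_simps)
  define t where "t = k\<^sup>2 / (1 - p)"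
  define u where "u = (\<sigma>\<^sup>2 + \<tau>) / p"
  define \<epsilon> where "\<epsilon> = ((c - g) / 2 * X)\<^sup>2"
  have k2: "1 < k\<^sup>2" using k by (simp add: one_less_power)
  have t0: "0 < t" unfolding t_def using k p(3) by (intro divide_pos_pos) auto
  have u0: "0 < u" using \<sigma> \<tau> p by (simp add: u_def add_pos_nonneg)
  have \<epsilon>0: "0 < \<epsilon>" using gc X by (simp add: \<epsilon>_def)
  have "1 / t < 1 - p"
    using k2 p(3) by (simp add: t_def divide_less_eq)
  then have tp: "1 / t + p < 1" by simp
  have pu: "\<sigma>\<^sup>2 + \<tau> = p * u" using p by (simp add: u_def)
  have pnt: "1 \<le> p * (N * t)"
  proof -
    have "1 \<le> P * v / \<sigma>" using P(3) \<sigma> by simp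
    also have "\<dots> = p * (N * (1 / (1 - p)))"
      unfolding p(2) v(2)[symmetric] using S v(1) \<sigma> by (simp add: p_def)
    also have "\<dots> \<le> p * (N * t)"
      unfolding t_def using k2 p(1,3) N by (intro mult_left_mono divide_right_mono) auto
    finally show ?thesis .
  qed
  have "\<tau> / P \<le> T" using P T by (simp add: divide_le_eq flip: T(2)) (simp add: mult_left_mono)
  have SX: "S = v * X + \<sigma> / v" by (simp add: S_def P_def vX)
  have F: "\<tau> / p + N * \<sigma>\<^sup>2 / (1 - p) \<le> (N + 1) * X\<^sup>2"
  proof -
    have "\<tau> / p = S * (\<tau> / P)" using S P by (simp add: p_def)
    moreover have "N * \<sigma>\<^sup>2 / (1 - p) = S * (v * \<sigma>)"
      unfolding p(2) using v(1) S \<sigma> by (simp add: power2_eq_square flip: v(2))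
    ultimately have "\<tau> / p + N * \<sigma>\<^sup>2 / (1 - p) = S * (\<tau> / P + v * \<sigma>)"
      by (simp only: distrib_left)
    also have "\<dots> \<le> S * (v * X)" unfolding vX using \<open>\<tau> / P \<le> T\<close> S by (intro mult_left_mono) auto
    also have "\<dots> = N * X\<^sup>2 + \<sigma> * X"
      unfolding SX v(2)[symmetric] using v by (simp add: field_simps power2_eq_square)
    also have "\<dots> \<le> N * X\<^sup>2 + X * X" using X by simp
    finally show ?thesis by (simp add: algebra_simps power2_eq_square)
  qed
  have "u + (N * t - 1 / p) * \<sigma>\<^sup>2 = \<tau> / p + k\<^sup>2 * (N * \<sigma>\<^sup>2 / (1 - p))"
    by (simp add: u_def t_def add_divide_distrib algebra_simps)
  also have "\<dots> \<le> k\<^sup>2 * (\<tau> / p) + k\<^sup>2 * (N * \<sigma>\<^sup>2 / (1 - p))"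
    using mult_right_mono[of 1 "k\<^sup>2" "\<tau> / p"] k2 \<tau> p(1) by simp
  also have "\<dots> \<le> k\<^sup>2 * ((N + 1) * X\<^sup>2)" unfolding distrib_left[symmetric] using F by (intro mult_left_mono) auto
  also have "\<dots> = (v * (k * g * X))\<^sup>2"
    using v N by (simp add: power_mult_distrib g(2) power2_eq_square[of v] field_simps)
  finally have "sqrt (u + (N * t - 1 / p) * \<sigma>\<^sup>2) \<le> v * (k * g * X)"
    using v k g X by (intro real_le_lsqrt) auto
  moreover have "sqrt (N * \<epsilon>) = v * ((c - g) / 2 * X)"
    using gc X by (simp add: real_sqrt_mult \<epsilon>_def v_def)
  moreover have "k * g * X + (c - g) / 2 * X = c * X" using g by (simp add: k_def field_simps)
  ultimately have "sqrt (u + (N * t - 1 / p) * \<sigma>\<^sup>2) + sqrt (N * \<epsilon>) \<le> v * (c * X)"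
    by (smt (verit) distrib_left)
  then show ?thesis
    using that[of t p u \<epsilon>] t0 p u0 \<epsilon>0 tp pu pnt unfolding N_def v_def c_def X_def by blast
qed

section \<open>The error bound\<close>

context singular_basis
begin

lemma tail_sum_bound:
  "(\<Sum>k<l. (\<sigma> (m + k))\<^sup>2) \<le> (\<sigma> m)\<^sup>2 + (\<Sum>\<^sub>\<infinity>k\<in>{m<..}. (\<sigma> k)\<^sup>2)"
proof -
  have "(\<lambda>k. (\<sigma> k)\<^sup>2) summable_on UNIV"
    using \<sigma>_sq_summable by (simp add: summable_on_UNIV_nonneg_real_iff)
  then have S: "(\<lambda>k. (\<sigma> k)\<^sup>2) summable_on {m<..}" by (rule summable_on_subset_banach) simp
  have "(\<Sum>k<l. (\<sigma> (m + k))\<^sup>2) \<le> (\<Sum>k<Suc l. (\<sigma> (m + k))\<^sup>2)" by simp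
  also have "\<dots> = (\<sigma> m)\<^sup>2 + (\<Sum>k<l. (\<sigma> (m + Suc k))\<^sup>2)" by (subst sum.lessThan_Suc_shift) simp
  also have "(\<Sum>k<l. (\<sigma> (m + Suc k))\<^sup>2) = (\<Sum>k\<in>(\<lambda>k. m + Suc k) ` {..<l}. (\<sigma> k)\<^sup>2)"
    by (subst sum.reindex) (auto simp: inj_on_def)
  also have "\<dots> \<le> (\<Sum>\<^sub>\<infinity>k\<in>{m<..}. (\<sigma> k)\<^sup>2)"
    by (rule finite_sum_le_infsum[OF S]) auto
  finally show ?thesis by simp
qed

text \<open>
  If \<open>\<sigma> 0 = 0\<close> then \<open>H\<close> is trivial, and if \<open>\<sigma> m = 0\<close> the sampling operator is exact for any admissible
  parameters of the upper barrier.
\<close>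

lemma sampling_error:
  fixes m n :: nat
  assumes m: "1 \<le> m" and mn: "m \<le> n" and r: "r = sqrt ((real m - 1) / real n)"
    and ne: "space M \<noteq> {}"
  obtains x \<phi> where "\<And>i. i < n \<Longrightarrow> x i \<in> space M" "\<And>i. i < n \<Longrightarrow> \<phi> i \<in> H"
    "\<And>f. f \<in> H \<Longrightarrow> nrm f \<le> 1 \<Longrightarrow> L2_norm M (f - (\<Sum>i<n. cscale (f (x i)) (\<phi> i))) \<le>
      (1 + 1 / (1 - r)) * (\<sigma> m + sqrt (1 / real n * (\<Sum>\<^sub>\<infinity>k\<in>{m<..}. (\<sigma> k)\<^sup>2)))"
proof -
  define \<tau> where "\<tau> = (\<Sum>\<^sub>\<infinity>k\<in>{m<..}. (\<sigma> k)\<^sup>2)"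
  have \<tau>: "0 \<le> \<tau>" unfolding \<tau>_def by (intro infsum_nonneg) auto
  define X where "X = \<sigma> m + sqrt (1 / real n * \<tau>)"
  have X: "\<sigma> m \<le> X" "0 \<le> X" using \<tau> \<sigma>_nonneg[of m] by (auto simp: X_def)
  have n1: "1 \<le> n" using m mn by simp
  have r1: "r < 1"
  proof -
    have "(real m - 1) / real n < 1" using mn n1 by (simp add: divide_less_eq)
    then show ?thesis unfolding r by (simp add: real_sqrt_lt_1_iff)
  qed
  have RX: "0 \<le> (1 + 1 / (1 - r)) * X" using r1 X by (intro mult_nonneg_nonneg) auto
  show ?thesis
  proof (cases "\<sigma> 0 = 0")
    case True
    obtain x0 where x0: "x0 \<in> space M" using ne by auto
    have z: "f = 0" if f: "f \<in> H" for f
    proof -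
      have "f \<in> W 0" using f by (simp add: W_def perp_def J_def)
      then show ?thesis by (rule W_trivial[OF True])
    qed
    have "L2_norm M (f - (\<Sum>i<n. cscale (f x0) 0)) = 0" if "f \<in> H" for f
      using z[OF that] by (simp add: L2_norm_def)
    then show ?thesis using that[of "\<lambda>_. x0" "\<lambda>_. 0"] x0 zero_in RX unfolding X_def \<tau>_def by simp
  next
    case False
    then have \<sigma>0: "0 < \<sigma> 0" using \<sigma>_nonneg[of 0] by simp
    obtain y s A where L: "0 < y" "0 < s" "s < y" "1 / s - 1 / y = 1" "0 < A"
      "y + real n * s - real m * y = real n * A" "1 + (1 + 1 / (2 * real n))\<^sup>2 / A \<le> (1 + 1 / (1 - r))\<^sup>2"
      by (rule lower_parameters[OF m mn r])
    have a0: "0 < y + real n * s - real m * y" using L n1 by simp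
    show ?thesis
    proof (cases "\<sigma> m = 0")
      case True
      have "\<sigma> (m + k) = 0" for k using \<sigma>_mono[of m "m + k"] \<sigma>_nonneg[of "m + k"] True by simp
      then have pu: "(\<Sum>k<l. (\<sigma> (m + k))\<^sup>2) \<le> 1 / 2 * 1" for l by simp
      have g: "1 / 3 + 1 / 2 < 1 / s - 1 / y" unfolding L(4) by simp
      have pnt: "1 \<le> 1 / 2 * (real n * 3)" using n1 by simp
      obtain x \<phi> where x: "\<And>i. i < n \<Longrightarrow> x i \<in> space M" "\<And>i. i < n \<Longrightarrow> \<phi> i \<in> H"
        "\<And>f. f \<in> H \<Longrightarrow> nrm f \<le> 1 \<Longrightarrow> q (f - (\<Sum>i<n. cscale (f (x i)) (\<phi> i))) \<le> 0"
        using sampling_operator[where t = 3 and p = "1 / 2" and \<epsilon> = 1 and u = 1,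
            OF m \<sigma>0 L(1-3) _ _ _ _ g a0 pu pnt] True by auto
      have err: "L2_norm M (f - (\<Sum>i<n. cscale (f (x i)) (\<phi> i))) \<le> (1 + 1 / (1 - r)) * X" if f: "f \<in> H" "nrm f \<le> 1" for f
        using x(3)[OF f] RX by simp
      show ?thesis by (rule that[of x \<phi>]) (fact x(1,2) err[unfolded X_def \<tau>_def])+
    next
      case False
      then have \<sigma>m: "0 < \<sigma> m" using \<sigma>_nonneg[of m] by simp
      obtain t p u \<epsilon> where U: "0 < t" "0 < p" "0 < u" "0 < \<epsilon>" "1 / t + p < 1" "(\<sigma> m)\<^sup>2 + \<tau> = p * u"
        "1 \<le> p * (real n * t)"
        "sqrt (u + (real n * t - 1 / p) * (\<sigma> m)\<^sup>2) + sqrt (real n * \<epsilon>) \<le>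
          sqrt (real n) * ((1 + 1 / (2 * real n)) * (\<sigma> m + sqrt (1 / real n * \<tau>)))"
        by (rule upper_parameters[OF n1 \<sigma>m \<tau>])
      have g: "1 / t + p < 1 / s - 1 / y" unfolding L(4) by (rule U(5))
      have pu: "(\<Sum>k<l. (\<sigma> (m + k))\<^sup>2) \<le> p * u" for l
        unfolding U(6)[symmetric] \<tau>_def by (rule tail_sum_bound)
      define Y where "Y = sqrt (u + (real n * t - 1 / p) * (\<sigma> m)\<^sup>2) + sqrt (real n * \<epsilon>)"
      obtain x \<phi> where x: "\<And>i. i < n \<Longrightarrow> x i \<in> space M" "\<And>i. i < n \<Longrightarrow> \<phi> i \<in> H"
        "\<And>f. f \<in> H \<Longrightarrow> nrm f \<le> 1 \<Longrightarrow> q (f - (\<Sum>i<n. cscale (f (x i)) (\<phi> i))) \<le>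
          (\<sigma> m)\<^sup>2 + Y\<^sup>2 / (real n * A)"
        using sampling_operator[OF m \<sigma>0 L(1-3) U(1,2,4,3) g a0 pu U(7)] False unfolding Y_def L(6)
        by (smt (verit, best))
      define c where "c = 1 + 1 / (2 * real n)"
      have Y0: "0 \<le> Y"
        unfolding Y_def
      proof (rule add_nonneg_nonneg; rule real_sqrt_ge_zero)
        have "1 / p \<le> real n * t" using U(2,7) by (simp add: divide_le_eq mult.commute)
        then have "0 \<le> (real n * t - 1 / p) * (\<sigma> m)\<^sup>2" by simp
        then show "0 \<le> u + (real n * t - 1 / p) * (\<sigma> m)\<^sup>2" using U(3) by linarith
      qed (use U in auto)
      have "Y\<^sup>2 \<le> (sqrt (real n) * (c * X))\<^sup>2"
        using U(8) Y0 unfolding Y_def[symmetric] c_def X_def by (intro power_mono) auto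
      also have "\<dots> = real n * (c\<^sup>2 * X\<^sup>2)" by (simp add: power_mult_distrib)
      finally have "Y\<^sup>2 / (real n * A) \<le> real n * (c\<^sup>2 * X\<^sup>2) / (real n * A)"
        using L(5) by (intro divide_right_mono) auto
      also have "\<dots> = c\<^sup>2 / A * X\<^sup>2" using n1 by simp
      finally have "(\<sigma> m)\<^sup>2 + Y\<^sup>2 / (real n * A) \<le> X\<^sup>2 + c\<^sup>2 / A * X\<^sup>2"
        using X \<sigma>m by (intro add_mono power_mono) auto
      also have "\<dots> = (1 + c\<^sup>2 / A) * X\<^sup>2" by (simp add: distrib_right)
      also have "\<dots> \<le> (1 + 1 / (1 - r))\<^sup>2 * X\<^sup>2" unfolding c_def by (intro mult_right_mono L(7)) auto
      finally have b: "(\<sigma> m)\<^sup>2 + Y\<^sup>2 / (real n * A) \<le> ((1 + 1 / (1 - r)) * X)\<^sup>2" by (simp add: power_mult_distrib)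
      have err: "L2_norm M (f - (\<Sum>i<n. cscale (f (x i)) (\<phi> i))) \<le> (1 + 1 / (1 - r)) * X" if f: "f \<in> H" "nrm f \<le> 1" for f
        by (rule power2_le_imp_le[OF order_trans[OF x(3)[OF f] b] RX])
      show ?thesis by (rule that[of x \<phi>]) (fact x(1,2) err[unfolded X_def \<tau>_def])+
    qed
  qed
qed

end

theorem corollary12:
  fixes M :: "'a measure"
    and H :: "('a \<Rightarrow> complex) set"
    and ip :: "('a \<Rightarrow> complex) \<Rightarrow> ('a \<Rightarrow> complex) \<Rightarrow> complex"
    and K :: "'a \<Rightarrow> 'a \<Rightarrow> complex"
    and \<sigma> :: "nat \<Rightarrow> real"
    and m n :: nat
    and r :: real
  assumes "space M \<noteq> {}"
    and "rkhs (space M) H ip K"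
    and "H \<subseteq> L2_funs M"
    and "bdd_above ((\<lambda>f. (L2_norm M f)\<^sup>2 / (ip_norm ip f)\<^sup>2) ` (H - {0}))"
    and "\<forall>f \<in> H - {0}. L2_norm M f \<noteq> 0"
    and "integrable M (\<lambda>x. K x x)"
    and "embedding_singular_values M H ip \<sigma>"
    and "1 \<le> m"
    and "m \<le> n"
    and "r = sqrt ((real m - 1) / real n)"
  shows "lin_sampling_number (space M) (L2_funs M) (L2_norm M) {f \<in> H. ip_norm ip f \<le> 1} n
    \<le> ennreal ((1 + 1 / (1 - r)) *
        (\<sigma> m + sqrt (1 / real n * (\<Sum>\<^sub>\<infinity>k\<in>{m<..}. (\<sigma> k)\<^sup>2))))"
proof -
  interpret rkhs "space M" H ip K by (rule assms(2))
  obtain C where C: "\<And>f. f \<in> H - {0} \<Longrightarrow> (L2_norm M f)\<^sup>2 / (ip_norm ip f)\<^sup>2 \<le> C"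
    using assms(4) by (auto simp: bdd_above_def)
  interpret embedded_rkhs M H ip K
  proof unfold_locales
    show "\<exists>C. \<forall>f\<in>H. (L2_norm M f)\<^sup>2 \<le> C * (ip_norm ip f)\<^sup>2"
    proof (intro exI[of _ C] ballI)
      fix f assume f: "f \<in> H"
      show "(L2_norm M f)\<^sup>2 \<le> C * (ip_norm ip f)\<^sup>2"
      proof (cases "f = 0")
        case True
        then show ?thesis using nrm_eq_0[OF zero_in] by (simp add: L2_norm_sq)
      next
        case False
        then show ?thesis using C[of f] f nrm_pos[OF f False] by (simp add: pos_divide_le_eq)
      qed
    qed
  qed (use assms in auto)
  obtain e where e: "\<And>k. 0 < \<sigma> k \<Longrightarrow> e k \<in> embedding_eigenspace M H ip ((\<sigma> k)\<^sup>2)"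
    "orthonormal_family ip {k. 0 < \<sigma> k} e"
    "\<And>t. 0 < t \<Longrightarrow> cfun.span (e ` {k. \<sigma> k = t}) = embedding_eigenspace M H ip (t\<^sup>2)"
    using singular_basis_exists[OF assms(7)] by blast
  interpret singular_basis M H ip K \<sigma> e
    using assms(7) e by unfold_locales (auto simp: embedding_singular_values_def)
  obtain x \<phi> where x: "\<And>i. i < n \<Longrightarrow> x i \<in> space M" "\<And>i. i < n \<Longrightarrow> \<phi> i \<in> H"
    "\<And>f. f \<in> H \<Longrightarrow> nrm f \<le> 1 \<Longrightarrow> L2_norm M (f - (\<Sum>i<n. cscale (f (x i)) (\<phi> i))) \<le>
      (1 + 1 / (1 - r)) * (\<sigma> m + sqrt (1 / real n * (\<Sum>\<^sub>\<infinity>k\<in>{m<..}. (\<sigma> k)\<^sup>2)))"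
    using sampling_error[OF assms(8-10,1)] by blast
  let ?x = "\<lambda>i. x (i - 1)" and ?\<phi> = "\<lambda>i. \<phi> (i - 1)"
  have mem: "(?x, ?\<phi>) \<in> ({1..n} \<rightarrow> space M) \<times> ({1..n} \<rightarrow> L2_funs M)"
    using x(1,2) in_L2 by (auto simp: Pi_iff)
  have fn: "(\<lambda>t. f t - (\<Sum>i=1..n. f (?x i) * ?\<phi> i t)) = f - (\<Sum>i<n. cscale (f (x i)) (\<phi> i))" for f
  proof
    fix t
    have "(\<Sum>i=1..n. f (?x i) * ?\<phi> i t) = (\<Sum>i<n. f (x i) * \<phi> i t)"
      by (simp add: sum.atLeast1_atMost_eq)
    then show "f t - (\<Sum>i=1..n. f (?x i) * ?\<phi> i t) = (f - (\<Sum>i<n. cscale (f (x i)) (\<phi> i))) t"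
      by (simp add: fun_diff_def sum_cscale_apply)
  qed
  show ?thesis
    unfolding lin_sampling_number_def
  proof (rule INF_lower2[OF mem])
    show "(case (?x, ?\<phi>) of (x, \<phi>) \<Rightarrow> SUP f\<in>{f \<in> H. ip_norm ip f \<le> 1}.
        ennreal (L2_norm M (\<lambda>t. f t - (\<Sum>i=1..n. f (x i) * \<phi> i t))))
      \<le> ennreal ((1 + 1 / (1 - r)) * (\<sigma> m + sqrt (1 / real n * (\<Sum>\<^sub>\<infinity>k\<in>{m<..}. (\<sigma> k)\<^sup>2))))"
      unfolding prod.case fn by (intro SUP_least ennreal_leI x(3)) simp_all
  qed
qed

end
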